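(* Let $\mathcal{P}$ be a finite chiral $n$-polytope ($n\ge4$) such that $X(\mathcal{P})$ is not isomorphic to the alternating group $A_{n+1}$. Let $\mathcal{Q}$ be the $n$-simplex. Then $\mathcal{P}\diamond\mathcal{Q}$ is chiral, and $X(\mathcal{P}\diamond\mathcal{Q})=X(\mathcal{P})$ (in particular $X(\mathcal{P}\diamond\mathcal{Q})\cong X(\mathcal{P})$).
   Context: All polytopes are abstract polytopes. A regular polytope is directly regular if its rotation group $\Gamma^+(\mathcal{P})$, generated by $\sigma_i=\rho_{i-1}\rho_i$ ($\rho_0,\dots,\rho_{n-1}$ the standard generating involutions relative to a base flag), has index $2$ in the automorphism group. The $n$-simplex $\{3^{n-1}\}$ is directly regular with rotation group $A_{n+1}$. A polytope is chiral if its automorphism group has two orbits on flags, adjacent flags lying in distinct orbits; then $\Gamma^+(\mathcal{P})$ is the full automorphism group, generated by standard rotations $\sigma_1,\dots,\sigma_{n-1}$. Let $W^+=\langle \sigma_1,\dots,\sigma_{n-1}\mid (\sigma_i\cdots\sigma_j)^2=1,\ 1\le i<j\le n-1\rangle$; each such $\Gamma^+(\mathcal{P})$ equals $W^+/M$ for a normal subgroup $M$, generators corresponding. Let $w\mapsto\overline{w}$ be the automorphism of $W^+$ with $\sigma_1\mapsto\sigma_1^{-1}$, $\sigma_2\mapsto\sigma_1^2\sigma_2$, $\sigma_j\mapsto\sigma_j$ ($j\ge3$). Mix: if $\Gamma^+(\mathcal{P})=W^+/M$ and $\Gamma^+(\mathcal{Q})=W^+/K$, the mix $\mathcal{P}\diamond\mathcal{Q}$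 is the (flag-connected pre-)polytope whose rotation group is the subgroup of $\Gamma^+(\mathcal{P})\times\Gamma^+(\mathcal{Q})$ generated by $(\sigma_i,\sigma_i')$, isomorphic to $W^+/N$ with $N=M\cap K$; it is chiral if $\overline N\ne N$ and directly regular otherwise. Chirality group: for rotation group $W^+/N$, $X=N\overline{N}/N$, the kernel of the natural epimorphism $W^+/N\to W^+/(N\overline N)$. *)

theory Defs
  imports "HOL-Algebra.Algebra"
begin

section \<open>Abstract polytopes\<close>

text \<open>
  A poset is given by its (reflexive) order relation \<open>r\<close>; its faces are the elements of
  \<^term>\<open>Field r\<close>. Ranks run from \<open>-1\<close> (least face) to \<open>n\<close> (greatest face).
\<close>

definition strictly_below :: "'a rel \<Rightarrow> 'a \<Rightarrow> 'a \<Rightarrow> bool" where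
  "strictly_below r F G \<longleftrightarrow> (F, G) \<in> r \<and> F \<noteq> G"

definition flags :: "'a rel \<Rightarrow> 'a set set" where
  "flags r = {C \<in> Chains r. \<forall>D \<in> Chains r. C \<subseteq> D \<longrightarrow> D = C}"

text \<open>The rank is one less than the length of the longest chain strictly below a face.\<close>

definition rank :: "'a rel \<Rightarrow> 'a \<Rightarrow> int" where
  "rank r F = int (Max (card ` {C \<in> Chains r. \<forall>G \<in> C. strictly_below r G F})) - 1"

definition adjacent_at :: "'a rel \<Rightarrow> nat \<Rightarrow> 'a set \<Rightarrow> 'a set \<Rightarrow> bool" where
  "adjacent_at r i \<Phi> \<Psi> \<longleftrightarrow> \<Phi> \<in> flags r \<and> \<Psi> \<in> flags r \<and> \<Phi> \<noteq> \<Psi> \<and>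
     {F \<in> \<Phi>. rank r F \<noteq> int i} = {F \<in> \<Psi>. rank r F \<noteq> int i}"

definition adjacent :: "'a rel \<Rightarrow> 'a set \<Rightarrow> 'a set \<Rightarrow> bool" where
  "adjacent r \<Phi> \<Psi> \<longleftrightarrow> (\<exists>i. adjacent_at r i \<Phi> \<Psi>)"

definition strongly_flag_connected :: "'a rel \<Rightarrow> bool" where
  "strongly_flag_connected r \<longleftrightarrow> (\<forall>\<Phi> \<in> flags r. \<forall>\<Psi> \<in> flags r.
     (\<Phi>, \<Psi>) \<in> {(A, B). adjacent r A B \<and> \<Phi> \<inter> \<Psi> \<subseteq> A \<and> \<Phi> \<inter> \<Psi> \<subseteq> B}\<^sup>*)"

definition abstract_polytope :: "nat \<Rightarrow> 'a rel \<Rightarrow> bool" where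
  "abstract_polytope n r \<longleftrightarrow>
     Partial_order r \<and>
     (\<exists>L \<in> Field r. \<forall>F \<in> Field r. (L, F) \<in> r) \<and>
     (\<exists>T \<in> Field r. \<forall>F \<in> Field r. (F, T) \<in> r) \<and>
     (\<forall>\<Phi> \<in> flags r. card \<Phi> = n + 2) \<and>
     strongly_flag_connected r \<and>
     (\<forall>F \<in> Field r. \<forall>G \<in> Field r. (F, G) \<in> r \<and> rank r G = rank r F + 2 \<longrightarrow>
        card {H. strictly_below r F H \<and> strictly_below r H G} = 2)"

definition polytope_aut_group :: "'a rel \<Rightarrow> ('a \<Rightarrow> 'a) monoid" where
  "polytope_aut_group r = BijGroup (Field r) \<lparr>carrier :=
     {f \<in> Bij (Field r). \<forall>F \<in> Field r. \<forall>G \<in> Field r. (f F, f G) \<in> r \<longleftrightarrow> (F, G) \<in> r}\<rparr>"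

definition chiral_polytope :: "nat \<Rightarrow> 'a rel \<Rightarrow> bool" where
  "chiral_polytope n r \<longleftrightarrow> abstract_polytope n r \<and>
     card (orbits (polytope_aut_group r) (flags r) image) = 2 \<and>
     (\<forall>\<Phi> \<Psi>. adjacent r \<Phi> \<Psi> \<longrightarrow>
        orbit (polytope_aut_group r) image \<Phi> \<noteq> orbit (polytope_aut_group r) image \<Psi>)"

text \<open>The face lattice of the \<open>n\<close>-simplex: all subsets of its \<open>n + 1\<close> vertices.\<close>

definition simplex :: "nat \<Rightarrow> nat set rel" where
  "simplex n = {(A, B). A \<subseteq> B \<and> B \<subseteq> {0..n}}"


section \<open>Standard generators relative to a base flag\<close>

text \<open>The \<open>i\<close>-adjacent flag, written \<open>\<Phi>\<^sup>i\<close> in comments below.\<close>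

definition adj :: "'a rel \<Rightarrow> nat \<Rightarrow> 'a set \<Rightarrow> 'a set" where
  "adj r i \<Phi> = (THE \<Psi>. adjacent_at r i \<Phi> \<Psi>)"

definition standard_reflection :: "'a rel \<Rightarrow> 'a set \<Rightarrow> nat \<Rightarrow> 'a \<Rightarrow> 'a" where
  "standard_reflection r \<Phi> i =
     (THE \<rho>. \<rho> \<in> carrier (polytope_aut_group r) \<and> \<rho> ` \<Phi> = adj r i \<Phi>)"

definition regular_rotation :: "'a rel \<Rightarrow> 'a set \<Rightarrow> nat \<Rightarrow> 'a \<Rightarrow> 'a" where
  "regular_rotation r \<Phi> i = standard_reflection r \<Phi> (i - 1)
     \<otimes>\<^bsub>polytope_aut_group r\<^esub> standard_reflection r \<Phi> i"

text \<open>
  In a chiral polytope there are no \<open>\<rho>\<^sub>i\<close>. The standard rotation \<open>\<sigma>\<^sub>i\<close> is the automorphism that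
  fixes all faces of \<open>\<Phi>\<close> except those of rank \<open>i - 1\<close> and \<open>i\<close>, and cyclically permutes the
  \<open>i\<close>-faces of the section \<open>F\<^sub>i\<^sub>+\<^sub>1/F\<^sub>i\<^sub>-\<^sub>2\<close>; it is determined by the image \<open>(\<Phi>\<^sup>i\<^sup>-\<^sup>1)\<^sup>i\<close> of \<open>\<Phi>\<close>.
  Automorphisms act on the left here, and the direction of rotation is the one of
  \<open>\<rho>\<^sub>i\<^sub>-\<^sub>1\<rho>\<^sub>i\<close> in the regular case: \<open>\<rho>\<^sub>i\<^sub>-\<^sub>1(\<rho>\<^sub>i(\<Phi>)) = \<rho>\<^sub>i\<^sub>-\<^sub>1(\<Phi>\<^sup>i) = (\<Phi>\<^sup>i\<^sup>-\<^sup>1)\<^sup>i\<close>. Passing to right actions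
  inverts every automorphism, which is an isomorphism respecting these generators.
\<close>

definition chiral_rotation :: "'a rel \<Rightarrow> 'a set \<Rightarrow> nat \<Rightarrow> 'a \<Rightarrow> 'a" where
  "chiral_rotation r \<Phi> i =
     (THE \<sigma>. \<sigma> \<in> carrier (polytope_aut_group r) \<and> \<sigma> ` \<Phi> = adj r i (adj r (i - 1) \<Phi>))"

definition rotation_group :: "nat \<Rightarrow> 'a rel \<Rightarrow> (nat \<Rightarrow> 'a \<Rightarrow> 'a) \<Rightarrow> ('a \<Rightarrow> 'a) monoid" where
  "rotation_group n r s = subgroup_generated (polytope_aut_group r) (s ` {1..n - 1})"


section \<open>Groups given by generators and relators\<close>

text \<open>
  Words over a set \<open>S\<close> of generators; the letter \<open>(x, True)\<close> stands for \<open>x\<close> and \<open>(x, False)\<close>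
  for its inverse.
\<close>

type_synonym 'g word = "('g \<times> bool) list"

definition words :: "'g set \<Rightarrow> 'g word set" where
  "words S = {w. fst ` set w \<subseteq> S}"

inductive word_eq :: "'g set \<Rightarrow> 'g word set \<Rightarrow> 'g word \<Rightarrow> 'g word \<Rightarrow> bool" for S R where
  refl: "u \<in> words S \<Longrightarrow> word_eq S R u u"
| sym: "word_eq S R u v \<Longrightarrow> word_eq S R v u"
| trans: "word_eq S R u v \<Longrightarrow> word_eq S R v w \<Longrightarrow> word_eq S R u w"
| cancel: "u \<in> words S \<Longrightarrow> v \<in> words S \<Longrightarrow> x \<in> S \<Longrightarrow>
     word_eq S R (u @ [(x, b), (x, \<not> b)] @ v) (u @ v)"
| relator: "u \<in> words S \<Longrightarrow> v \<in> words S \<Longrightarrow> w \<in> R \<Longrightarrow> w \<in> words S \<Longrightarrow>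
     word_eq S R (u @ w @ v) (u @ v)"

definition word_class :: "'g set \<Rightarrow> 'g word set \<Rightarrow> 'g word \<Rightarrow> 'g word set" where
  "word_class S R w = {v. word_eq S R w v}"

definition presented_group :: "'g set \<Rightarrow> 'g word set \<Rightarrow> 'g word set monoid" where
  "presented_group S R =
     \<lparr>carrier = word_class S R ` words S,
      monoid.mult = (\<lambda>A B. \<Union>a \<in> A. \<Union>b \<in> B. word_class S R (a @ b)),
      one = word_class S R []\<rparr>"


section \<open>The group \<open>W\<^sup>+\<close>\<close>

definition Wplus_relators :: "nat \<Rightarrow> nat word set" where
  "Wplus_relators n =
     {(let w = map (\<lambda>k. (k, True)) [i..<Suc j] in w @ w) | i j. 1 \<le> i \<and> i < j \<and> j \<le> n - 1}"

definition Wplus :: "nat \<Rightarrow> nat word set monoid" where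
  "Wplus n = presented_group {1..n - 1} (Wplus_relators n)"

definition Wplus_gen :: "nat \<Rightarrow> nat \<Rightarrow> nat word set" where
  "Wplus_gen n i = word_class {1..n - 1} (Wplus_relators n) [(i, True)]"

definition bar :: "nat \<Rightarrow> nat word set \<Rightarrow> nat word set" where
  "bar n = (THE f. f \<in> auto (Wplus n) \<and>
     f (Wplus_gen n 1) = inv\<^bsub>Wplus n\<^esub> (Wplus_gen n 1) \<and>
     f (Wplus_gen n 2) =
       (Wplus_gen n 1 [^]\<^bsub>Wplus n\<^esub> (2::nat)) \<otimes>\<^bsub>Wplus n\<^esub> Wplus_gen n 2 \<and>
     (\<forall>j \<in> {3..n - 1}. f (Wplus_gen n j) = Wplus_gen n j))"

text \<open>
  For a group \<open>G\<close> with distinguished elements \<open>s 1, \<dots>, s (n - 1)\<close> that satisfy the relations of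
  \<open>W\<^sup>+\<close> and generate \<open>G\<close>, this is the normal subgroup \<open>M\<close> with \<open>G = W\<^sup>+/M\<close>, generators
  corresponding.
\<close>

definition natural_hom :: "nat \<Rightarrow> ('b, 'm) monoid_scheme \<Rightarrow> (nat \<Rightarrow> 'b) \<Rightarrow> nat word set \<Rightarrow> 'b" where
  "natural_hom n G s = (THE f. f \<in> hom (Wplus n) G \<inter> extensional (carrier (Wplus n)) \<and>
     (\<forall>i \<in> {1..n - 1}. f (Wplus_gen n i) = s i))"

definition defining_subgroup :: "nat \<Rightarrow> ('b, 'm) monoid_scheme \<Rightarrow> (nat \<Rightarrow> 'b) \<Rightarrow> nat word set set" where
  "defining_subgroup n G s = kernel (Wplus n) G (natural_hom n G s)"


section \<open>Mix and chirality group\<close>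

text \<open>
  The mix is not a polytope in general; it is represented by its rotation group, together with
  the generators \<open>(s i, t i)\<close>.
\<close>

definition mix_gen :: "(nat \<Rightarrow> 'b) \<Rightarrow> (nat \<Rightarrow> 'c) \<Rightarrow> nat \<Rightarrow> 'b \<times> 'c" where
  "mix_gen s t i = (s i, t i)"

definition mix_group ::
  "nat \<Rightarrow> ('b, 'm) monoid_scheme \<Rightarrow> (nat \<Rightarrow> 'b) \<Rightarrow> ('c, 'k) monoid_scheme \<Rightarrow> (nat \<Rightarrow> 'c) \<Rightarrow>
     ('b \<times> 'c) monoid" where
  "mix_group n G s H t = subgroup_generated (G \<times>\<times> H) (mix_gen s t ` {1..n - 1})"

text \<open>Chirality of the object with rotation group \<open>W\<^sup>+/N\<close>; otherwise it is directly regular.\<close>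

definition chiral_subgroup :: "nat \<Rightarrow> nat word set set \<Rightarrow> bool" where
  "chiral_subgroup n N \<longleftrightarrow> bar n ` N \<noteq> N"

text \<open>The quotient of \<open>N \<cdot> bar(N)\<close> by \<open>N\<close>, a subgroup of \<open>W\<^sup>+/N\<close>.\<close>

definition chirality_group :: "nat \<Rightarrow> nat word set set \<Rightarrow> nat word set set monoid" where
  "chirality_group n N = (Wplus n \<lparr>carrier := N <#>\<^bsub>Wplus n\<^esub> (bar n ` N)\<rparr>) Mod N"

end

theory Submission
  imports Defs
begin

text \<open>
  Let \<open>M\<close> and \<open>K\<close> be the subgroups of \<open>W = W\<^sup>+\<close> defining the chiral polytope and the simplex, and
  \<open>N = M \<inter> K\<close>. The map \<open>Nx \<mapsto> Mx\<close> from \<open>N bar(N) / N\<close> to \<open>M bar(M) / M\<close> is injective because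
  \<open>bar\<close> preserves \<open>K\<close>. It is onto once \<open>bar(M) \<subseteq> M bar(N)\<close>, which is clear if \<open>bar(M) \<subseteq> K\<close>.
  Otherwise \<open>M\<close> and \<open>bar(M)\<close> both surject onto the simple group \<open>W/K = A\<^bsub>n+1\<^esub>\<close>; as this group is
  not abelian and \<open>M \<inter> bar(M)\<close> contains the commutators of \<open>M\<close> with \<open>bar(M)\<close>, also
  \<open>M \<inter> bar(M)\<close> surjects, so that \<open>bar(M) = (M \<inter> bar(M)) (bar(M) \<inter> K) \<subseteq> M bar(N)\<close>. If \<open>bar(N) = N\<close>,
  the same inclusion gives \<open>bar(M) \<subseteq> M\<close>, and then the polytope has a reflection.
\<close>


section \<open>Presented groups\<close>

text \<open>Why \<open>M\<close> surjects when bar(M) is not inside \<open>K\<close>: a normal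
  subgroup has trivial or full image in the simple quotient, and a trivial image of \<open>M\<close>
  would put bar(M) inside bar(K) = K. Why the intersection surjects: were its image trivial, any two
  elements of the quotient, one lifted to \<open>M\<close> and the other to bar(M), would commute.
  Since \<open>bar\<close> is an involution preserving \<open>K\<close>, the part of bar(M) in
  \<open>K\<close> lies in bar(N). The bound on n enters as n + 1 >= 5, where the alternating group
  is simple.

  The objects named by \<open>THE\<close> need existence and uniqueness first. For
  \<open>bar\<close> and the natural maps these come from the universal property of the
  presentation, for adjacent flags from the diamond condition, for rotations and reflections from
  rigidity: an automorphism is determined by its value on one flag. The final reflection is the hard
  one: the group only yields a map of flags, and turning it into a map of faces takes strong
  flag-connectedness in full, with paths that keep the common faces.\<close>

lemma words_simps [simp]:
  "[] \<in> words S" "a # w \<in> words S \<longleftrightarrow> fst a \<in> S \<and> w \<in> words S"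
  "u @ v \<in> words S \<longleftrightarrow> u \<in> words S \<and> v \<in> words S"
  by (auto simp: words_def)

lemma word_eq_words: "word_eq S R u v \<Longrightarrow> u \<in> words S \<and> v \<in> words S"
  by (induction rule: word_eq.induct) auto

lemma word_eq_context:
  assumes "word_eq S R u v" "a \<in> words S" "b \<in> words S"
  shows "word_eq S R (a @ u @ b) (a @ v @ b)"
  using assms(1)
proof induction
  case (refl u)
  then show ?case using assms by (intro word_eq.refl) simp
next
  case (sym u v)
  show ?case using sym.IH by (rule word_eq.sym)
next
  case (trans u v w)
  show ?case using trans.IH by (rule word_eq.trans)
next
  case (cancel u v x c)
  then show ?case using assms word_eq.cancel[of "a @ u" S "v @ b" x R c] by simp
next
  case (relator u v w)
  then show ?case using assms word_eq.relator[of "a @ u" S "v @ b" w R] by simp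
qed

text \<open>Makes \<open>word_eq\<close> a congruence; the two factors are replaced one at a
  time.\<close>

lemma word_eq_append:
  assumes "word_eq S R u u'" "word_eq S R v v'"
  shows "word_eq S R (u @ v) (u' @ v')"
  using word_eq_context[OF assms(1), of "[]" v] word_eq_context[OF assms(2), of u' "[]"]
    word_eq_words[OF assms(1)] word_eq_words[OF assms(2)] word_eq.trans[of S R "u @ v" "u' @ v" "u' @ v'"]
  by simp

text \<open>The hypothesis matters: words with letters outside \<open>S\<close> all have the empty
  class, yet they are related to nothing.\<close>

lemma word_class_eq_iff:
  assumes "u \<in> words S"
  shows "word_class S R u = word_class S R v \<longleftrightarrow> word_eq S R u v"
proof
  assume "word_class S R u = word_class S R v"
  then have "u \<in> word_class S R v" using word_eq.refl[OF assms, of R] by (auto simp: word_class_def)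
  then show "word_eq S R u v" by (simp add: word_class_def word_eq.sym)
next
  assume "word_eq S R u v"
  then have "word_eq S R u w \<longleftrightarrow> word_eq S R v w" for w
    using word_eq.sym[of S R u v] word_eq.trans[of S R u v w] word_eq.trans[of S R v u w] by blast
  then show "word_class S R u = word_class S R v" by (simp add: word_class_def)
qed

text \<open>The product is defined as a union over all representatives. By congruence the members of
  this union coincide, and since classes are nonempty it does not collapse to the empty set.\<close>

lemma presented_group_mult:
  assumes "u \<in> words S" "v \<in> words S"
  shows "word_class S R u \<otimes>\<^bsub>presented_group S R\<^esub> word_class S R v = word_class S R (u @ v)"
proof -
  have *: "word_class S R (a @ b) = word_class S R (u @ v)"
    if "a \<in> word_class S R u" "b \<in> word_class S R v" for a b
  proof -
    have "word_eq S R (u @ v) (a @ b)" using that word_eq_append[of S R u a v b] by (simp add: word_class_def)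
    then show ?thesis using assms by (simp add: word_class_eq_iff[symmetric])
  qed
  have ne: "word_class S R u \<noteq> {}" "word_class S R v \<noteq> {}"
    using assms word_eq.refl[of _ S R] by (auto simp: word_class_def)
  have "word_class S R u \<otimes>\<^bsub>presented_group S R\<^esub> word_class S R v =
      (\<Union>a \<in> word_class S R u. \<Union>b \<in> word_class S R v. word_class S R (a @ b))"
    by (simp add: presented_group_def)
  also have "\<dots> = (\<Union>a \<in> word_class S R u. \<Union>b \<in> word_class S R v. word_class S R (u @ v))"
    by (intro SUP_cong HOL.refl *)
  finally show ?thesis using ne by simp
qed

lemma presented_group_simps [simp]:
  "carrier (presented_group S R) = word_class S R ` words S"
  "one (presented_group S R) = word_class S R []"
  by (simp_all add: presented_group_def)

definition inverse_word :: "'g word \<Rightarrow> 'g word" where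
  "inverse_word w = rev (map (\<lambda>(x, b). (x, \<not> b)) w)"

lemma inverse_word_in_words [simp]: "inverse_word w \<in> words S \<longleftrightarrow> w \<in> words S"
  by (auto simp: inverse_word_def words_def image_image split_beta)

lemma word_eq_inverse_left:
  "w \<in> words S \<Longrightarrow> word_eq S R (inverse_word w @ w) []"
proof (induction w)
  case Nil
  then show ?case by (simp add: inverse_word_def word_eq.refl)
next
  case (Cons a w)
  obtain x b where a: "a = (x, b)" by force
  \<comment> \<open>The double negation is \<open>b\<close> itself; it is written out to match the
    rule \<open>cancel\<close> for the letter with exponent \<open>\<not> b\<close>.\<close>
  have "word_eq S R (inverse_word w @ [(x, \<not> b), (x, \<not> \<not> b)] @ w) (inverse_word w @ w)"
    using Cons.prems by (intro word_eq.cancel) (auto simp: a)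
  moreover have "word_eq S R (inverse_word w @ w) []" using Cons by simp
  ultimately show ?case by (simp add: inverse_word_def a word_eq.trans)
qed

lemma group_presented_group: "group (presented_group S R)"
proof (rule groupI)
  fix A assume "A \<in> carrier (presented_group S R)"
  then obtain u where u: "u \<in> words S" "A = word_class S R u" by auto
  then show "\<one>\<^bsub>presented_group S R\<^esub> \<otimes>\<^bsub>presented_group S R\<^esub> A = A"
    by (simp add: presented_group_mult)
  show "\<exists>B\<in>carrier (presented_group S R). B \<otimes>\<^bsub>presented_group S R\<^esub> A = \<one>\<^bsub>presented_group S R\<^esub>"
    using u by (auto intro!: bexI[of _ "inverse_word u"]
        simp: presented_group_mult word_class_eq_iff word_eq_inverse_left)
qed (auto simp: presented_group_mult)

section \<open>Evaluation of words and the universal property of a presentation\<close>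

primrec word_eval :: "('b, 'm) monoid_scheme \<Rightarrow> ('g \<Rightarrow> 'b) \<Rightarrow> 'g word \<Rightarrow> 'b" where
  "word_eval G s [] = \<one>\<^bsub>G\<^esub>"
| "word_eval G s (a # w) = (if snd a then s (fst a) else inv\<^bsub>G\<^esub> s (fst a)) \<otimes>\<^bsub>G\<^esub> word_eval G s w"

context group
begin

lemma word_eval_closed [simp]:
  "s \<in> S \<rightarrow> carrier G \<Longrightarrow> w \<in> words S \<Longrightarrow> word_eval G s w \<in> carrier G"
  by (induction w) auto

lemma word_eval_append:
  assumes "s \<in> S \<rightarrow> carrier G" "u \<in> words S" "v \<in> words S"
  shows "word_eval G s (u @ v) = word_eval G s u \<otimes> word_eval G s v"
  using assms(2) by (induction u) (use assms in \<open>auto simp: m_assoc Pi_iff\<close>)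

text \<open>The core of von Dyck's theorem: once the relators evaluate to 1, the value of a word
  depends only on its class.\<close>

lemma word_eval_cong:
  assumes "word_eq S R u v" and s: "s \<in> S \<rightarrow> carrier G"
    and R: "\<And>w. w \<in> R \<Longrightarrow> w \<in> words S \<Longrightarrow> word_eval G s w = \<one>"
  shows "word_eval G s u = word_eval G s v"
  using assms(1)
proof induction
  case (cancel u v x b)
  then have "s x \<in> carrier G" using s by auto
  then have "word_eval G s ([(x, b), (x, \<not> b)] @ v) = word_eval G s v"
    using word_eval_closed[OF s cancel(2)] by (cases b) (auto simp flip: m_assoc)
  then show ?case using cancel word_eval_append[OF s cancel(1), of "[(x, b), (x, \<not> b)] @ v"]
      word_eval_append[OF s cancel(1,2)] by simp
next
  case (relator u v w)
  then show ?case using word_eval_append[OF s] word_eval_closed[OF s] R by simp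
qed auto

lemma hom_word_eval:
  assumes "group H" "h \<in> hom G H" "s \<in> S \<rightarrow> carrier G" "w \<in> words S"
  shows "h (word_eval G s w) = word_eval H (\<lambda>x. h (s x)) w"
proof -
  interpret h: group_hom G H h
    using assms by (simp add: group_hom_def group_hom_axioms_def is_group)
  show ?thesis using assms(4) by (induction w) (use assms in \<open>auto simp: Pi_iff\<close>)
qed

end

text \<open>Every element is the value of a word at the generators, so homomorphisms can be compared
  through \<open>hom_word_eval\<close>.\<close>

lemma presented_group_word_eval:
  assumes "w \<in> words S"
  shows "word_eval (presented_group S R) (\<lambda>x. word_class S R [(x, True)]) w = word_class S R w"
proof -
  interpret group "presented_group S R" by (rule group_presented_group)
  have inv: "inv\<^bsub>presented_group S R\<^esub> word_class S R [(x, True)] = word_class S R [(x, False)]" if "x \<in> S" for x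
    using that word_eq.cancel[of "[]" S "[]" x R False]
    by (intro inv_equality) (auto simp: presented_group_mult word_class_eq_iff)
  show ?thesis using assms
  proof (induction w)
    case (Cons a w)
    obtain x b where "a = (x, b)" by force
    then show ?case using Cons inv[of x] by (cases b) (auto simp: presented_group_mult)
  qed simp
qed

text \<open>Von Dyck's theorem. Extensionality fixes the values off the carrier, so that the map is
  unique as a function, as the \<open>THE\<close> in \<open>natural_hom\<close> demands.\<close>

lemma presented_group_hom_exists:
  assumes "group G" and s: "s \<in> S \<rightarrow> carrier G"
    and R: "\<And>w. w \<in> R \<Longrightarrow> w \<in> words S \<Longrightarrow> word_eval G s w = \<one>\<^bsub>G\<^esub>"
  shows "\<exists>f \<in> hom (presented_group S R) G \<inter> extensional (carrier (presented_group S R)).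
    \<forall>x \<in> S. f (word_class S R [(x, True)]) = s x"
proof -
  interpret group G by fact
  define f where "f = (\<lambda>A \<in> carrier (presented_group S R). word_eval G s (SOME w. w \<in> A))"
  have f: "f (word_class S R w) = word_eval G s w" if "w \<in> words S" for w
  proof -
    have "w \<in> word_class S R w" using that by (simp add: word_class_def word_eq.refl)
    then have "(SOME v. v \<in> word_class S R w) \<in> word_class S R w" by (rule someI)
    then have "word_eq S R w (SOME v. v \<in> word_class S R w)" by (simp add: word_class_def)
    then show ?thesis using word_eval_cong[OF _ s R] that by (simp add: f_def)
  qed
  show ?thesis
  proof (intro bexI[of _ f] ballI IntI homI)
    fix x assume "x \<in> S"
    then show "f (word_class S R [(x, True)]) = s x" using s by (subst f) (auto simp: Pi_iff)
  next
    show "f \<in> extensional (carrier (presented_group S R))" by (simp add: f_def)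
  next
    fix A assume "A \<in> carrier (presented_group S R)"
    then show "f A \<in> carrier G" using f word_eval_closed[OF s] by auto
  next
    fix A B assume "A \<in> carrier (presented_group S R)" "B \<in> carrier (presented_group S R)"
    then show "f (A \<otimes>\<^bsub>presented_group S R\<^esub> B) = f A \<otimes>\<^bsub>G\<^esub> f B"
      using f word_eval_append[OF s] by (auto simp: presented_group_mult)
  qed
qed

lemma presented_group_hom_unique:
  assumes "group G" "f \<in> hom (presented_group S R) G" "h \<in> hom (presented_group S R) G"
    and "\<And>x. x \<in> S \<Longrightarrow> f (word_class S R [(x, True)]) = h (word_class S R [(x, True)])"
    and "A \<in> carrier (presented_group S R)"
  shows "f A = h A"
proof -
  interpret group "presented_group S R" by (rule group_presented_group)
  obtain w where w: "w \<in> words S" "A = word_class S R w" using assms(5) by auto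
  let ?g = "\<lambda>x. word_class S R [(x, True)]"
  have g: "?g \<in> S \<rightarrow> carrier (presented_group S R)" by auto
  have "word_eval G (\<lambda>x. f (?g x)) w = word_eval G (\<lambda>x. h (?g x)) w"
    using w(1) by (induction w) (auto simp: assms(4))
  then show ?thesis
    using hom_word_eval[OF assms(1,2) g w(1)] hom_word_eval[OF assms(1,3) g w(1)]
      presented_group_word_eval[OF w(1), of R] w(2) by simp
qed


section \<open>The group \<open>W\<^sup>+\<close>\<close>

text \<open>The product \<open>s i ... s j\<close>, encoded as the value of the very word that is
  doubled in the relators, so that a relator evaluates to the square of such a product.\<close>

definition rot_prod :: "('b, 'm) monoid_scheme \<Rightarrow> (nat \<Rightarrow> 'b) \<Rightarrow> nat \<Rightarrow> nat \<Rightarrow> 'b" where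
  "rot_prod G s i j = word_eval G s (map (\<lambda>k. (k, True)) [i..<Suc j])"

lemma rot_prod_word: "{i..j} \<subseteq> S \<Longrightarrow> map (\<lambda>k. (k, True)) [i..<Suc j] \<in> words S"
  by (auto simp: words_def simp del: upt_Suc)

lemma rot_prod_empty: "j < i \<Longrightarrow> rot_prod G s i j = \<one>\<^bsub>G\<^esub>"
  by (simp add: rot_prod_def)

lemma rot_prod_rec: "i \<le> j \<Longrightarrow> rot_prod G s i j = s i \<otimes>\<^bsub>G\<^esub> rot_prod G s (Suc i) j"
  by (simp add: rot_prod_def upt_conv_Cons del: upt_Suc)

lemma rot_prod_cong:
  assumes "\<And>k. i \<le> k \<Longrightarrow> k \<le> j \<Longrightarrow> s k = t k"
  shows "rot_prod G s i j = rot_prod G t i j"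
proof -
  have "word_eval G s (map (\<lambda>k. (k, True)) xs) = word_eval G t (map (\<lambda>k. (k, True)) xs)"
    if "set xs \<subseteq> {i..j}" for xs
    using that by (induction xs) (auto simp: assms)
  from this[of "[i..<Suc j]"] show ?thesis unfolding rot_prod_def by (simp del: upt_Suc add: subset_iff)
qed

context group
begin

lemma rot_prod_closed [simp]: "s \<in> {i..j} \<rightarrow> carrier G \<Longrightarrow> rot_prod G s i j \<in> carrier G"
  unfolding rot_prod_def by (rule word_eval_closed[where S = "{i..j}"]) (auto intro: rot_prod_word simp del: upt_Suc)

lemma rot_prod_single: "s i \<in> carrier G \<Longrightarrow> rot_prod G s i i = s i"
  by (simp add: rot_prod_rec rot_prod_empty)

lemma hom_rot_prod:
  assumes "group H" "h \<in> hom G H" "s \<in> {i..j} \<rightarrow> carrier G"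
  shows "h (rot_prod G s i j) = rot_prod H (\<lambda>x. h (s x)) i j"
  unfolding rot_prod_def by (rule hom_word_eval[OF assms rot_prod_word]) simp

end

section \<open>Groups satisfying the relations of W+, and the kernels of their natural maps\<close>

definition Wplus_relations :: "nat \<Rightarrow> ('b, 'm) monoid_scheme \<Rightarrow> (nat \<Rightarrow> 'b) \<Rightarrow> bool" where
  "Wplus_relations n G s \<longleftrightarrow> s \<in> {1..n - 1} \<rightarrow> carrier G \<and>
     (\<forall>i j. 1 \<le> i \<and> i < j \<and> j \<le> n - 1 \<longrightarrow> rot_prod G s i j \<otimes>\<^bsub>G\<^esub> rot_prod G s i j = \<one>\<^bsub>G\<^esub>)"

lemma Wplus_relators_iff:
  "w \<in> Wplus_relators n \<longleftrightarrow> (\<exists>i j. 1 \<le> i \<and> i < j \<and> j \<le> n - 1 \<and>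
     w = map (\<lambda>k. (k, True)) [i..<Suc j] @ map (\<lambda>k. (k, True)) [i..<Suc j])"
  unfolding Wplus_relators_def Let_def by blast

lemma (in group) Wplus_relations_iff:
  "Wplus_relations n G s \<longleftrightarrow> s \<in> {1..n - 1} \<rightarrow> carrier G \<and>
     (\<forall>w \<in> Wplus_relators n. word_eval G s w = \<one>)"
proof -
  have *: "word_eval G s (map (\<lambda>k. (k, True)) [i..<Suc j] @ map (\<lambda>k. (k, True)) [i..<Suc j]) =
      rot_prod G s i j \<otimes> rot_prod G s i j"
    if "s \<in> {1..n - 1} \<rightarrow> carrier G" "1 \<le> i" "j \<le> n - 1" for i j
    using word_eval_append[OF that(1) rot_prod_word rot_prod_word] that by (simp add: rot_prod_def)
  have "(\<forall>w \<in> Wplus_relators n. word_eval G s w = \<one>) \<longleftrightarrow>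
      (\<forall>i j. 1 \<le> i \<and> i < j \<and> j \<le> n - 1 \<longrightarrow> rot_prod G s i j \<otimes> rot_prod G s i j = \<one>)"
    if "s \<in> {1..n - 1} \<rightarrow> carrier G"
    unfolding Ball_def Wplus_relators_iff using *[OF that] by metis
  then show ?thesis unfolding Wplus_relations_def by blast
qed

lemma group_Wplus: "group (Wplus n)"
  unfolding Wplus_def by (rule group_presented_group)

lemma Wplus_gen_closed [simp]: "1 \<le> i \<Longrightarrow> i \<le> n - 1 \<Longrightarrow> Wplus_gen n i \<in> carrier (Wplus n)"
  unfolding Wplus_def Wplus_gen_def by auto

lemma Wplus_relations_Wplus: "Wplus_relations n (Wplus n) (Wplus_gen n)"
proof -
  interpret group "Wplus n" by (rule group_Wplus)
  have "word_eval (Wplus n) (Wplus_gen n) w = \<one>\<^bsub>Wplus n\<^esub>" if "w \<in> Wplus_relators n" for w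
  proof -
    have w: "w \<in> words {1..n - 1}"
      using that unfolding Wplus_relators_iff by (auto simp: words_def)
    then have "word_eval (Wplus n) (Wplus_gen n) w = word_class {1..n - 1} (Wplus_relators n) w"
      unfolding Wplus_def Wplus_gen_def by (rule presented_group_word_eval)
    also have "\<dots> = word_class {1..n - 1} (Wplus_relators n) []"
      using word_eq.relator[of "[]" "{1..n - 1}" "[]" w "Wplus_relators n"] that w
      by (simp add: word_class_eq_iff)
    finally show ?thesis by (simp add: Wplus_def)
  qed
  then show ?thesis unfolding Wplus_relations_iff by auto
qed

lemma Wplus_hom_unique:
  assumes "group G" "f \<in> hom (Wplus n) G" "h \<in> hom (Wplus n) G"
    and "\<And>i. 1 \<le> i \<Longrightarrow> i \<le> n - 1 \<Longrightarrow> f (Wplus_gen n i) = h (Wplus_gen n i)"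
    and "w \<in> carrier (Wplus n)"
  shows "f w = h w"
  using assms presented_group_hom_unique[of G f "{1..n - 1}" "Wplus_relators n" h w]
  unfolding Wplus_def Wplus_gen_def by auto

lemma natural_hom:
  assumes "group G" "Wplus_relations n G s"
  shows "natural_hom n G s \<in> hom (Wplus n) G" "natural_hom n G s \<in> extensional (carrier (Wplus n))"
    and "\<And>i. 1 \<le> i \<Longrightarrow> i \<le> n - 1 \<Longrightarrow> natural_hom n G s (Wplus_gen n i) = s i"
proof -
  let ?P = "\<lambda>f. f \<in> hom (Wplus n) G \<inter> extensional (carrier (Wplus n)) \<and>
     (\<forall>i \<in> {1..n - 1}. f (Wplus_gen n i) = s i)"
  have "\<exists>f. ?P f"
    using presented_group_hom_exists[of G s "{1..n - 1}" "Wplus_relators n"] assms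
    unfolding group.Wplus_relations_iff[OF assms(1)] Wplus_def Wplus_gen_def by blast
  moreover have "f = h" if "?P f" "?P h" for f h
    by (rule extensionalityI[of _ "carrier (Wplus n)"])
      (use that Wplus_hom_unique[OF assms(1), of f n h] in auto)
  ultimately have "\<exists>!f. ?P f" by blast
  from theI'[OF this] have "?P (natural_hom n G s)" unfolding natural_hom_def .
  then show "natural_hom n G s \<in> hom (Wplus n) G" "natural_hom n G s \<in> extensional (carrier (Wplus n))"
    "\<And>i. 1 \<le> i \<Longrightarrow> i \<le> n - 1 \<Longrightarrow> natural_hom n G s (Wplus_gen n i) = s i" by auto
qed

text \<open>Lets the kernel be computed in another model \<open>H\<close>: \<open>f\<close> after
  \<open>h\<close> agrees with the natural map on generators, hence everywhere, and an injective
  \<open>f\<close> does not enlarge the kernel. It serves to replace automorphisms of the simplex by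
  permutations.\<close>

lemma defining_subgroup_eq_kernel:
  assumes "group G" "Wplus_relations n G s" "group H" "h \<in> hom (Wplus n) H" "f \<in> hom H G"
    and "inj_on f (carrier H)"
    and "\<And>i. 1 \<le> i \<Longrightarrow> i \<le> n - 1 \<Longrightarrow> f (h (Wplus_gen n i)) = s i"
  shows "defining_subgroup n G s = kernel (Wplus n) H h"
proof -
  interpret f: group_hom H G f using assms by (simp add: group_hom_def group_hom_axioms_def)
  have "natural_hom n G s w = f (h w)" if "w \<in> carrier (Wplus n)" for w
    using Wplus_hom_unique[OF assms(1) natural_hom(1)[OF assms(1,2)] hom_compose[OF assms(4,5)] _ that]
      natural_hom(3)[OF assms(1,2)] assms(7) by auto
  moreover have "f x = \<one>\<^bsub>G\<^esub> \<longleftrightarrow> x = \<one>\<^bsub>H\<^esub>" if "x \<in> carrier H" for x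
    using assms(6) that by (metis f.hom_one f.G.one_closed inj_on_eq_iff)
  moreover have "h w \<in> carrier H" if "w \<in> carrier (Wplus n)" for w
    using assms(4) that by (auto simp: hom_def)
  ultimately show ?thesis unfolding defining_subgroup_def kernel_def by auto
qed

text \<open>The product of the rotations from \<open>i\<close> to \<open>j\<close> telescopes to
  \<open>r (i - 1) \<otimes> r j\<close>. For \<open>i < j\<close> the two indices differ by at
  least 2, so these involutions commute and the product squares to 1.\<close>

lemma (in group) Wplus_relations_reflections:
  assumes r: "\<And>k. k < n \<Longrightarrow> r k \<in> carrier G" and r2: "\<And>k. k < n \<Longrightarrow> r k \<otimes> r k = \<one>"
    and comm: "\<And>k l. Suc k < l \<Longrightarrow> l < n \<Longrightarrow> r k \<otimes> r l = r l \<otimes> r k"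
    and s: "\<And>i. 1 \<le> i \<Longrightarrow> i \<le> n - 1 \<Longrightarrow> s i = r (i - 1) \<otimes> r i"
  shows "Wplus_relations n G s"
proof -
  have rr: "r k \<otimes> (r k \<otimes> x) = x" if "k < n" "x \<in> carrier G" for k x
    using r r2 that by (simp flip: m_assoc)
  have *: "rot_prod G s i j = r (i - 1) \<otimes> r j" if "1 \<le> i" "i \<le> j" "j \<le> n - 1" for i j
    using that(2,1)
  proof (induction i rule: inc_induct)
    case base
    then show ?case using that r s by (simp add: rot_prod_single)
  next
    case (step k)
    then show ?case using that r s rr[of k "r j"] by (simp add: rot_prod_rec m_assoc)
  qed
  show ?thesis unfolding Wplus_relations_def
  proof (intro conjI allI impI)
    show "s \<in> {1..n - 1} \<rightarrow> carrier G" using r s by auto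
    fix i j assume ij: "1 \<le> i \<and> i < j \<and> j \<le> n - 1"
    then have lt: "i - 1 < n" "j < n" "Suc (i - 1) < j" by auto
    then have "r (i - 1) \<otimes> r j \<otimes> (r (i - 1) \<otimes> r j) = r (i - 1) \<otimes> r j \<otimes> (r j \<otimes> r (i - 1))"
      using comm by simp
    also have "\<dots> = \<one>" using lt r r2 rr by (simp add: m_assoc)
    finally show "rot_prod G s i j \<otimes> rot_prod G s i j = \<one>" using * ij by simp
  qed
qed

lemma Wplus_relations_hom:
  assumes "group G" "group H" "h \<in> hom G H" "Wplus_relations n G s"
    and t: "\<And>i. 1 \<le> i \<Longrightarrow> i \<le> n - 1 \<Longrightarrow> t i = h (s i)"
  shows "Wplus_relations n H t"
  unfolding Wplus_relations_def
proof (intro conjI allI impI)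
  interpret h: group_hom G H h using assms by (simp add: group_hom_def group_hom_axioms_def)
  have s: "s \<in> {1..n - 1} \<rightarrow> carrier G" using assms(4) by (simp add: Wplus_relations_def)
  show "t \<in> {1..n - 1} \<rightarrow> carrier H" using s t h.hom_closed by (auto simp: Pi_iff)
  fix i j assume ij: "1 \<le> i \<and> i < j \<and> j \<le> n - 1"
  have sij: "s \<in> {i..j} \<rightarrow> carrier G" using s ij by auto
  have "rot_prod H t i j = rot_prod H (\<lambda>k. h (s k)) i j" by (rule rot_prod_cong) (use t ij in auto)
  also have "\<dots> = h (rot_prod G s i j)" by (rule group.hom_rot_prod[OF assms(1-3) sij, symmetric])
  finally have "rot_prod H t i j \<otimes>\<^bsub>H\<^esub> rot_prod H t i j = h (rot_prod G s i j \<otimes>\<^bsub>G\<^esub> rot_prod G s i j)"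
    using group.rot_prod_closed[OF assms(1) sij] by simp
  also have "\<dots> = \<one>\<^bsub>H\<^esub>" using assms(4) ij by (simp add: Wplus_relations_def)
  finally show "rot_prod H t i j \<otimes>\<^bsub>H\<^esub> rot_prod H t i j = \<one>\<^bsub>H\<^esub>" .
qed

lemma rot_prod_subgroup_generated:
  "rot_prod (subgroup_generated G S) s i j = rot_prod G s i j"
proof -
  have "word_eval (subgroup_generated G S) s (map (\<lambda>k. (k, True)) xs) = word_eval G s (map (\<lambda>k. (k, True)) xs)" for xs
    by (induction xs) (auto simp: subgroup_generated_def)
  then show ?thesis unfolding rot_prod_def .
qed

lemma rot_prod_DirProd:
  "rot_prod (G \<times>\<times> H) (\<lambda>i. (s i, t i)) i j = (rot_prod G s i j, rot_prod H t i j)"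
proof -
  have "word_eval (G \<times>\<times> H) (\<lambda>i. (s i, t i)) (map (\<lambda>k. (k, True)) xs) =
      (word_eval G s (map (\<lambda>k. (k, True)) xs), word_eval H t (map (\<lambda>k. (k, True)) xs))" for xs
    by (induction xs) auto
  then show ?thesis unfolding rot_prod_def .
qed

lemma Wplus_relations_subgroup_generated:
  assumes "group G" "Wplus_relations n G s"
  shows "Wplus_relations n (subgroup_generated G (s ` {1..n - 1})) s"
proof -
  interpret group G by fact
  have "s ` {1..n - 1} \<subseteq> carrier (subgroup_generated G (s ` {1..n - 1}))"
    by (rule subgroup_generated_subset_carrier_subset) (use assms in \<open>auto simp: Wplus_relations_def\<close>)
  then show ?thesis using assms(2)
    unfolding Wplus_relations_def rot_prod_subgroup_generated by (auto simp: subgroup_generated_def)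
qed

lemma Wplus_relations_DirProd:
  assumes "Wplus_relations n G s" "Wplus_relations n H t"
  shows "Wplus_relations n (G \<times>\<times> H) (mix_gen s t)"
proof -
  have "mix_gen s t = (\<lambda>i. (s i, t i))" by (simp add: mix_gen_def fun_eq_iff)
  then show ?thesis using assms unfolding Wplus_relations_def by (auto simp: rot_prod_DirProd Pi_iff)
qed

text \<open>Restricting the codomain does not change the kernel. Rotation groups and mixes can
  therefore be treated inside the full automorphism groups and their product.\<close>

lemma defining_subgroup_subgroup_generated:
  assumes "group G" "Wplus_relations n G s"
  shows "defining_subgroup n (subgroup_generated G (s ` {1..n - 1})) s = defining_subgroup n G s"
proof -
  interpret group G by fact
  let ?H = "subgroup_generated G (s ` {1..n - 1})"
  have grp: "group ?H" by (rule group_subgroup_generated)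
  note nat = natural_hom[OF grp Wplus_relations_subgroup_generated[OF assms]]
  have "natural_hom n ?H s \<in> hom (Wplus n) G"
    using nat(1) carrier_subgroup_generated_subset[of "s ` {1..n - 1}"] by (auto simp: hom_def Pi_iff)
  then have "natural_hom n ?H s w = natural_hom n G s w" if "w \<in> carrier (Wplus n)" for w
    by (rule Wplus_hom_unique[OF assms(1) _ natural_hom(1)[OF assms]])
      (use nat(3) natural_hom(3)[OF assms] that in auto)
  then show ?thesis unfolding defining_subgroup_def kernel_def by auto
qed

text \<open>The identity N = M \<inter> K for a mix: by uniqueness, the natural map into the product
  is the pair of natural maps.\<close>

lemma defining_subgroup_DirProd:
  assumes "group G" "Wplus_relations n G s" "group H" "Wplus_relations n H t"
  shows "defining_subgroup n (G \<times>\<times> H) (mix_gen s t) = defining_subgroup n G s \<inter> defining_subgroup n H t"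
proof -
  have grp: "group (G \<times>\<times> H)" using assms by (simp add: DirProd_group)
  have rel: "Wplus_relations n (G \<times>\<times> H) (mix_gen s t)" using assms by (intro Wplus_relations_DirProd)
  let ?f = "\<lambda>w. (natural_hom n G s w, natural_hom n H t w)"
  have "?f \<in> hom (Wplus n) (G \<times>\<times> H)"
    using natural_hom(1)[OF assms(1,2)] natural_hom(1)[OF assms(3,4)] by (auto simp: hom_def Pi_iff)
  then have "natural_hom n (G \<times>\<times> H) (mix_gen s t) w = ?f w" if "w \<in> carrier (Wplus n)" for w
    by (rule Wplus_hom_unique[OF grp natural_hom(1)[OF grp rel]])
      (use natural_hom(3)[OF grp rel] natural_hom(3)[OF assms(1,2)] natural_hom(3)[OF assms(3,4)] that
        in \<open>auto simp: mix_gen_def\<close>)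
  then show ?thesis unfolding defining_subgroup_def kernel_def by auto
qed

lemma normal_defining_subgroup:
  assumes "group G" "Wplus_relations n G s"
  shows "defining_subgroup n G s \<lhd> Wplus n"
proof -
  interpret group_hom "Wplus n" G "natural_hom n G s"
    using assms natural_hom(1)[OF assms] group_Wplus by (simp add: group_hom_def group_hom_axioms_def)
  show ?thesis unfolding defining_subgroup_def by (rule normal_kernel)
qed

text \<open>The values of \<open>bar\<close> on generators, read in an arbitrary group. They come
  from conjugation by rho_0 when there are reflections: rho_0 inverts rho_0 rho_1, commutes with all
  rho_j for j >= 2, and takes rho_1 rho_2 to rho_0 rho_1 rho_0 rho_2 = (rho_0 rho_1)(rho_0
  rho_1)(rho_1 rho_2).\<close>

definition bar_gens :: "('b, 'm) monoid_scheme \<Rightarrow> (nat \<Rightarrow> 'b) \<Rightarrow> nat \<Rightarrow> 'b" where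
  "bar_gens G s i = (if i = 1 then inv\<^bsub>G\<^esub> s 1 else if i = 2 then s 1 \<otimes>\<^bsub>G\<^esub> s 1 \<otimes>\<^bsub>G\<^esub> s 2 else s i)"

text \<open>In a product from 1 the new first factor cancels one of the two \<open>s 1\<close> that
  the second one brings; in a product from 2 both remain.\<close>

lemma (in group) bar_gens:
  assumes s: "s \<in> {1..n - 1} \<rightarrow> carrier G" and j: "2 \<le> j" "j \<le> n - 1"
  shows rot_prod_bar_gens_1: "rot_prod G (bar_gens G s) 1 j = rot_prod G s 1 j" 
    and rot_prod_bar_gens_2: "rot_prod G (bar_gens G s) 2 j = s 1 \<otimes> rot_prod G s 1 j"
proof -
  have c: "s 1 \<in> carrier G" "s 2 \<in> carrier G" "rot_prod G s 3 j \<in> carrier G"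
    using s j by (auto intro!: rot_prod_closed)
  have 3: "rot_prod G (bar_gens G s) 3 j = rot_prod G s 3 j"
    by (rule rot_prod_cong) (simp add: bar_gens_def)
  have s2: "rot_prod G s 2 j = s 2 \<otimes> rot_prod G s 3 j" using j by (simp add: rot_prod_rec eval_nat_numeral)
  have s1: "rot_prod G s 1 j = s 1 \<otimes> rot_prod G s 2 j" using j by (simp add: rot_prod_rec eval_nat_numeral)
  have "rot_prod G (bar_gens G s) 2 j = bar_gens G s 2 \<otimes> rot_prod G (bar_gens G s) 3 j"
    using j by (simp add: rot_prod_rec eval_nat_numeral)
  also have "\<dots> = s 1 \<otimes> rot_prod G s 1 j"
    using c unfolding 3 s1 s2 by (simp add: bar_gens_def m_assoc)
  finally show *: "rot_prod G (bar_gens G s) 2 j = s 1 \<otimes> rot_prod G s 1 j" .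
  have "rot_prod G (bar_gens G s) 1 j = bar_gens G s 1 \<otimes> rot_prod G (bar_gens G s) 2 j"
    using j by (simp add: rot_prod_rec eval_nat_numeral)
  also have "\<dots> = rot_prod G s 1 j"
    using c unfolding * s1 s2 by (simp add: bar_gens_def flip: m_assoc)
  finally show "rot_prod G (bar_gens G s) 1 j = rot_prod G s 1 j" .
qed

lemma (in group) Wplus_relations_bar_gens:
  assumes n: "n \<ge> 3" and rel: "Wplus_relations n G s"
  shows "Wplus_relations n G (bar_gens G s)"
proof -
  have s: "s \<in> {1..n - 1} \<rightarrow> carrier G"
    and sq: "\<And>i j. 1 \<le> i \<Longrightarrow> i < j \<Longrightarrow> j \<le> n - 1 \<Longrightarrow> rot_prod G s i j \<otimes> rot_prod G s i j = \<one>"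
    using rel by (auto simp: Wplus_relations_def)
  show ?thesis unfolding Wplus_relations_def
  proof (intro conjI allI impI)
    have "s 1 \<in> carrier G" "s 2 \<in> carrier G" using s n by auto
    then show "bar_gens G s \<in> {1..n - 1} \<rightarrow> carrier G" using s by (auto simp: bar_gens_def)
    fix i j assume ij: "1 \<le> i \<and> i < j \<and> j \<le> n - 1"
    consider "i = 1" | "i = 2" | "i \<ge> 3" using ij by linarith
    then show "rot_prod G (bar_gens G s) i j \<otimes> rot_prod G (bar_gens G s) i j = \<one>"
    proof cases
      case 1
      then show ?thesis using rot_prod_bar_gens_1[OF s, of j] ij sq[of 1 j] by simp
    next
      case 2
      \<comment> \<open>Since \<open>v\<close> and \<open>a v\<close> square to 1, both
        \<open>v\<close> and \<open>a v a\<close> are inverse to \<open>v\<close>, so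
        \<open>a v a = v\<close>. The element to be squared is \<open>a (a v)\<close>, and its
        square is \<open>a (a v a) (a v) = (a v)(a v) = 1\<close>.\<close>
      define a where "a = s 1"
      define v where "v = rot_prod G s 2 j"
      have a: "a \<in> carrier G" using s ij by (auto simp: a_def)
      have v: "v \<in> carrier G" unfolding v_def using s ij by (intro rot_prod_closed) auto
      have 1: "rot_prod G s 1 j = a \<otimes> v"
        using ij 2 by (simp add: rot_prod_rec a_def v_def eval_nat_numeral)
      have vv: "v \<otimes> v = \<one>" using sq[of 2 j] ij 2 by (simp add: v_def)
      have av: "a \<otimes> v \<otimes> (a \<otimes> v) = \<one>" using sq[of 1 j] ij 2 unfolding 1 by simp
      then have avav: "(a \<otimes> v \<otimes> a) \<otimes> v = \<one>" using a v by (simp add: m_assoc)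
      have "a \<otimes> v \<otimes> a = v" using inv_equality[OF avav] inv_equality[OF vv] a v by simp
      then have "a \<otimes> (a \<otimes> v) \<otimes> (a \<otimes> (a \<otimes> v)) = a \<otimes> (v \<otimes> (a \<otimes> v))"
        using a v by (metis m_assoc m_closed)
      also have "\<dots> = \<one>" using av a v by (simp add: m_assoc)
      finally show ?thesis using rot_prod_bar_gens_2[OF s, of j] ij 2 unfolding 1 a_def[symmetric] by simp
    next
      case 3
      have "rot_prod G (bar_gens G s) i j = rot_prod G s i j"
        by (rule rot_prod_cong) (use 3 in \<open>simp add: bar_gens_def\<close>)
      then show ?thesis using sq ij by simp
    qed
  qed
qed

text \<open>The relations give an endomorphism with the prescribed values. Its square fixes the
  generators, the second because \<open>s_1^-2 s_1^2 s_2 = s_2\<close>; it is thus its own inverse,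
  an automorphism, and the one that \<open>bar\<close> denotes.\<close>

lemma bar_props:
  assumes n: "n \<ge> 3"
  shows bar_auto: "bar n \<in> auto (Wplus n)"
    and bar_gen: "1 \<le> i \<Longrightarrow> i \<le> n - 1 \<Longrightarrow> bar n (Wplus_gen n i) = bar_gens (Wplus n) (Wplus_gen n) i"
    and bar_bar: "w \<in> carrier (Wplus n) \<Longrightarrow> bar n (bar n w) = w"
proof -
  interpret W: group "Wplus n" by (rule group_Wplus)
  let ?g = "Wplus_gen n" and ?W = "Wplus n"
  define h where "h = natural_hom n ?W (bar_gens ?W ?g)"
  have rel: "Wplus_relations n ?W (bar_gens ?W ?g)"
    by (rule W.Wplus_relations_bar_gens[OF n Wplus_relations_Wplus])
  note h = natural_hom[OF W.group_axioms rel, folded h_def]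
  have g: "?g 1 \<in> carrier ?W" "?g 2 \<in> carrier ?W" using n by auto
  interpret h: group_hom ?W ?W h by unfold_locales (rule h(1))
  have hh: "h (h w) = w" if "w \<in> carrier ?W" for w
  proof -
    have "(h \<circ> h) w = (\<lambda>x \<in> carrier ?W. x) w"
    proof (rule Wplus_hom_unique[OF W.group_axioms hom_compose[OF h(1) h(1)] _ _ that])
      show "(\<lambda>x \<in> carrier ?W. x) \<in> hom ?W ?W" by (auto simp: hom_def)
      fix i assume i: "1 \<le> i" "i \<le> n - 1"
      have h1: "h (?g 1) = inv\<^bsub>?W\<^esub> ?g 1" and h2: "h (?g 2) = ?g 1 \<otimes>\<^bsub>?W\<^esub> ?g 1 \<otimes>\<^bsub>?W\<^esub> ?g 2"
        using h(3)[of 1] h(3)[of 2] n by (auto simp: bar_gens_def)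
      consider "i = 1" | "i = 2" | "i \<ge> 3" using i by linarith
      then show "(h \<circ> h) (?g i) = (\<lambda>x \<in> carrier ?W. x) (?g i)"
      proof cases
        case 1
        then show ?thesis using h1 g by simp
      next
        case 2
        have "inv\<^bsub>?W\<^esub> ?g 1 \<otimes>\<^bsub>?W\<^esub> inv\<^bsub>?W\<^esub> ?g 1 \<otimes>\<^bsub>?W\<^esub> (?g 1 \<otimes>\<^bsub>?W\<^esub> ?g 1 \<otimes>\<^bsub>?W\<^esub> ?g 2) = ?g 2"
          using g by (simp add: W.m_assoc W.inv_solve_left')
        then show ?thesis using 2 h1 h2 g by simp
      next
        case 3
        then show ?thesis using h(3)[OF i] i by (simp add: bar_gens_def)
      qed
    qed
    then show ?thesis using that by simp
  qed
  have "bij_betw h (carrier ?W) (carrier ?W)"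
    by (rule bij_betw_byWitness[of _ h]) (use hh h.hom_closed in auto)
  then have auto: "h \<in> auto ?W" using h(1,2) by (simp add: auto_def Bij_def)
  let ?P = "\<lambda>f. f \<in> auto ?W \<and> f (?g 1) = inv\<^bsub>?W\<^esub> (?g 1) \<and>
     f (?g 2) = (?g 1 [^]\<^bsub>?W\<^esub> (2::nat)) \<otimes>\<^bsub>?W\<^esub> ?g 2 \<and> (\<forall>j \<in> {3..n - 1}. f (?g j) = ?g j)"
  have sq: "?g 1 [^]\<^bsub>?W\<^esub> (2::nat) = ?g 1 \<otimes>\<^bsub>?W\<^esub> ?g 1" using g by (simp add: eval_nat_numeral)
  have Ph: "?P h" using auto h(3) n unfolding sq by (auto simp: bar_gens_def)
  have uniq: "f = h" if "?P f" for f
  proof (rule extensionalityI[of _ "carrier ?W"])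
    show "f \<in> extensional (carrier ?W)" "h \<in> extensional (carrier ?W)"
      using that auto by (auto simp: auto_def Bij_def)
    fix w assume "w \<in> carrier ?W"
    then show "f w = h w"
    proof (rule Wplus_hom_unique[OF W.group_axioms _ h(1), rotated 2])
      show "f \<in> hom ?W ?W" using that by (auto simp: auto_def)
      fix i assume "1 \<le> i" "i \<le> n - 1"
      moreover have "i = 1 \<or> i = 2 \<or> i \<in> {3..n - 1}" using calculation by auto
      ultimately show "f (?g i) = h (?g i)" using that h(3)[of i] unfolding sq by (auto simp: bar_gens_def)
    qed
  qed
  have "bar n = h" unfolding bar_def using Ph uniq by (rule the_equality)
  then show "bar n \<in> auto ?W" "1 \<le> i \<Longrightarrow> i \<le> n - 1 \<Longrightarrow> bar n (?g i) = bar_gens ?W ?g i"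
    "w \<in> carrier ?W \<Longrightarrow> bar n (bar n w) = w"
    using auto h(3) hh by auto
qed

section \<open>Flags and automorphisms of polytopes\<close>

definition face :: "'a rel \<Rightarrow> 'a set \<Rightarrow> int \<Rightarrow> 'a" where
  "face r \<Phi> k = (THE F. F \<in> \<Phi> \<and> rank r F = k)"

text \<open>The polytope axioms are layered. The simplex is used as a graded poset with diamonds,
  with rigidity proved from its vertices; for the chiral polytope strong flag-connectedness is
  added.\<close>

locale graded_poset =
  fixes n :: nat and r :: "'a rel"
  assumes partial_order: "Partial_order r" and finite_Field: "finite (Field r)"
    and card_flag: "\<And>C. C \<in> flags r \<Longrightarrow> card C = n + 2"
begin

lemma le_refl: "F \<in> Field r \<Longrightarrow> (F, F) \<in> r"
  using partial_order by (auto simp: partial_order_on_def preorder_on_def refl_on_def)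

lemma le_antisym: "(F, G) \<in> r \<Longrightarrow> (G, F) \<in> r \<Longrightarrow> F = G"
  using partial_order by (auto simp: partial_order_on_def antisym_def)

lemma le_trans: "(F, G) \<in> r \<Longrightarrow> (G, H) \<in> r \<Longrightarrow> (F, H) \<in> r"
  using partial_order unfolding partial_order_on_def preorder_on_def by (meson transD)

lemma chain_Field: "C \<in> Chains r \<Longrightarrow> C \<subseteq> Field r"
  by (auto simp: Chains_def Field_def)

lemma finite_chain: "C \<in> Chains r \<Longrightarrow> finite C"
  using chain_Field finite_Field finite_subset by blast

lemma chain_comparable: "C \<in> Chains r \<Longrightarrow> F \<in> C \<Longrightarrow> G \<in> C \<Longrightarrow> (F, G) \<in> r \<or> (G, F) \<in> r"
  by (auto simp: Chains_def)

lemma flag_chain: "\<Phi> \<in> flags r \<Longrightarrow> \<Phi> \<in> Chains r"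
  by (simp add: flags_def)

lemma chain_extends_to_flag:
  assumes "C \<in> Chains r"
  shows "\<exists>\<Phi> \<in> flags r. C \<subseteq> \<Phi>"
proof -
  let ?S = "{D \<in> Chains r. C \<subseteq> D}"
  have "?S \<subseteq> Pow (Field r)" using chain_Field by blast
  then have "finite ?S" using finite_Field by (meson finite_Pow_iff finite_subset)
  moreover have "C \<in> ?S" using assms by simp
  ultimately obtain D where D: "D \<in> ?S" "\<forall>E \<in> ?S. D \<subseteq> E \<longrightarrow> D = E"
    using finite_has_maximal2[of ?S C] by blast
  then have "D \<in> flags r" by (auto simp: flags_def)
  then show ?thesis using D(1) by blast
qed

lemma flagI:
  assumes "C \<in> Chains r" "card C = n + 2"
  shows "C \<in> flags r"
proof -
  obtain \<Phi> where "\<Phi> \<in> flags r" "C \<subseteq> \<Phi>" using chain_extends_to_flag[OF assms(1)] by blast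
  then have "C = \<Phi>" using card_flag assms(2) finite_chain[OF flag_chain] card_subset_eq by metis
  then show ?thesis using \<open>\<Phi> \<in> flags r\<close> by simp
qed

lemma card_chain: "C \<in> Chains r \<Longrightarrow> card C \<le> n + 2"
  using chain_extends_to_flag card_flag finite_chain[OF flag_chain] card_mono by metis

text \<open>\<open>rank\<close> is a maximum over all chains, but any one flag through
  \<open>F\<close> attains it: a longer chain below \<open>F\<close>, spliced with the part of the
  flag from \<open>F\<close> upwards, would be a chain of more than n + 2 faces.\<close>

lemma rank_in_flag:
  assumes \<Phi>: "\<Phi> \<in> flags r" and F: "F \<in> \<Phi>"
  shows "rank r F = int (card {G \<in> \<Phi>. strictly_below r G F}) - 1"
proof -
  let ?B = "{G \<in> \<Phi>. strictly_below r G F}"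
  let ?S = "{C \<in> Chains r. \<forall>G \<in> C. strictly_below r G F}"
  have fin: "finite \<Phi>" using finite_chain[OF flag_chain[OF \<Phi>]] .
  have "Max (card ` ?S) = card ?B"
  proof (rule Max_eqI)
    have "?S \<subseteq> Pow (Field r)" using chain_Field by blast
    then show "finite (card ` ?S)" using finite_Field by (meson finite_Pow_iff finite_subset finite_imageI)
    have "?B \<in> ?S" using flag_chain[OF \<Phi>] by (auto simp: Chains_def)
    then show "card ?B \<in> card ` ?S" by blast
    fix m assume "m \<in> card ` ?S"
    then obtain C where C: "C \<in> Chains r" "\<And>G. G \<in> C \<Longrightarrow> strictly_below r G F" "m = card C" by blast
    have above: "(F, G) \<in> r" if "G \<in> \<Phi> - ?B" for G
      using that F chain_comparable[OF flag_chain[OF \<Phi>], of F G] by (auto simp: strictly_below_def)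
    have "(G, H) \<in> r" if "G \<in> C" "H \<in> \<Phi> - ?B" for G H
      using le_trans[of G F H] C(2)[OF that(1)] above[OF that(2)] by (simp add: strictly_below_def)
    then have "C \<union> (\<Phi> - ?B) \<in> Chains r"
      using C(1) flag_chain[OF \<Phi>] unfolding Chains_def by blast
    then have "card (C \<union> (\<Phi> - ?B)) \<le> card \<Phi>" using card_chain card_flag[OF \<Phi>] by simp
    moreover have "C \<inter> (\<Phi> - ?B) = {}" using C(2) by auto
    then have "card (C \<union> (\<Phi> - ?B)) = card C + card (\<Phi> - ?B)"
      using finite_chain[OF C(1)] fin by (intro card_Un_disjoint) auto
    moreover have "card \<Phi> = card ?B + card (\<Phi> - ?B)"
      using fin card_Diff_subset[of ?B \<Phi>] card_mono[of \<Phi> ?B] by auto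
    ultimately show "m \<le> card ?B" using C(3) by simp
  qed
  then show ?thesis by (simp add: rank_def)
qed

lemma rank_strict_mono:
  assumes "(F, G) \<in> r" "F \<noteq> G"
  shows "rank r F < rank r G"
proof -
  have "F \<in> Field r" "G \<in> Field r" using assms(1) by (auto simp: Field_def)
  then have "{F, G} \<in> Chains r" using assms(1) le_refl by (auto simp: Chains_def)
  then obtain \<Phi> where \<Phi>: "\<Phi> \<in> flags r" "F \<in> \<Phi>" "G \<in> \<Phi>" using chain_extends_to_flag by blast
  have "{H \<in> \<Phi>. strictly_below r H F} \<subset> {H \<in> \<Phi>. strictly_below r H G}"
    using assms \<Phi> le_trans[of _ F G] le_antisym[of F G] unfolding strictly_below_def by blast
  then have "card {H \<in> \<Phi>. strictly_below r H F} < card {H \<in> \<Phi>. strictly_below r H G}"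
    using finite_chain[OF flag_chain[OF \<Phi>(1)]] by (intro psubset_card_mono) auto
  then show ?thesis using rank_in_flag \<Phi> by simp
qed

lemma rank_mono: "(F, G) \<in> r \<Longrightarrow> rank r F \<le> rank r G"
  using rank_strict_mono[of F G] by (cases "F = G") auto

lemma inj_on_rank: "\<Phi> \<in> flags r \<Longrightarrow> inj_on (rank r) \<Phi>"
  using chain_comparable[OF flag_chain] rank_strict_mono by (metis inj_onI order_less_irrefl)

lemma rank_image_flag:
  assumes \<Phi>: "\<Phi> \<in> flags r"
  shows "rank r ` \<Phi> = {-1..int n}"
proof (rule card_subset_eq)
  have fin: "finite \<Phi>" using finite_chain[OF flag_chain[OF \<Phi>]] .
  show "rank r ` \<Phi> \<subseteq> {-1..int n}"
  proof
    fix k assume "k \<in> rank r ` \<Phi>"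
    then obtain F where F: "F \<in> \<Phi>" "k = rank r F" by blast
    have "{G \<in> \<Phi>. strictly_below r G F} \<subset> \<Phi>" using F by (auto simp: strictly_below_def)
    then have "card {G \<in> \<Phi>. strictly_below r G F} < n + 2"
      using psubset_card_mono[OF fin] card_flag[OF \<Phi>] by metis
    then show "k \<in> {-1..int n}" using F rank_in_flag[OF \<Phi>] by simp
  qed
  show "card (rank r ` \<Phi>) = card {-1..int n}"
    using card_image[OF inj_on_rank[OF \<Phi>]] card_flag[OF \<Phi>] by simp
qed simp

lemma face_rank: "\<Phi> \<in> flags r \<Longrightarrow> F \<in> \<Phi> \<Longrightarrow> face r \<Phi> (rank r F) = F"
  unfolding face_def using inj_on_rank[of \<Phi>] by (auto simp: inj_on_def)

lemma
  assumes "\<Phi> \<in> flags r" "-1 \<le> k" "k \<le> int n"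
  shows face_in_flag: "face r \<Phi> k \<in> \<Phi>" and rank_face: "rank r (face r \<Phi> k) = k"
proof -
  have "k \<in> rank r ` \<Phi>" using rank_image_flag[OF assms(1)] assms by simp
  then obtain F where "F \<in> \<Phi>" "k = rank r F" by blast
  then show "face r \<Phi> k \<in> \<Phi>" "rank r (face r \<Phi> k) = k" using face_rank[OF assms(1)] by auto
qed

lemma rank_bounds: "\<Phi> \<in> flags r \<Longrightarrow> F \<in> \<Phi> \<Longrightarrow> -1 \<le> rank r F \<and> rank r F \<le> int n"
  using rank_image_flag by fastforce

lemma flag_le_iff:
  assumes "\<Phi> \<in> flags r" "F \<in> \<Phi>" "G \<in> \<Phi>"
  shows "(F, G) \<in> r \<longleftrightarrow> rank r F \<le> rank r G"
  using chain_comparable[OF flag_chain[OF assms(1)] assms(2,3)] rank_strict_mono[of G F] rank_mono[of F G]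
    le_refl chain_Field[OF flag_chain[OF assms(1)]] assms(2) by (cases "F = G") auto

lemma face_le: "\<Phi> \<in> flags r \<Longrightarrow> -1 \<le> k \<Longrightarrow> k \<le> l \<Longrightarrow> l \<le> int n \<Longrightarrow> (face r \<Phi> k, face r \<Phi> l) \<in> r"
  by (subst flag_le_iff[of \<Phi>]) (auto simp: face_in_flag rank_face)

lemma flag_eqI:
  assumes "\<Phi> \<in> flags r" "\<Psi> \<in> flags r"
    and "\<And>k. -1 \<le> k \<Longrightarrow> k \<le> int n \<Longrightarrow> face r \<Phi> k = face r \<Psi> k"
  shows "\<Phi> = \<Psi>"
proof -
  have "\<Phi> \<subseteq> \<Psi>" if "\<Phi> \<in> flags r" "\<Psi> \<in> flags r"
    "\<And>k. -1 \<le> k \<Longrightarrow> k \<le> int n \<Longrightarrow> face r \<Phi> k = face r \<Psi> k" for \<Phi> \<Psi>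
    using that face_rank face_in_flag rank_bounds by (metis subsetI)
  from this[OF assms] this[OF assms(2,1)] assms(3) show ?thesis by fastforce
qed

lemma adjacent_at_iff:
  assumes \<Phi>: "\<Phi> \<in> flags r" and \<Psi>: "\<Psi> \<in> flags r"
  shows "adjacent_at r i \<Phi> \<Psi> \<longleftrightarrow>
    \<Phi> \<noteq> \<Psi> \<and> (\<forall>k. -1 \<le> k \<and> k \<le> int n \<and> k \<noteq> int i \<longrightarrow> face r \<Phi> k = face r \<Psi> k)"
proof -
  have "{F \<in> \<Phi>. rank r F \<noteq> int i} = {F \<in> \<Psi>. rank r F \<noteq> int i} \<longleftrightarrow>
      (\<forall>k. -1 \<le> k \<and> k \<le> int n \<and> k \<noteq> int i \<longrightarrow> face r \<Phi> k = face r \<Psi> k)" (is "?L = ?R \<longleftrightarrow> ?E")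
  proof
    assume eq: "?L = ?R"
    show ?E
    proof (intro allI impI)
      fix k assume k: "-1 \<le> k \<and> k \<le> int n \<and> k \<noteq> int i"
      then have "face r \<Phi> k \<in> ?L" using face_in_flag[OF \<Phi>] rank_face[OF \<Phi>] by simp
      then have "face r \<Phi> k \<in> \<Psi>" unfolding eq by simp
      then show "face r \<Phi> k = face r \<Psi> k" using face_rank[OF \<Psi>] rank_face[OF \<Phi>] k by metis
    qed
  next
    assume E: ?E
    have "F \<in> \<Psi>" if "F \<in> \<Phi>" "rank r F \<noteq> int i" for F
      using E face_rank[OF \<Phi> that(1)] rank_bounds[OF \<Phi> that(1)] that(2) face_in_flag[OF \<Psi>] by metis
    moreover have "F \<in> \<Phi>" if "F \<in> \<Psi>" "rank r F \<noteq> int i" for F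
      using E face_rank[OF \<Psi> that(1)] rank_bounds[OF \<Psi> that(1)] that(2) face_in_flag[OF \<Phi>] by metis
    ultimately show "?L = ?R" by blast
  qed
  then show ?thesis using assms unfolding adjacent_at_def by blast
qed

end

section \<open>The diamond condition and adjacent flags\<close>

locale diamond_poset = graded_poset +
  assumes least: "\<exists>L \<in> Field r. \<forall>F \<in> Field r. (L, F) \<in> r"
    and greatest: "\<exists>T \<in> Field r. \<forall>F \<in> Field r. (F, T) \<in> r"
    and diamond: "\<And>F G. (F, G) \<in> r \<Longrightarrow> rank r G = rank r F + 2 \<Longrightarrow>
      card {H. strictly_below r F H \<and> strictly_below r H G} = 2"
begin

lemma face_top: "\<Phi> \<in> flags r \<Longrightarrow> \<Psi> \<in> flags r \<Longrightarrow> face r \<Phi> (int n) = face r \<Psi> (int n)"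
proof -
  obtain T where T: "T \<in> Field r" "\<And>F. F \<in> Field r \<Longrightarrow> (F, T) \<in> r" using greatest by blast
  have "face r \<Phi> (int n) = T" if "\<Phi> \<in> flags r" for \<Phi>
  proof -
    have "\<Phi> \<subseteq> Field r" using chain_Field flag_chain that by blast
    then have "insert T \<Phi> \<in> Chains r" using flag_chain[OF that] T by (auto simp: Chains_def)
    then have "T \<in> \<Phi>" using that by (auto simp: flags_def)
    moreover have "rank r T = int n"
      using rank_mono[OF T(2), of "face r \<Phi> (int n)"] face_in_flag[OF that, of "int n"]
        rank_face[OF that, of "int n"] rank_bounds[OF that \<open>T \<in> \<Phi>\<close>] \<open>\<Phi> \<subseteq> Field r\<close> by auto
    ultimately show ?thesis using face_rank[OF that] by metis
  qed
  then show "\<Phi> \<in> flags r \<Longrightarrow> \<Psi> \<in> flags r \<Longrightarrow> face r \<Phi> (int n) = face r \<Psi> (int n)" by simp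
qed

text \<open>\<open>adjacent_at\<close> admits every natural number. Rank n is excluded because all
  flags share the greatest face, larger ranks because no face has them.\<close>

lemma adjacent_at_less:
  assumes "adjacent_at r i \<Phi> \<Psi>"
  shows "i < n"
proof (rule ccontr)
  assume i: "\<not> i < n"
  have \<Phi>: "\<Phi> \<in> flags r" and \<Psi>: "\<Psi> \<in> flags r" using assms by (auto simp: adjacent_at_def)
  have "\<Phi> = \<Psi>"
  proof (rule flag_eqI[OF \<Phi> \<Psi>])
    fix k assume "-1 \<le> k" "k \<le> int n"
    then show "face r \<Phi> k = face r \<Psi> k"
      using assms face_top[OF \<Phi> \<Psi>] i unfolding adjacent_at_iff[OF \<Phi> \<Psi>] by (cases "k = int n") auto
  qed
  then show False using assms by (simp add: adjacent_at_def)
qed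

definition between :: "'a set \<Rightarrow> nat \<Rightarrow> 'a set" where
  "between \<Phi> i = {H. strictly_below r (face r \<Phi> (int i - 1)) H \<and> strictly_below r H (face r \<Phi> (int i + 1))}"

lemma between_two:
  assumes \<Phi>: "\<Phi> \<in> flags r" and i: "i < n"
  obtains b where "b \<noteq> face r \<Phi> (int i)" "between \<Phi> i = {face r \<Phi> (int i), b}"
proof -
  have "card (between \<Phi> i) = 2" unfolding between_def
    by (rule diamond) (use face_le[OF \<Phi>] rank_face[OF \<Phi>] i in auto)
  moreover have "face r \<Phi> (int i) \<in> between \<Phi> i"
    unfolding between_def strictly_below_def
    using face_le[OF \<Phi>] rank_face[OF \<Phi>, of "int i"] rank_face[OF \<Phi>, of "int i - 1"] rank_face[OF \<Phi>, of "int i + 1"] i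
    by auto
  ultimately show ?thesis using that unfolding card_2_iff by (metis insert_iff insert_commute singletonD)
qed

lemma face_in_between:
  assumes \<Phi>: "\<Phi> \<in> flags r" and \<Psi>: "\<Psi> \<in> flags r" and i: "i < n"
    and "face r \<Psi> (int i - 1) = face r \<Phi> (int i - 1)" "face r \<Psi> (int i + 1) = face r \<Phi> (int i + 1)"
  shows "face r \<Psi> (int i) \<in> between \<Phi> i"
  unfolding between_def strictly_below_def assms(4,5)[symmetric]
  using face_le[OF \<Psi>] rank_face[OF \<Psi>, of "int i"] rank_face[OF \<Psi>, of "int i - 1"] rank_face[OF \<Psi>, of "int i + 1"] i
  by auto

text \<open>The new i-face is the other element of the diamond, so it depends only on the faces of
  ranks i - 1, i and i + 1. This locality gives both the uniqueness of adjacent flags and the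
  commuting of adjacencies at distance at least 2.\<close>

lemma adjacent_at_face_determined:
  assumes "adjacent_at r i \<Phi> \<Psi>" "adjacent_at r i \<Phi>' \<Psi>'"
    and "\<And>k. k \<in> {int i - 1, int i, int i + 1} \<Longrightarrow> face r \<Phi> k = face r \<Phi>' k"
  shows "face r \<Psi> (int i) = face r \<Psi>' (int i)"
proof -
  have i: "i < n" using assms(1) by (rule adjacent_at_less)
  have fl: "\<Phi> \<in> flags r" "\<Psi> \<in> flags r" "\<Phi>' \<in> flags r" "\<Psi>' \<in> flags r"
    using assms(1,2) by (auto simp: adjacent_at_def)
  have *: "face r \<Phi> k = face r \<Psi> k" "face r \<Phi>' k = face r \<Psi>' k" if "-1 \<le> k" "k \<le> int n" "k \<noteq> int i" for k
    using assms(1,2) that fl unfolding adjacent_at_iff[OF fl(1,2)] adjacent_at_iff[OF fl(3,4)] by auto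
  have "face r \<Psi> (int i) \<noteq> face r \<Phi> (int i)"
    using assms(1) *(1) flag_eqI[OF fl(1,2)] unfolding adjacent_at_def by metis
  moreover have "face r \<Psi>' (int i) \<noteq> face r \<Phi>' (int i)"
    using assms(2) *(2) flag_eqI[OF fl(3,4)] unfolding adjacent_at_def by metis
  moreover have "face r \<Psi> (int i) \<in> between \<Phi> i"
    by (rule face_in_between[OF fl(1,2) i]) (use * i in auto)
  moreover have "face r \<Psi>' (int i) \<in> between \<Phi>' i"
    by (rule face_in_between[OF fl(3,4) i]) (use * i in auto)
  moreover have "between \<Phi>' i = between \<Phi> i" using assms(3) by (simp add: between_def)
  moreover obtain b where "between \<Phi> i = {face r \<Phi> (int i), b}" using between_two[OF fl(1) i] .
  ultimately show ?thesis using assms(3)[of "int i"] by auto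
qed

lemma adjacent_at_unique:
  assumes "adjacent_at r i \<Phi> \<Psi>" "adjacent_at r i \<Phi> \<Psi>'"
  shows "\<Psi> = \<Psi>'"
proof (rule flag_eqI)
  show fl: "\<Psi> \<in> flags r" "\<Psi>' \<in> flags r" using assms by (auto simp: adjacent_at_def)
  have \<Phi>: "\<Phi> \<in> flags r" using assms by (auto simp: adjacent_at_def)
  fix k assume "-1 \<le> k" "k \<le> int n"
  then show "face r \<Psi> k = face r \<Psi>' k"
    using adjacent_at_face_determined[OF assms] assms
    unfolding adjacent_at_iff[OF \<Phi> fl(1)] adjacent_at_iff[OF \<Phi> fl(2)] by (cases "k = int i") auto
qed

lemma adjacent_at_exists:
  assumes \<Phi>: "\<Phi> \<in> flags r" and i: "i < n"
  shows "\<exists>\<Psi>. adjacent_at r i \<Phi> \<Psi>"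
proof -
  let ?f = "face r \<Phi>"
  obtain b where b: "b \<noteq> ?f (int i)" "between \<Phi> i = {?f (int i), b}" using between_two[OF \<Phi> i] .
  then have "b \<in> between \<Phi> i" by simp
  then have lo: "(?f (int i - 1), b) \<in> r" "?f (int i - 1) \<noteq> b" and hi: "(b, ?f (int i + 1)) \<in> r" "b \<noteq> ?f (int i + 1)"
    by (auto simp: between_def strictly_below_def)
  \<comment> \<open>\<open>b\<close> lies strictly between faces of ranks i - 1 and i + 1; this
    leaves rank i only.\<close>
  have rb: "rank r b = int i"
    using rank_strict_mono[OF lo] rank_strict_mono[OF hi] rank_face[OF \<Phi>] i by simp
  define \<Psi> where "\<Psi> = insert b (\<Phi> - {?f (int i)})"
  have fi: "?f (int i) \<in> \<Phi>" using face_in_flag[OF \<Phi>] i by simp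
  have comp: "(F, b) \<in> r \<or> (b, F) \<in> r" if "F \<in> \<Phi> - {?f (int i)}" for F
  proof -
    have F: "F \<in> \<Phi>" using that by simp
    have "rank r F \<noteq> int i" using that face_rank[OF \<Phi> F] by auto
    then consider "rank r F \<le> int i - 1" | "int i + 1 \<le> rank r F" by linarith
    then show ?thesis
    proof cases
      case 1
      then have "(F, ?f (int i - 1)) \<in> r"
        using face_le[OF \<Phi>, of "rank r F" "int i - 1"] rank_bounds[OF \<Phi> F] face_rank[OF \<Phi> F] i by simp
      then show ?thesis using lo(1) le_trans by blast
    next
      case 2
      then have "(?f (int i + 1), F) \<in> r"
        using face_le[OF \<Phi>, of "int i + 1" "rank r F"] rank_bounds[OF \<Phi> F] face_rank[OF \<Phi> F] i by simp
      then show ?thesis using hi(1) le_trans by blast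
    qed
  qed
  have "b \<notin> \<Phi>" using face_rank[OF \<Phi>, of b] rb b(1) by auto
  have "b \<in> Field r" using lo(1) by (auto simp: Field_def)
  then have "\<Psi> \<in> Chains r"
    using flag_chain[OF \<Phi>] comp le_refl unfolding \<Psi>_def Chains_def by blast
  moreover have "card \<Psi> = n + 2"
    using \<open>b \<notin> \<Phi>\<close> fi card_flag[OF \<Phi>] finite_chain[OF flag_chain[OF \<Phi>]] unfolding \<Psi>_def
    by (simp add: card_Diff_singleton)
  ultimately have "\<Psi> \<in> flags r" by (rule flagI)
  moreover have "\<Phi> \<noteq> \<Psi>" using \<open>b \<notin> \<Phi>\<close> \<Psi>_def by blast
  moreover have "{F \<in> \<Phi>. rank r F \<noteq> int i} = {F \<in> \<Psi>. rank r F \<noteq> int i}"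
    using rb rank_face[OF \<Phi>, of "int i"] i unfolding \<Psi>_def by auto
  ultimately show ?thesis using \<Phi> unfolding adjacent_at_def by blast
qed

lemma adj_eq: "adjacent_at r i \<Phi> \<Psi> \<Longrightarrow> adj r i \<Phi> = \<Psi>"
  unfolding adj_def by (rule the_equality) (auto dest: adjacent_at_unique)

lemma adjacent_at_adj: "\<Phi> \<in> flags r \<Longrightarrow> i < n \<Longrightarrow> adjacent_at r i \<Phi> (adj r i \<Phi>)"
  using adjacent_at_exists adj_eq by metis

lemma adj_flag: "\<Phi> \<in> flags r \<Longrightarrow> i < n \<Longrightarrow> adj r i \<Phi> \<in> flags r"
  using adjacent_at_adj by (auto simp: adjacent_at_def)

lemma face_adj:
  assumes "\<Phi> \<in> flags r" "i < n" "-1 \<le> k" "k \<le> int n" "k \<noteq> int i"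
  shows "face r (adj r i \<Phi>) k = face r \<Phi> k"
  using adjacent_at_adj[OF assms(1,2)] adj_flag[OF assms(1,2)] assms adjacent_at_iff by metis

lemma adj_adj: "\<Phi> \<in> flags r \<Longrightarrow> i < n \<Longrightarrow> adj r i (adj r i \<Phi>) = \<Phi>"
  by (rule adj_eq) (use adjacent_at_adj in \<open>auto simp: adjacent_at_def\<close>)

lemma adj_commute:
  assumes \<Phi>: "\<Phi> \<in> flags r" and ij: "Suc i < j" "j < n"
  shows "adj r i (adj r j \<Phi>) = adj r j (adj r i \<Phi>)"
proof -
  have i: "i < n" and j: "j < n" using ij by auto
  note f = adj_flag[OF \<Phi> i] adj_flag[OF \<Phi> j]
  show ?thesis
  proof (rule flag_eqI)
    show "adj r i (adj r j \<Phi>) \<in> flags r" "adj r j (adj r i \<Phi>) \<in> flags r"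
      using adj_flag f i j by auto
    have fi: "face r (adj r i (adj r j \<Phi>)) (int i) = face r (adj r i \<Phi>) (int i)"
      by (rule adjacent_at_face_determined[OF adjacent_at_adj[OF f(2) i] adjacent_at_adj[OF \<Phi> i]])
        (use face_adj[OF \<Phi> j] ij in auto)
    have fj: "face r (adj r j (adj r i \<Phi>)) (int j) = face r (adj r j \<Phi>) (int j)"
      by (rule adjacent_at_face_determined[OF adjacent_at_adj[OF f(1) j] adjacent_at_adj[OF \<Phi> j]])
        (use face_adj[OF \<Phi> i] ij in auto)
    fix k assume k: "-1 \<le> k" "k \<le> int n"
    consider "k = int i" | "k = int j" | "k \<noteq> int i" "k \<noteq> int j" by blast
    then show "face r (adj r i (adj r j \<Phi>)) k = face r (adj r j (adj r i \<Phi>)) k"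
    proof cases
      case 1
      then show ?thesis using fi face_adj[OF f(1) j k] ij by simp
    next
      case 2
      then show ?thesis using fj face_adj[OF f(2) i k] ij by simp
    next
      case 3
      then show ?thesis using face_adj k f \<Phi> i j by simp
    qed
  qed
qed

end

section \<open>Automorphisms and their action on flags\<close>

lemma polytope_aut_group_simps:
  "f \<in> carrier (polytope_aut_group r) \<longleftrightarrow>
    f \<in> Bij (Field r) \<and> (\<forall>F \<in> Field r. \<forall>G \<in> Field r. (f F, f G) \<in> r \<longleftrightarrow> (F, G) \<in> r)"
  "one (polytope_aut_group r) = (\<lambda>x \<in> Field r. x)"
  by (simp_all add: polytope_aut_group_def BijGroup_def)

lemma aut_apply_in_Field: "f \<in> carrier (polytope_aut_group r) \<Longrightarrow> F \<in> Field r \<Longrightarrow> f F \<in> Field r"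
  unfolding polytope_aut_group_simps using Bij_imp_funcset by blast

lemma aut_mult_apply:
  assumes "f \<in> carrier (polytope_aut_group r)" "g \<in> carrier (polytope_aut_group r)" "F \<in> Field r"
  shows "(f \<otimes>\<^bsub>polytope_aut_group r\<^esub> g) F = f (g F)"
  using assms by (simp add: polytope_aut_group_def BijGroup_def compose_def)

lemma aut_one_apply: "F \<in> Field r \<Longrightarrow> \<one>\<^bsub>polytope_aut_group r\<^esub> F = F"
  by (simp add: polytope_aut_group_simps)

lemma group_polytope_aut_group: "group (polytope_aut_group r)"
proof -
  interpret B: group "BijGroup (Field r)" by (rule group_BijGroup)
  let ?A = "{f \<in> Bij (Field r). \<forall>F \<in> Field r. \<forall>G \<in> Field r. (f F, f G) \<in> r \<longleftrightarrow> (F, G) \<in> r}"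
  have in_F: "f F \<in> Field r" if "f \<in> Bij (Field r)" "F \<in> Field r" for f F
    using Bij_imp_funcset that by blast
  have "subgroup ?A (BijGroup (Field r))"
  proof (rule B.subgroupI)
    show "?A \<subseteq> carrier (BijGroup (Field r))" by (auto simp: BijGroup_def)
    show "?A \<noteq> {}" using id_Bij[of "Field r"] by (auto intro!: exI[of _ "\<lambda>x\<in>Field r. x"])
    fix f assume f: "f \<in> ?A"
    then have b: "bij_betw f (Field r) (Field r)" by (auto simp: Bij_def)
    have "(inv_into (Field r) f F, inv_into (Field r) f G) \<in> r \<longleftrightarrow> (F, G) \<in> r"
      if "F \<in> Field r" "G \<in> Field r" for F G
    proof -
      have "inv_into (Field r) f F \<in> Field r" "inv_into (Field r) f G \<in> Field r"
        using b that bij_betw_apply[OF bij_betw_inv_into[OF b]] by auto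
      then have "(f (inv_into (Field r) f F), f (inv_into (Field r) f G)) \<in> r \<longleftrightarrow>
          (inv_into (Field r) f F, inv_into (Field r) f G) \<in> r"
        using f by blast
      then show ?thesis using bij_betw_inv_into_right[OF b] that by simp
    qed
    then show "inv\<^bsub>BijGroup (Field r)\<^esub> f \<in> ?A"
      using f by (simp add: inv_BijGroup restrict_inv_into_Bij)
    fix g assume g: "g \<in> ?A"
    show "f \<otimes>\<^bsub>BijGroup (Field r)\<^esub> g \<in> ?A"
      using f g in_F[of g] by (simp add: BijGroup_def compose_Bij compose_eq)
  qed
  from B.subgroup_imp_group[OF this] show ?thesis by (simp add: polytope_aut_group_def)
qed

context diamond_poset
begin

abbreviation Aut :: "('a \<Rightarrow> 'a) monoid" where "Aut \<equiv> polytope_aut_group r"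

lemma flag_Field: "\<Phi> \<in> flags r \<Longrightarrow> \<Phi> \<subseteq> Field r"
  using chain_Field flag_chain by blast

lemma aut_mult_image:
  assumes "f \<in> carrier Aut" "g \<in> carrier Aut" "\<Phi> \<in> flags r"
  shows "(f \<otimes>\<^bsub>Aut\<^esub> g) ` \<Phi> = f ` g ` \<Phi>"
proof -
  have "(f \<otimes>\<^bsub>Aut\<^esub> g) ` \<Phi> = (\<lambda>F. f (g F)) ` \<Phi>"
    by (rule image_cong[OF HOL.refl]) (use aut_mult_apply[OF assms(1,2)] flag_Field[OF assms(3)] in auto)
  then show ?thesis by (simp add: image_image)
qed

lemma aut_one_image: "\<Phi> \<in> flags r \<Longrightarrow> \<one>\<^bsub>Aut\<^esub> ` \<Phi> = \<Phi>"
proof -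
  assume "\<Phi> \<in> flags r"
  then have "\<one>\<^bsub>Aut\<^esub> ` \<Phi> = (\<lambda>F. F) ` \<Phi>"
    by (intro image_cong HOL.refl aut_one_apply) (use flag_Field in blast)
  then show ?thesis by simp
qed

lemma aut_inj: "f \<in> carrier Aut \<Longrightarrow> inj_on f (Field r)"
  unfolding polytope_aut_group_simps Bij_def bij_betw_def by blast

lemma aut_flag:
  assumes f: "f \<in> carrier Aut" and \<Phi>: "\<Phi> \<in> flags r"
  shows "f ` \<Phi> \<in> flags r"
proof (rule flagI)
  have F: "\<Phi> \<subseteq> Field r" by (rule flag_Field[OF \<Phi>])
  show "f ` \<Phi> \<in> Chains r"
    using f F flag_chain[OF \<Phi>] unfolding Chains_def polytope_aut_group_simps by blast
  show "card (f ` \<Phi>) = n + 2"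
    using card_image[OF inj_on_subset[OF aut_inj[OF f] F]] card_flag[OF \<Phi>] by simp
qed

lemma Field_in_flag: "F \<in> Field r \<Longrightarrow> \<exists>\<Phi> \<in> flags r. F \<in> \<Phi>"
  using chain_extends_to_flag[of "{F}"] le_refl[of F] by (auto simp: Chains_def)

lemma aut_rank:
  assumes f: "f \<in> carrier Aut" and F: "F \<in> Field r"
  shows "rank r (f F) = rank r F"
proof -
  obtain \<Phi> where \<Phi>: "\<Phi> \<in> flags r" "F \<in> \<Phi>" using Field_in_flag[OF F] by blast
  have sub: "\<Phi> \<subseteq> Field r" by (rule flag_Field[OF \<Phi>(1)])
  have "strictly_below r (f G) (f F) \<longleftrightarrow> strictly_below r G F" if "G \<in> \<Phi>" for G
    using f F that sub inj_onD[OF aut_inj[OF f], of G F] unfolding strictly_below_def polytope_aut_group_simps by blast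
  then have "{G \<in> f ` \<Phi>. strictly_below r G (f F)} = f ` {G \<in> \<Phi>. strictly_below r G F}" by blast
  moreover have "inj_on f {G \<in> \<Phi>. strictly_below r G F}"
    by (rule inj_on_subset[OF aut_inj[OF f]]) (use sub in blast)
  ultimately have "card {G \<in> f ` \<Phi>. strictly_below r G (f F)} = card {G \<in> \<Phi>. strictly_below r G F}"
    using card_image by metis
  then show ?thesis using rank_in_flag[OF \<Phi>] rank_in_flag[OF aut_flag[OF f \<Phi>(1)], of "f F"] \<Phi>(2) by simp
qed

lemma aut_face:
  assumes f: "f \<in> carrier Aut" and \<Phi>: "\<Phi> \<in> flags r" and k: "-1 \<le> k" "k \<le> int n"
  shows "face r (f ` \<Phi>) k = f (face r \<Phi> k)"
proof -
  have F: "face r \<Phi> k \<in> \<Phi>" "rank r (face r \<Phi> k) = k" using face_in_flag[OF \<Phi> k] rank_face[OF \<Phi> k] .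
  then have "rank r (f (face r \<Phi> k)) = k" using aut_rank[OF f] flag_Field[OF \<Phi>] by auto
  then show ?thesis using face_rank[OF aut_flag[OF f \<Phi>], of "f (face r \<Phi> k)"] F by auto
qed

text \<open>The bridge between automorphisms and adjacencies: the two actions on flags commute, so
  an automorphism can be moved past any sequence of adjacencies.\<close>

lemma aut_adj:
  assumes f: "f \<in> carrier Aut" and \<Phi>: "\<Phi> \<in> flags r" and i: "i < n"
  shows "f ` adj r i \<Phi> = adj r i (f ` \<Phi>)"
proof (rule adj_eq[symmetric])
  have A: "adj r i \<Phi> \<in> flags r" by (rule adj_flag[OF \<Phi> i])
  have "f ` \<Phi> \<noteq> f ` adj r i \<Phi>"
    using inj_on_image_eq_iff[OF aut_inj[OF f] flag_Field[OF \<Phi>] flag_Field[OF A]] adjacent_at_adj[OF \<Phi> i]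
    by (simp add: adjacent_at_def)
  then show "adjacent_at r i (f ` \<Phi>) (f ` adj r i \<Phi>)"
    unfolding adjacent_at_iff[OF aut_flag[OF f \<Phi>] aut_flag[OF f A]]
    using aut_face[OF f \<Phi>] aut_face[OF f A] face_adj[OF \<Phi> i] by auto
qed

end

section \<open>Strong flag-connectedness: rigidity and extension of flag maps\<close>

locale polytope = diamond_poset +
  assumes connected: "strongly_flag_connected r"
begin

lemma flag_induct:
  assumes "\<Phi> \<in> flags r" "\<Psi> \<in> flags r" "P \<Phi>"
    and step: "\<And>\<Xi> i. \<Xi> \<in> flags r \<Longrightarrow> P \<Xi> \<Longrightarrow> i < n \<Longrightarrow> P (adj r i \<Xi>)"
  shows "P \<Psi>"
proof -
  have "(\<Phi>, \<Psi>) \<in> {(A, B). adjacent r A B \<and> \<Phi> \<inter> \<Psi> \<subseteq> A \<and> \<Phi> \<inter> \<Psi> \<subseteq> B}\<^sup>*"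
    using connected assms(1,2) unfolding strongly_flag_connected_def by blast
  then show ?thesis
  proof induction
    case (step A B)
    then obtain i where i: "adjacent_at r i A B" unfolding adjacent_def by blast
    then have "B = adj r i A" "i < n" "A \<in> flags r"
      using adj_eq[OF i] adjacent_at_less[OF i] by (auto simp: adjacent_at_def)
    then show ?case using assms(4) step.IH by blast
  qed (rule assms(3))
qed

text \<open>Agreement on one flag spreads along adjacencies to all flags, and the image of a face is
  the face of the same rank in the image of any flag through it.\<close>

lemma aut_unique:
  assumes f: "f \<in> carrier Aut" and g: "g \<in> carrier Aut" and \<Phi>: "\<Phi> \<in> flags r" and eq: "f ` \<Phi> = g ` \<Phi>"
  shows "f = g"
proof (rule extensionalityI[of _ "Field r"])
  show "f \<in> extensional (Field r)" "g \<in> extensional (Field r)"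
    using f g by (auto simp: polytope_aut_group_simps Bij_def)
  fix F assume F: "F \<in> Field r"
  then obtain \<Psi> where \<Psi>: "\<Psi> \<in> flags r" "F \<in> \<Psi>" using Field_in_flag by blast
  have "f ` \<Psi> = g ` \<Psi>"
    by (rule flag_induct[OF \<Phi> \<Psi>(1), of "\<lambda>\<Xi>. f ` \<Xi> = g ` \<Xi>"]) (use eq aut_adj[OF f] aut_adj[OF g] in auto)
  then show "f F = g F"
    using aut_face[OF f \<Psi>(1), of "rank r F"] aut_face[OF g \<Psi>(1), of "rank r F"] rank_bounds[OF \<Psi>] face_rank[OF \<Psi>]
    by simp
qed

text \<open>A face is an equivalence class of flags: by strong flag-connectedness, two flags share
  their \<open>k\<close>-face iff they are joined by adjacencies of other ranks.\<close>

lemma flag_involution_extends: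
  assumes f: "\<And>\<Xi>. \<Xi> \<in> flags r \<Longrightarrow> f \<Xi> \<in> flags r" and ff: "\<And>\<Xi>. \<Xi> \<in> flags r \<Longrightarrow> f (f \<Xi>) = \<Xi>"
    and fadj: "\<And>\<Xi> i. \<Xi> \<in> flags r \<Longrightarrow> i < n \<Longrightarrow> f (adj r i \<Xi>) = adj r i (f \<Xi>)"
  shows "\<exists>g \<in> carrier Aut. \<forall>\<Xi> \<in> flags r. g ` \<Xi> = f \<Xi>"
proof -
  have well: "face r (f \<Phi>) (rank r F) = face r (f \<Psi>) (rank r F)"
    if \<Phi>: "\<Phi> \<in> flags r" "F \<in> \<Phi>" and \<Psi>: "\<Psi> \<in> flags r" "F \<in> \<Psi>" for \<Phi> \<Psi> F
  proof -
    have "(\<Phi>, \<Psi>) \<in> {(A, B). adjacent r A B \<and> \<Phi> \<inter> \<Psi> \<subseteq> A \<and> \<Phi> \<inter> \<Psi> \<subseteq> B}\<^sup>*"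
      using connected \<Phi>(1) \<Psi>(1) unfolding strongly_flag_connected_def by blast
    then show ?thesis
    proof induction
      case (step A B)
      then obtain i where i: "adjacent_at r i A B" unfolding adjacent_def by blast
      then have B: "B = adj r i A" "i < n" and fl: "A \<in> flags r" "B \<in> flags r"
        using adj_eq[OF i] adjacent_at_less[OF i] by (auto simp: adjacent_at_def)
      \<comment> \<open>The path joining the two flags stays among flags containing all their common
        faces, in particular \<open>F\<close>. Hence no step of the path changes the face at the
        rank of \<open>F\<close>.\<close>
      have F: "F \<in> A" "F \<in> B" using step.hyps \<Phi> \<Psi> by auto
      have "rank r F \<noteq> int i"
      proof
        assume "rank r F = int i"
        then have "face r A (int i) = face r B (int i)"
          using face_rank[OF fl(1) F(1)] face_rank[OF fl(2) F(2)] by simp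
        then have "A = B" using i flag_eqI[OF fl] unfolding adjacent_at_iff[OF fl] by metis
        then show False using i by (simp add: adjacent_at_def)
      qed
      then have "face r (f B) (rank r F) = face r (f A) (rank r F)"
        using fadj[OF fl(1) B(2)] face_adj[OF f[OF fl(1)] B(2)] rank_bounds[OF fl(1) F(1)] B(1) by simp
      then show ?case using step.IH by simp
    qed simp
  qed
  define g where "g = (\<lambda>F \<in> Field r. face r (f (SOME \<Xi>. \<Xi> \<in> flags r \<and> F \<in> \<Xi>)) (rank r F))"
  have g: "g F = face r (f \<Xi>) (rank r F)" if "\<Xi> \<in> flags r" "F \<in> \<Xi>" for \<Xi> F
  proof -
    let ?S = "SOME \<Xi>. \<Xi> \<in> flags r \<and> F \<in> \<Xi>"
    have "?S \<in> flags r \<and> F \<in> ?S" by (rule someI[of _ \<Xi>]) (use that in blast)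
    then have "face r (f ?S) (rank r F) = face r (f \<Xi>) (rank r F)" using well that by blast
    moreover have "g F = face r (f ?S) (rank r F)"
      unfolding g_def by (rule restrict_apply') (use flag_Field that in blast)
    ultimately show ?thesis by simp
  qed
  have g_in: "g F \<in> f \<Xi>" and g_rank: "rank r (g F) = rank r F" if "\<Xi> \<in> flags r" "F \<in> \<Xi>" for \<Xi> F
    using g[OF that] face_in_flag[OF f[OF that(1)]] rank_face[OF f[OF that(1)]] rank_bounds[OF that] by auto
  have gF: "g F \<in> Field r" if "F \<in> Field r" for F
    using Field_in_flag[OF that] g_in f flag_Field by blast
  \<comment> \<open>As \<open>f\<close> is an involution, \<open>g\<close> is its own inverse;
    bijectivity and the reflection of the order then follow from monotonicity alone.\<close>
  have gg: "g (g F) = F" if F: "F \<in> Field r" for F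
  proof -
    obtain \<Xi> where \<Xi>: "\<Xi> \<in> flags r" "F \<in> \<Xi>" using Field_in_flag[OF F] by blast
    show ?thesis using g[OF f[OF \<Xi>(1)] g_in[OF \<Xi>]] ff[OF \<Xi>(1)] g_rank[OF \<Xi>] face_rank[OF \<Xi>] by simp
  qed
  have mono: "(g F, g G) \<in> r" if FG: "(F, G) \<in> r" for F G
  proof -
    have "{F, G} \<in> Chains r" using FG le_refl[of F] le_refl[of G] by (auto simp: Chains_def Field_def)
    then obtain \<Xi> where \<Xi>: "\<Xi> \<in> flags r" "F \<in> \<Xi>" "G \<in> \<Xi>" using chain_extends_to_flag by blast
    show ?thesis
      using flag_le_iff[OF f[OF \<Xi>(1)] g_in[OF \<Xi>(1,2)] g_in[OF \<Xi>(1,3)]] g_rank[OF \<Xi>(1,2)] g_rank[OF \<Xi>(1,3)]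
        rank_mono[OF FG] by simp
  qed
  have "bij_betw g (Field r) (Field r)"
    by (rule bij_betw_byWitness[of _ g]) (use gg gF in auto)
  moreover have "(g F, g G) \<in> r \<longleftrightarrow> (F, G) \<in> r" if "F \<in> Field r" "G \<in> Field r" for F G
    using mono[of F G] mono[of "g F" "g G"] gg that by auto
  ultimately have "g \<in> carrier Aut"
    by (auto simp: polytope_aut_group_simps Bij_def g_def)
  moreover have "g ` \<Xi> = f \<Xi>" if \<Xi>: "\<Xi> \<in> flags r" for \<Xi>
  proof (rule card_subset_eq)
    show "finite (f \<Xi>)" using finite_chain[OF flag_chain[OF f[OF \<Xi>]]] .
    show "g ` \<Xi> \<subseteq> f \<Xi>" using g_in[OF \<Xi>] by blast
    show "card (g ` \<Xi>) = card (f \<Xi>)"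
      using card_flag[OF aut_flag[OF calculation \<Xi>]] card_flag[OF f[OF \<Xi>]] by simp
  qed
  ultimately show ?thesis by blast
qed

end

lemma polytope_if_abstract_polytope:
  assumes "abstract_polytope n r" "finite (Field r)"
  shows "polytope n r"
proof
  show "Partial_order r" "finite (Field r)" "strongly_flag_connected r"
    "\<exists>L \<in> Field r. \<forall>F \<in> Field r. (L, F) \<in> r" "\<exists>T \<in> Field r. \<forall>F \<in> Field r. (F, T) \<in> r"
    "\<And>C. C \<in> flags r \<Longrightarrow> card C = n + 2"
    using assms by (auto simp: abstract_polytope_def)
  fix F G assume "(F, G) \<in> r" "rank r G = rank r F + 2"
  then show "card {H. strictly_below r F H \<and> strictly_below r H G} = 2"
    using assms(1) unfolding abstract_polytope_def by (meson FieldI1 FieldI2)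
qed

section \<open>Chiral polytopes\<close>

context diamond_poset
begin

sublocale Aut: group Aut by (rule group_polytope_aut_group)

lemma orbit_image:
  assumes g: "g \<in> carrier Aut" and \<Phi>: "\<Phi> \<in> flags r"
  shows "orbit Aut image (g ` \<Phi>) = orbit Aut image \<Phi>"
proof -
  have "h ` g ` \<Phi> \<in> orbit Aut image \<Phi>" if "h \<in> carrier Aut" for h
    using aut_mult_image[OF that g \<Phi>] Aut.m_closed[OF that g] unfolding orbit_def by (metis (mono_tags, lifting) mem_Collect_eq)
  moreover have "h ` \<Phi> \<in> orbit Aut image (g ` \<Phi>)" if h: "h \<in> carrier Aut" for h
  proof -
    have "(h \<otimes>\<^bsub>Aut\<^esub> inv\<^bsub>Aut\<^esub> g) ` g ` \<Phi> = (h \<otimes>\<^bsub>Aut\<^esub> inv\<^bsub>Aut\<^esub> g \<otimes>\<^bsub>Aut\<^esub> g) ` \<Phi>"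
      using g h \<Phi> by (intro aut_mult_image[symmetric]) auto
    also have "\<dots> = h ` \<Phi>" using g h by (simp add: Aut.m_assoc)
    finally show ?thesis using Aut.m_closed[OF h Aut.inv_closed[OF g]] unfolding orbit_def
      by (metis (mono_tags, lifting) mem_Collect_eq)
  qed
  ultimately show ?thesis unfolding orbit_def by blast
qed

lemma orbit_self: "\<Phi> \<in> flags r \<Longrightarrow> \<Phi> \<in> orbit Aut image \<Phi>"
  using aut_one_image Aut.one_closed unfolding orbit_def by (metis (mono_tags, lifting) mem_Collect_eq)

end

locale chiral_poset = polytope +
  fixes \<Phi> :: "'a set"
  assumes two_orbits: "card (orbits Aut (flags r) image) = 2"
    and adjacent_orbits: "\<And>\<Xi> \<Psi>. adjacent r \<Xi> \<Psi> \<Longrightarrow> orbit Aut image \<Xi> \<noteq> orbit Aut image \<Psi>"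
    and base: "\<Phi> \<in> flags r"
begin

lemma orbit_adj: "\<Xi> \<in> flags r \<Longrightarrow> i < n \<Longrightarrow> orbit Aut image (adj r i \<Xi>) \<noteq> orbit Aut image \<Xi>"
  using adjacent_orbits adjacent_at_adj unfolding adjacent_def by metis

text \<open>Every adjacency switches the orbit and there are only two orbits, so two adjacencies
  lead back to the orbit of the start. This is where the rotations come from.\<close>

lemma adj_adj_in_orbit:
  assumes \<Xi>: "\<Xi> \<in> flags r" and "i < n" "j < n"
  shows "\<exists>g \<in> carrier Aut. g ` \<Xi> = adj r j (adj r i \<Xi>)"
proof -
  let ?O = "orbit Aut image"
  have fl: "adj r i \<Xi> \<in> flags r" "adj r j (adj r i \<Xi>) \<in> flags r" using assms adj_flag by auto
  obtain O1 O2 where "orbits Aut (flags r) image = {O1, O2}"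
    using two_orbits by (meson card_2_iff)
  moreover have "?O \<Psi> \<in> orbits Aut (flags r) image" if "\<Psi> \<in> flags r" for \<Psi>
    using that unfolding orbits_def by blast
  ultimately have "?O \<Psi> = O1 \<or> ?O \<Psi> = O2" if "\<Psi> \<in> flags r" for \<Psi> using that by blast
  then have "?O (adj r j (adj r i \<Xi>)) = ?O \<Xi>"
    using orbit_adj[OF \<Xi> assms(2)] orbit_adj[OF fl(1) assms(3)] \<Xi> fl by metis
  then have "adj r j (adj r i \<Xi>) \<in> ?O \<Xi>" using orbit_self[OF fl(2)] by simp
  then show ?thesis unfolding orbit_def by auto
qed

abbreviation \<sigma> where "\<sigma> \<equiv> chiral_rotation r \<Phi>"

lemma rotation:
  assumes "1 \<le> i" "i \<le> n - 1"
  shows "\<sigma> i \<in> carrier Aut" "\<sigma> i ` \<Phi> = adj r i (adj r (i - 1) \<Phi>)"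
proof -
  let ?P = "\<lambda>g. g \<in> carrier Aut \<and> g ` \<Phi> = adj r i (adj r (i - 1) \<Phi>)"
  have "i - 1 < n" "i < n" using assms by arith+
  then have "\<exists>g. ?P g" using adj_adj_in_orbit[OF base] by blast
  moreover have "g = h" if "?P g" "?P h" for g h
    using aut_unique[of g h \<Phi>] base that by metis
  ultimately have "\<exists>!g. ?P g" by blast
  from theI'[OF this] have "?P (\<sigma> i)" unfolding chiral_rotation_def .
  then show "\<sigma> i \<in> carrier Aut" "\<sigma> i ` \<Phi> = adj r i (adj r (i - 1) \<Phi>)" by auto
qed

lemma rotations_Pi: "1 \<le> i \<Longrightarrow> j \<le> n - 1 \<Longrightarrow> \<sigma> \<in> {i..j} \<rightarrow> carrier Aut"
  using rotation(1) by auto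

text \<open>The flags telescope although no reflections exist: \<open>\<sigma> k\<close> commutes
  with adjacencies, and the k-adjacency in its value on the base flag cancels the one left by the
  shorter product.\<close>

lemma rot_prod_image:
  assumes "1 \<le> i" "i \<le> j" "j \<le> n - 1"
  shows "rot_prod Aut \<sigma> i j ` \<Phi> = adj r j (adj r (i - 1) \<Phi>)"
  using assms(2,1)
proof (induction i rule: inc_induct)
  case base
  then show ?case using rotation[of j] assms by (simp add: Aut.rot_prod_single)
next
  case (step k)
  have k: "1 \<le> k" "k \<le> n - 1" "k < n" "j < n" "k - 1 < n" using step assms by auto
  have R: "rot_prod Aut \<sigma> (Suc k) j \<in> carrier Aut"
    using rotations_Pi[of "Suc k" j] assms by (intro Aut.rot_prod_closed) auto
  have fl: "adj r k \<Phi> \<in> flags r" "adj r (k - 1) \<Phi> \<in> flags r" using adj_flag[OF base] k by auto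
  have "rot_prod Aut \<sigma> k j ` \<Phi> = \<sigma> k ` rot_prod Aut \<sigma> (Suc k) j ` \<Phi>"
    using step.hyps aut_mult_image[OF rotation(1)[OF k(1,2)] R base] by (simp add: rot_prod_rec)
  also have "\<dots> = \<sigma> k ` adj r j (adj r k \<Phi>)" using step.IH k by simp
  also have "\<dots> = adj r j (adj r k (\<sigma> k ` \<Phi>))"
    using aut_adj[OF rotation(1)[OF k(1,2)]] base fl k by simp
  also have "\<dots> = adj r j (adj r (k - 1) \<Phi>)"
    using rotation(2)[OF k(1,2)] adj_adj[OF fl(2) k(3)] by simp
  finally show ?case .
qed

text \<open>The square of the product applies the adjacencies of ranks i - 1 and j twice each. They
  commute, so the base flag is fixed, and by rigidity the square is trivial.\<close>

lemma Wplus_relations_rotations: "Wplus_relations n Aut \<sigma>"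
  unfolding Wplus_relations_def
proof (intro conjI allI impI)
  show "\<sigma> \<in> {1..n - 1} \<rightarrow> carrier Aut" by (rule rotations_Pi) auto
  fix i j assume ij: "1 \<le> i \<and> i < j \<and> j \<le> n - 1"
  then have lt: "i - 1 < n" "j < n" "Suc (i - 1) < j" by auto
  let ?R = "rot_prod Aut \<sigma> i j"
  have R: "?R \<in> carrier Aut" using rotations_Pi[of i j] ij by (intro Aut.rot_prod_closed) auto
  have im: "?R ` \<Phi> = adj r j (adj r (i - 1) \<Phi>)" using rot_prod_image[of i j] ij by simp
  have fl: "adj r (i - 1) \<Phi> \<in> flags r" "adj r j \<Phi> \<in> flags r" "adj r j (adj r (i - 1) \<Phi>) \<in> flags r"
    using adj_flag base lt by auto
  have "(?R \<otimes>\<^bsub>Aut\<^esub> ?R) ` \<Phi> = adj r j (adj r (i - 1) (adj r j (adj r (i - 1) \<Phi>)))"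
    using aut_mult_image[OF R R base] im aut_adj[OF R] base fl lt by simp
  also have "\<dots> = adj r j (adj r j (adj r (i - 1) (adj r (i - 1) \<Phi>)))"
    using adj_commute[OF fl(1) lt(3,2)] by simp
  also have "\<dots> = \<one>\<^bsub>Aut\<^esub> ` \<Phi>"
    using adj_adj[OF base] lt aut_one_image[OF base] by simp
  finally show "?R \<otimes>\<^bsub>Aut\<^esub> ?R = \<one>\<^bsub>Aut\<^esub>"
    using aut_unique[OF Aut.m_closed[OF R R] Aut.one_closed base] by blast
qed

text \<open>If \<open>bar\<close> preserved the defining subgroup, then exchanging \<open>w\<Phi>\<close> with \<open>bar(w)\<Phi>'\<close> for all words
  \<open>w\<close>, where \<open>\<Phi>'\<close> is the \<open>0\<close>-adjacent flag of \<open>\<Phi>\<close>, would be a well-defined involution of the flags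
  that commutes with all adjacencies, hence a reflection taking \<open>\<Phi>\<close> to \<open>\<Phi>'\<close>.\<close>

theorem bar_image_not_subset:
  assumes n: "n \<ge> 3"
  shows "\<not> bar n ` defining_subgroup n Aut \<sigma> \<subseteq> defining_subgroup n Aut \<sigma>"
proof
  let ?W = "Wplus n"
  define \<nu> where "\<nu> = natural_hom n Aut \<sigma>"
  note \<nu> = natural_hom[OF Aut.group_axioms Wplus_relations_rotations, folded \<nu>_def]
  assume "bar n ` defining_subgroup n Aut \<sigma> \<subseteq> defining_subgroup n Aut \<sigma>"
  then have bar_ker: "\<nu> (bar n w) = \<one>\<^bsub>Aut\<^esub>" if "w \<in> carrier ?W" "\<nu> w = \<one>\<^bsub>Aut\<^esub>" for w
    using that unfolding defining_subgroup_def kernel_def \<nu>_def by blast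
  interpret W: group ?W by (rule group_Wplus)
  interpret \<nu>: group_hom ?W Aut \<nu> by unfold_locales (rule \<nu>(1))
  have bar_hom: "bar n \<in> hom ?W ?W" using bar_auto[OF n] by (simp add: auto_def)
  interpret bar: group_hom ?W ?W "bar n" by unfold_locales (rule bar_hom)
  have n0: "0 < n" using n by simp
  define \<Phi>' where "\<Phi>' = adj r 0 \<Phi>"
  have \<Phi>': "\<Phi>' \<in> flags r" unfolding \<Phi>'_def by (rule adj_flag[OF base n0])
  have adj0: "adj r 0 \<Phi>' = \<Phi>" unfolding \<Phi>'_def by (rule adj_adj[OF base n0])

  \<comment> \<open>The first place where invariance of the kernel is used: the map w \<mapsto>
    \<open>\<nu> (bar n w)\<close> depends only on \<open>\<nu> w\<close>, and by rigidity only on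
    the value of \<open>\<nu> w\<close> on one flag.\<close>
  have same: "\<nu> (bar n v) = \<nu> (bar n w)"
    if v: "v \<in> carrier ?W" and w: "w \<in> carrier ?W" and \<Xi>: "\<Xi> \<in> flags r" and eq: "\<nu> v ` \<Xi> = \<nu> w ` \<Xi>" for v w \<Xi>
  proof -
    have "\<nu> v = \<nu> w" using aut_unique[OF _ _ \<Xi> eq] v w \<nu>.hom_closed by blast
    then have "\<nu> (v \<otimes>\<^bsub>?W\<^esub> inv\<^bsub>?W\<^esub> w) = \<one>\<^bsub>Aut\<^esub>" using v w by simp
    then have "\<nu> (bar n (v \<otimes>\<^bsub>?W\<^esub> inv\<^bsub>?W\<^esub> w)) = \<one>\<^bsub>Aut\<^esub>" using v w by (intro bar_ker) auto
    then have "\<nu> (bar n v) \<otimes>\<^bsub>Aut\<^esub> inv\<^bsub>Aut\<^esub> \<nu> (bar n w) = \<one>\<^bsub>Aut\<^esub>" using v w by simp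
    then show ?thesis using v w by (metis Aut.inv_closed Aut.inv_equality Aut.inv_inv \<nu>.hom_closed bar.hom_closed)
  qed

  \<comment> \<open>Adjacent flags lie in different orbits, so the two cases in the definition of
    \<open>f\<close> below never overlap.\<close>
  have disjoint: "\<nu> v ` \<Phi> \<noteq> \<nu> w ` \<Phi>'" if "v \<in> carrier ?W" "w \<in> carrier ?W" for v w
    using orbit_image[OF \<nu>.hom_closed[OF that(1)] base] orbit_image[OF \<nu>.hom_closed[OF that(2)] \<Phi>']
      orbit_adj[OF base n0] unfolding \<Phi>'_def by metis

  \<comment> \<open>A word encoding i-adjacency at the base: \<open>t\<close> takes
    \<open>\<Phi>\<close> to the i-adjacent flag of \<open>\<Phi>'\<close>, and
    \<open>bar n t\<close> takes \<open>\<Phi>'\<close> to that of \<open>\<Phi>\<close>. The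
    witness is 1 for i = 0, the first generator for i = 1, and the product of the first i
    generators, which \<open>bar\<close> fixes, for i >= 2.\<close>
  have swap: "\<exists>t \<in> carrier ?W. bar n t \<in> carrier ?W \<and> \<nu> t ` \<Phi> = adj r i \<Phi>' \<and> \<nu> (bar n t) ` \<Phi> = adj r 0 (adj r i \<Phi>)"
    if i: "i < n" for i
  proof -
    have fl: "adj r i \<Phi> \<in> flags r" by (rule adj_flag[OF base i])
    have g1: "Wplus_gen n 1 \<in> carrier ?W" using n by simp
    consider "i = 0" | "i = 1" | "i \<ge> 2" by linarith
    then show ?thesis
    proof cases
      case 1
      then show ?thesis using adj0 adj_adj[OF base n0] aut_one_image[OF base]
        by (intro bexI[of _ "\<one>\<^bsub>?W\<^esub>"]) auto
    next
      case 2
      have \<sigma>1: "\<nu> (Wplus_gen n 1) = \<sigma> 1" "\<sigma> 1 \<in> carrier Aut" "\<sigma> 1 ` \<Phi> = adj r 1 \<Phi>'"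
        using \<nu>(3)[of 1] rotation[of 1] n by (auto simp: \<Phi>'_def)
      have n1: "1 < n" using n by simp
      have fl1: "adj r 1 \<Phi> \<in> flags r" "adj r 1 \<Phi>' \<in> flags r" using adj_flag n1 base \<Phi>' by auto
      have bt: "bar n (Wplus_gen n 1) = inv\<^bsub>?W\<^esub> Wplus_gen n 1"
        using bar_gen[OF n, of 1] n by (simp add: bar_gens_def)
      have "\<sigma> 1 ` adj r 0 (adj r 1 \<Phi>) = \<Phi>"
        using aut_adj[OF \<sigma>1(2)] \<sigma>1(3) fl1 base n0 n1 adj_adj[OF \<Phi>' n1] adj0 by simp
      then have "(inv\<^bsub>Aut\<^esub> \<sigma> 1) ` \<Phi> = (inv\<^bsub>Aut\<^esub> \<sigma> 1) ` \<sigma> 1 ` adj r 0 (adj r 1 \<Phi>)" by simp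
      also have "\<dots> = adj r 0 (adj r 1 \<Phi>)"
        using aut_mult_image[OF Aut.inv_closed[OF \<sigma>1(2)] \<sigma>1(2) adj_flag[OF fl1(1) n0]] \<sigma>1(2)
          aut_one_image[OF adj_flag[OF fl1(1) n0]] by simp
      finally have "\<nu> (bar n (Wplus_gen n 1)) ` \<Phi> = adj r 0 (adj r 1 \<Phi>)"
        unfolding bt using g1 \<sigma>1(1) by simp
      then show ?thesis using 2 g1 \<sigma>1 by (intro bexI[of _ "Wplus_gen n 1"]) auto
    next
      case 3
      let ?t = "rot_prod ?W (Wplus_gen n) 1 i"
      have gens: "Wplus_gen n \<in> {1..n - 1} \<rightarrow> carrier ?W" "Wplus_gen n \<in> {1..i} \<rightarrow> carrier ?W" using i by auto
      have t: "?t \<in> carrier ?W" by (rule W.rot_prod_closed[OF gens(2)])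
      have "\<nu> ?t = rot_prod Aut (\<lambda>k. \<nu> (Wplus_gen n k)) 1 i"
        by (rule W.hom_rot_prod[OF Aut.group_axioms \<nu>(1) gens(2)])
      also have "\<dots> = rot_prod Aut \<sigma> 1 i" by (rule rot_prod_cong) (use i \<nu>(3) in auto)
      finally have im: "\<nu> ?t ` \<Phi> = adj r i \<Phi>'" using rot_prod_image[of 1 i] i 3 by (simp add: \<Phi>'_def)
      have "bar n ?t = rot_prod ?W (\<lambda>k. bar n (Wplus_gen n k)) 1 i"
        by (rule W.hom_rot_prod[OF W.group_axioms bar_hom gens(2)])
      also have "\<dots> = rot_prod ?W (bar_gens ?W (Wplus_gen n)) 1 i"
        by (rule rot_prod_cong) (use i bar_gen[OF n] in auto)
      also have "\<dots> = ?t" by (rule W.rot_prod_bar_gens_1[OF gens(1) 3]) (use i in simp)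
      finally have "bar n ?t = ?t" .
      moreover have "adj r i \<Phi>' = adj r 0 (adj r i \<Phi>)"
        unfolding \<Phi>'_def using adj_commute[OF base, of 0 i] 3 i by simp
      ultimately show ?thesis using t im by (intro bexI[of _ ?t]) auto
    qed
  qed

  \<comment> \<open>Automorphisms act on the left, so adjacency at an arbitrary flag becomes right
    multiplication by \<open>t\<close> or \<open>bar n t\<close>, with the two kinds of flags
    exchanged.\<close>
  have step: "\<exists>t \<in> carrier ?W. (\<forall>w \<in> carrier ?W.
      adj r i (\<nu> w ` \<Phi>') = \<nu> (w \<otimes>\<^bsub>?W\<^esub> t) ` \<Phi> \<and> adj r i (\<nu> w ` \<Phi>) = \<nu> (w \<otimes>\<^bsub>?W\<^esub> bar n t) ` \<Phi>')"
    if i: "i < n" for i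
  proof -
    obtain t where t: "t \<in> carrier ?W" "bar n t \<in> carrier ?W" "\<nu> t ` \<Phi> = adj r i \<Phi>'"
      "\<nu> (bar n t) ` \<Phi> = adj r 0 (adj r i \<Phi>)" using swap[OF i] by blast
    have "\<nu> (bar n t) ` \<Phi>' = adj r i \<Phi>"
      using aut_adj[OF \<nu>.hom_closed[OF t(2)] base n0] t(4) adj_adj[OF adj_flag[OF base i] n0]
      by (simp add: \<Phi>'_def)
    then show ?thesis
      using t i aut_adj[OF \<nu>.hom_closed _ i] aut_mult_image base \<Phi>' \<nu>.hom_closed by (intro bexI[of _ t]) auto
  qed

  have cover: "\<exists>w \<in> carrier ?W. \<Xi> = \<nu> w ` \<Phi> \<or> \<Xi> = \<nu> w ` \<Phi>'" if "\<Xi> \<in> flags r" for \<Xi>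
  proof (rule flag_induct[OF base that])
    show "\<exists>w \<in> carrier ?W. \<Phi> = \<nu> w ` \<Phi> \<or> \<Phi> = \<nu> w ` \<Phi>'"
      using aut_one_image[OF base] by (intro bexI[of _ "\<one>\<^bsub>?W\<^esub>"]) auto
    fix \<Xi> i assume ex: "\<exists>w \<in> carrier ?W. \<Xi> = \<nu> w ` \<Phi> \<or> \<Xi> = \<nu> w ` \<Phi>'" and i: "i < n"
    from ex obtain w where w: "w \<in> carrier ?W" "\<Xi> = \<nu> w ` \<Phi> \<or> \<Xi> = \<nu> w ` \<Phi>'" by (rule bexE)
    from step[OF i] obtain t where t: "t \<in> carrier ?W" and st: "\<forall>w \<in> carrier ?W.
      adj r i (\<nu> w ` \<Phi>') = \<nu> (w \<otimes>\<^bsub>?W\<^esub> t) ` \<Phi> \<and> adj r i (\<nu> w ` \<Phi>) = \<nu> (w \<otimes>\<^bsub>?W\<^esub> bar n t) ` \<Phi>'"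
      by (rule bexE)
    have "w \<otimes>\<^bsub>?W\<^esub> t \<in> carrier ?W" "w \<otimes>\<^bsub>?W\<^esub> bar n t \<in> carrier ?W" using w(1) t by auto
    then show "\<exists>w \<in> carrier ?W. adj r i \<Xi> = \<nu> w ` \<Phi> \<or> adj r i \<Xi> = \<nu> w ` \<Phi>'"
      using w(2) bspec[OF st w(1)] by metis
  qed

  define f where "f \<Xi> = (if \<exists>w \<in> carrier ?W. \<Xi> = \<nu> w ` \<Phi>
    then \<nu> (bar n (SOME w. w \<in> carrier ?W \<and> \<Xi> = \<nu> w ` \<Phi>)) ` \<Phi>'
    else \<nu> (bar n (SOME w. w \<in> carrier ?W \<and> \<Xi> = \<nu> w ` \<Phi>')) ` \<Phi>)" for \<Xi>
  have f1: "f (\<nu> w ` \<Phi>) = \<nu> (bar n w) ` \<Phi>'" if w: "w \<in> carrier ?W" for w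
  proof -
    let ?v = "SOME v. v \<in> carrier ?W \<and> \<nu> w ` \<Phi> = \<nu> v ` \<Phi>"
    have "?v \<in> carrier ?W \<and> \<nu> w ` \<Phi> = \<nu> ?v ` \<Phi>" by (rule someI[of _ w]) (use w in simp)
    then have "\<nu> (bar n w) = \<nu> (bar n ?v)" using same[OF w _ base] by blast
    moreover have "f (\<nu> w ` \<Phi>) = \<nu> (bar n ?v) ` \<Phi>'" unfolding f_def by (rule if_P) (use w in blast)
    ultimately show ?thesis by simp
  qed
  have f2: "f (\<nu> w ` \<Phi>') = \<nu> (bar n w) ` \<Phi>" if w: "w \<in> carrier ?W" for w
  proof -
    let ?v = "SOME v. v \<in> carrier ?W \<and> \<nu> w ` \<Phi>' = \<nu> v ` \<Phi>'"
    have "?v \<in> carrier ?W \<and> \<nu> w ` \<Phi>' = \<nu> ?v ` \<Phi>'" by (rule someI[of _ w]) (use w in simp)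
    then have "\<nu> (bar n w) = \<nu> (bar n ?v)" using same[OF w _ \<Phi>'] by blast
    moreover have "f (\<nu> w ` \<Phi>') = \<nu> (bar n ?v) ` \<Phi>"
      unfolding f_def by (rule if_not_P) (use w disjoint in metis)
    ultimately show ?thesis by simp
  qed
  \<comment> \<open>Because \<open>bar\<close> is an involution, it also interchanges the two right
    multiplications; this is why \<open>f\<close> commutes with adjacencies.\<close>
  have bar_step: "bar n (w \<otimes>\<^bsub>?W\<^esub> bar n t) = bar n w \<otimes>\<^bsub>?W\<^esub> t" if "w \<in> carrier ?W" "t \<in> carrier ?W" for w t
    using that bar_bar[OF n] by simp

  have "\<exists>g \<in> carrier Aut. \<forall>\<Xi> \<in> flags r. g ` \<Xi> = f \<Xi>"
  proof (rule flag_involution_extends)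
    fix \<Xi> assume "\<Xi> \<in> flags r"
    from cover[OF this] obtain w where w: "w \<in> carrier ?W" "\<Xi> = \<nu> w ` \<Phi> \<or> \<Xi> = \<nu> w ` \<Phi>'" by (rule bexE)
    note c = bar.hom_closed[OF w(1)]
    show "f \<Xi> \<in> flags r"
      using w f1[OF w(1)] f2[OF w(1)] aut_flag[OF \<nu>.hom_closed[OF c]] base \<Phi>' by metis
    show "f (f \<Xi>) = \<Xi>"
      using w f1[OF w(1)] f2[OF w(1)] f1[OF c] f2[OF c] bar_bar[OF n w(1)] by metis
    fix i assume i: "i < n"
    from step[OF i] obtain t where t: "t \<in> carrier ?W" and st': "\<forall>w \<in> carrier ?W.
      adj r i (\<nu> w ` \<Phi>') = \<nu> (w \<otimes>\<^bsub>?W\<^esub> t) ` \<Phi> \<and> adj r i (\<nu> w ` \<Phi>) = \<nu> (w \<otimes>\<^bsub>?W\<^esub> bar n t) ` \<Phi>'"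
      by (rule bexE)
    note st = bspec[OF st', THEN conjunct1] bspec[OF st', THEN conjunct2]
    note bt = bar.hom_closed[OF t]
    from w(2) show "f (adj r i \<Xi>) = adj r i (f \<Xi>)"
    proof
      assume \<Xi>: "\<Xi> = \<nu> w ` \<Phi>"
      show ?thesis unfolding \<Xi> st(2)[OF w(1)] f1[OF w(1)] st(1)[OF c] f2[OF W.m_closed[OF w(1) bt]]
        bar_step[OF w(1) t] by (rule HOL.refl)
    next
      assume \<Xi>: "\<Xi> = \<nu> w ` \<Phi>'"
      show ?thesis unfolding \<Xi> st(1)[OF w(1)] f2[OF w(1)] st(2)[OF c] f1[OF W.m_closed[OF w(1) t]]
        bar.hom_mult[OF w(1) t] by (rule HOL.refl)
    qed
  qed
  then obtain g where g: "g \<in> carrier Aut" "g ` \<Phi> = f \<Phi>" using base by blast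
  have "f \<Phi> = \<Phi>'" using f1[OF W.one_closed] aut_one_image[OF base] aut_one_image[OF \<Phi>'] by simp
  then show False using g orbit_image[OF g(1) base] orbit_adj[OF base n0] unfolding \<Phi>'_def by metis
qed

end

lemma chiral_poset_if_chiral_polytope:
  assumes "chiral_polytope n r" "finite (Field r)" "\<Phi> \<in> flags r"
  shows "chiral_poset n r \<Phi>"
proof -
  interpret polytope n r
    using assms by (intro polytope_if_abstract_polytope) (auto simp: chiral_polytope_def)
  show ?thesis
    using assms by unfold_locales (auto simp: chiral_polytope_def)
qed

section \<open>Simplicity of alternating groups\<close>

lemma sym_group_simps [simp]:
  "carrier (sym_group n) = {p. p permutes {1..n}}"
  "monoid.mult (sym_group n) = (\<circ>)" "one (sym_group n) = id"
  by (simp_all add: sym_group_def)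

lemma alt_group_simps [simp]:
  "carrier (alt_group n) = {p. p permutes {1..n} \<and> evenperm p}"
  "monoid.mult (alt_group n) = (\<circ>)" "one (alt_group n) = id"
  by (simp_all add: alt_group_def)

lemma permutation_if_permutes: "p permutes {1..n::nat} \<Longrightarrow> permutation p"
  by (auto simp: permutation_permutes)

lemma evenperm_transpose_comp:
  assumes "permutation p" "a \<noteq> b"
  shows "evenperm (transpose a b \<circ> p) \<longleftrightarrow> \<not> evenperm p"
  using assms by (simp add: evenperm_comp permutation_swap_id evenperm_swap)

text \<open>Neighbouring products \<rho>_i \<rho>_(i+1) telescope to \<rho>_1 \<rho>_i, and their
  inverses give \<rho>_i \<rho>_1; even products of adjacent transpositions are built from
  these.\<close>

lemma alt_group_subset_of_adjacent_products:
  assumes H: "subgroup H (sym_group n)"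
    and s: "\<And>i. 1 \<le> i \<Longrightarrow> i + 2 \<le> n \<Longrightarrow> transpose i (i + 1) \<circ> transpose (i + 1) (i + 2) \<in> H"
  shows "carrier (alt_group n) \<subseteq> H"
proof -
  interpret S: group "sym_group n" by (rule sym_group_is_group)
  define \<rho> where "\<rho> i = transpose i (Suc i)" for i :: nat
  have \<rho>2: "\<rho> i \<circ> \<rho> i = id" for i by (simp add: \<rho>_def)
  have mH: "x \<circ> y \<in> H" if "x \<in> H" "y \<in> H" for x y
    using subgroup.m_closed[OF H that] by simp
  have iH: "inv' x \<in> H" if "x \<in> H" for x
    using subgroup.m_inv_closed[OF H that] that subgroup.subset[OF H] 
    by (metis subsetD sym_group_inv_equality)
  have \<rho>1: "\<rho> 1 \<circ> \<rho> i \<in> H" if "1 \<le> i" "i < n" for i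
    using that
  proof (induction i rule: dec_induct)
    case base
    then show ?case using subgroup.one_closed[OF H] by (metis \<rho>2 sym_group_simps(3))
  next
    case (step i)
    have "\<rho> 1 \<circ> \<rho> (Suc i) = (\<rho> 1 \<circ> \<rho> i) \<circ> (\<rho> i \<circ> \<rho> (Suc i))"
      using \<rho>2[of i] by (metis comp_assoc comp_id)
    moreover have "\<rho> i \<circ> \<rho> (Suc i) \<in> H" using step s[of i] by (simp add: \<rho>_def)
    moreover have "\<rho> 1 \<circ> \<rho> i \<in> H" using step by (metis Suc_lessD)
    ultimately show ?case using mH by metis
  qed
  have \<rho>1': "\<rho> i \<circ> \<rho> 1 \<in> H" if "1 \<le> i" "i < n" for i
    using iH[OF \<rho>1[OF that]] by (simp add: \<rho>_def o_inv_distrib)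
  \<comment> \<open>An invariant for all permutations, so that induction over single transpositions
    is possible: an odd permutation is first made even by \<rho>_1.\<close>
  define A where "A p \<longleftrightarrow> (if evenperm p then p \<in> H else \<rho> 1 \<circ> p \<in> H)" for p
  have A\<rho>: "A (\<rho> i \<circ> p)" if "A p" "p permutes {1..n}" "1 \<le> i" "i < n" for i p
  proof (cases "evenperm p")
    case True
    then have "(\<rho> 1 \<circ> \<rho> i) \<circ> p \<in> H" using that \<rho>1 mH by (simp add: A_def)
    then show ?thesis using True evenperm_transpose_comp[of p i "Suc i"] permutation_if_permutes[of p n] that
      by (simp add: A_def \<rho>_def comp_assoc)
  next
    case False
    then have "(\<rho> i \<circ> \<rho> 1) \<circ> (\<rho> 1 \<circ> p) \<in> H" using that \<rho>1' mH by (simp add: A_def)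
    moreover have "(\<rho> i \<circ> \<rho> 1) \<circ> (\<rho> 1 \<circ> p) = \<rho> i \<circ> p"
      using \<rho>2[of 1] by (metis comp_assoc comp_id)
    ultimately show ?thesis using False evenperm_transpose_comp[of p i "Suc i"] permutation_if_permutes[of p n] that
      by (simp add: A_def \<rho>_def)
  qed
  have p\<rho>: "transpose a b \<circ> p permutes {1..n}" if "p permutes {1..n}" "1 \<le> a" "a < b" "b \<le> n" for a b p
    using that by (intro permutes_compose permutes_swap_id) auto
  have At: "A (transpose a b \<circ> p)" if "A p" "p permutes {1..n}" "1 \<le> a" "a < b" "b \<le> n" for a b p
    using that(4,1,2,3,5)
  proof (induction b arbitrary: p)
    case 0
    then show ?case by simp
  next
    case (Suc b)
    show ?case
    proof (cases "a = b")
      case True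
      have "A (\<rho> b \<circ> p)" using A\<rho>[OF Suc.prems(2,3), of b] Suc.prems True by linarith
      then show ?thesis unfolding True \<rho>_def .
    next
      case False
      then have ab: "a < b" using Suc.prems by simp
      \<comment> \<open>(a b+1) = (a b)(b b+1)(a b): an arbitrary transposition is reduced to
        adjacent ones by induction on its larger point.\<close>
      have eq: "transpose a (Suc b) \<circ> p = transpose a b \<circ> (\<rho> b \<circ> (transpose a b \<circ> p))"
        using transpose_comp_triple[of a "Suc b" b] ab by (auto simp: \<rho>_def fun_eq_iff)
      have b: "b \<le> n" using Suc.prems by simp
      have 1: "A (transpose a b \<circ> p)" by (rule Suc.IH[OF ab Suc.prems(2-4) b])
      have 2: "A (\<rho> b \<circ> (transpose a b \<circ> p))" using A\<rho>[OF 1] p\<rho>[of p a b] Suc.prems ab by simp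
      have 3: "\<rho> b \<circ> (transpose a b \<circ> p) permutes {1..n}"
        using p\<rho>[OF p\<rho>[of p a b], of b "Suc b"] Suc.prems ab by (simp add: \<rho>_def)
      show ?thesis unfolding eq by (rule Suc.IH[OF ab 2 3 Suc.prems(4) b])
    qed
  qed
  show ?thesis
  proof
    fix p assume "p \<in> carrier (alt_group n)"
    then have p: "p permutes {1..n}" "evenperm p" by auto
    from p(1) finite_atLeastAtMost have "A p"
    proof (induction rule: permutes_induct)
      case id
      show ?case using subgroup.one_closed[OF H] unfolding A_def by (metis evenperm_id sym_group_simps(3))
    next
      case (swap a b p)
      show ?case
      proof (cases "a < b")
        case True
        then show ?thesis by (intro At) (use swap in auto)
      next
        case False
        then have "A (transpose b a \<circ> p)" by (intro At) (use swap in auto)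
        then show ?thesis by (metis transpose_commute)
      qed
    qed
    then show "p \<in> H" using p by (simp add: A_def)
  qed
qed

section \<open>Three-cycles and normal subgroups of the alternating group\<close>

definition three_cycle :: "'a \<Rightarrow> 'a \<Rightarrow> 'a \<Rightarrow> 'a \<Rightarrow> 'a" where
  "three_cycle a b c = transpose a b \<circ> transpose b c"

lemma three_cycle_in_alt_group:
  assumes "distinct [a, b, c]" "{a, b, c} \<subseteq> {1..n}"
  shows "three_cycle a b c \<in> carrier (alt_group n)"
proof -
  have "transpose a b \<circ> transpose b c permutes {1..n}"
    using assms by (intro permutes_compose permutes_swap_id) auto
  then show ?thesis using assms
    by (simp add: three_cycle_def evenperm_comp permutation_swap_id evenperm_swap)
qed

lemma three_cycle_conj:
  assumes "bij p"
  shows "p \<circ> three_cycle a b c \<circ> inv' p = three_cycle (p a) (p b) (p c)"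
proof -
  have *: "p \<circ> transpose x y = transpose (p x) (p y) \<circ> p" for x y
    using assms by (auto simp: fun_eq_iff transpose_def bij_def inj_eq)
  have "p \<circ> three_cycle a b c = three_cycle (p a) (p b) (p c) \<circ> p"
    unfolding three_cycle_def by (metis "*" comp_assoc)
  then show ?thesis using assms by (simp add: comp_assoc bij_is_surj surj_iff[THEN iffD1])
qed

lemma three_cycle_apply:
  "distinct [a, b, c] \<Longrightarrow> three_cycle a b c x = (if x = a then b else if x = b then c else if x = c then a else x)"
  by (auto simp: three_cycle_def transpose_def)

lemma inv_three_cycle: "inv' (three_cycle a b c) = three_cycle c b a"
  by (simp add: three_cycle_def o_inv_distrib transpose_commute)

lemma exists_not_in_list:
  assumes "length xs < n"
  shows "\<exists>e \<in> {1..n::nat}. e \<notin> set xs"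
proof -
  have "card (set xs) < card {1..n}" using card_length[of xs] assms by simp
  then show ?thesis using card_mono[of "set xs" "{1..n}"] by (meson List.finite_set not_le subsetI)
qed

locale alt_normal =
  fixes n :: nat and H :: "(nat \<Rightarrow> nat) set"
  assumes n5: "n \<ge> 5" and normal: "H \<lhd> alt_group n"
begin

sublocale normal H "alt_group n" by (rule normal)

lemma in_alt: "h \<in> H \<Longrightarrow> h permutes {1..n} \<and> evenperm h"
  using subset by auto

lemma conj_closed:
  assumes "h \<in> H" "p \<in> carrier (alt_group n)"
  shows "p \<circ> h \<circ> inv' p \<in> H"
  using inv_op_closed2[OF assms(2,1)] alt_group_inv_equality[OF assms(2)] by simp

lemma comp_closed: "h \<in> H \<Longrightarrow> k \<in> H \<Longrightarrow> h \<circ> k \<in> H"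
  using subgroup.m_closed[OF subgroup_axioms, of h k] unfolding alt_group_simps .

lemma inv_closed': 
  assumes "h \<in> H"
  shows "inv' h \<in> H"
proof -
  have "h \<in> carrier (alt_group n)" using assms subset by blast
  then show ?thesis using subgroup.m_inv_closed[OF subgroup_axioms assms]
    unfolding alt_group_inv_equality[OF \<open>h \<in> carrier (alt_group n)\<close>] by simp
qed

lemma commutator_closed:
  assumes "h \<in> H" "p \<in> carrier (alt_group n)"
  shows "h \<circ> (p \<circ> inv' h \<circ> inv' p) \<in> H"
  using comp_closed conj_closed inv_closed' assms by blast

lemma bij: "h \<in> H \<Longrightarrow> bij h" using in_alt permutes_bij by blast

lemma in_range_if_moved: "h \<in> H \<Longrightarrow> h x \<noteq> x \<Longrightarrow> x \<in> {1..n} \<and> h x \<in> {1..n}"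
  using in_alt by (metis permutes_def permutes_in_image)

text \<open>The commutator of \<open>h\<close> with (a b c): the conjugate of the three-cycle by
  \<open>h\<close>, times its inverse. It moves at most six points, and suitable choices of a, b, c
  make these overlap.\<close>

lemma commutator_three_cycle:
  assumes "h \<in> H" "distinct [a, b, c]" "{a, b, c} \<subseteq> {1..n}"
  shows "three_cycle (h a) (h b) (h c) \<circ> three_cycle c b a \<in> H"
proof -
  have "h \<circ> (three_cycle a b c \<circ> inv' h \<circ> inv' (three_cycle a b c)) \<in> H"
    by (rule commutator_closed[OF assms(1) three_cycle_in_alt_group[OF assms(2,3)]])
  then show ?thesis
    using three_cycle_conj[OF bij[OF assms(1)], of a b c] by (metis inv_three_cycle comp_assoc)
qed

text \<open>The even permutation carrying one three-cycle to another is corrected, if necessary, by a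
  transposition of two further points; this is where \<open>n \<ge> 5\<close> enters.\<close>

lemma all_if_three_cycle:
  assumes h: "three_cycle a b c \<in> H" and d: "distinct [a, b, c]" and abc: "{a, b, c} \<subseteq> {1..n}"
  shows "H = carrier (alt_group n)"
proof -
  have "three_cycle x y z \<in> H" if "distinct [x, y, z]" "{x, y, z} \<subseteq> {1..n}" for x y z
  proof -
    have "\<exists>p. p permutes {1..n} \<and> p a = x \<and> p b = y \<and> p c = z"
    proof -
      \<comment> \<open>Three transpositions put a, b, c in place one after another; each later one
        avoids the points already placed.\<close>
      define p1 where "p1 = transpose a x"
      define p2 where "p2 = transpose (p1 b) y"
      define p3 where "p3 = transpose (p2 (p1 c)) z"
      have *: "p1 permutes {1..n}" unfolding p1_def using abc that by (intro permutes_swap_id) auto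
      have *: "p1 permutes {1..n}" "p1 b \<in> {1..n}" "p1 c \<in> {1..n}"
        using * abc permutes_in_image[OF *] by auto
      have **: "p2 permutes {1..n}" unfolding p2_def using * abc that by (intro permutes_swap_id) auto
      have **: "p2 permutes {1..n}" "p2 (p1 c) \<in> {1..n}"
        using ** * abc permutes_in_image[OF **] by auto
      have ***: "p3 permutes {1..n}" unfolding p3_def using ** abc that by (intro permutes_swap_id) auto
      have "p3 \<circ> (p2 \<circ> p1) permutes {1..n}" using * ** *** by (intro permutes_compose)
      moreover have "p1 a = x" "p1 b \<noteq> x" "p1 c \<noteq> x" "p1 b \<noteq> p1 c"
        using d by (auto simp: p1_def transpose_def)
      moreover then have "p2 x = x" "p2 (p1 b) = y" "p2 (p1 c) \<noteq> y" "p2 (p1 c) \<noteq> x"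
        using that by (auto simp: p2_def transpose_def)
      moreover then have "p3 x = x" "p3 y = y" "p3 (p2 (p1 c)) = z" 
        using that by (auto simp: p3_def transpose_def)
      ultimately show ?thesis by (intro exI[of _ "p3 \<circ> (p2 \<circ> p1)"]) simp
    qed
    then obtain p where p: "p permutes {1..n}" "p a = x" "p b = y" "p c = z" by blast
    obtain u where u: "u \<in> {1..n}" "u \<notin> {x, y, z}"
      using exists_not_in_list[of "[x, y, z]" n] n5 by auto
    obtain v where v: "v \<in> {1..n}" "v \<notin> {x, y, z, u}"
      using exists_not_in_list[of "[x, y, z, u]" n] n5 by auto
    define q where "q = (if evenperm p then p else transpose u v \<circ> p)"
    have "q permutes {1..n}"
      using p(1) u v by (auto simp: q_def intro!: permutes_compose permutes_swap_id)
    moreover have "evenperm q"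
      using evenperm_transpose_comp[of p u v] permutation_if_permutes[OF p(1)] v by (auto simp: q_def)
    moreover have "q a = x" "q b = y" "q c = z"
      using p u v by (auto simp: q_def transpose_def)
    ultimately show ?thesis
      using conj_closed[OF h, of q] three_cycle_conj[of q a b c] permutes_bij[of q] by auto
  qed
  then show ?thesis
    using subset alt_group_subset_of_adjacent_products[of H n] 
      group.incl_subgroup[OF sym_group_is_group alt_group_is_subgroup, of H n] subgroup_axioms
    by (simp add: three_cycle_def alt_group_def)
qed

text \<open>With b, c, d the successive images of a, the commutator of \<open>h\<close> with (a b c)
  is (b c d)(c b a) = (a d b), a three-cycle.\<close>

lemma all_if_moves_four:
  assumes h: "h \<in> H" and d: "distinct [a, h a, h (h a), h (h (h a))]"
  shows "H = carrier (alt_group n)"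
proof -
  let ?b = "h a" let ?c = "h ?b" let ?d = "h ?c"
  have in_n: "{a, ?b, ?c, ?d} \<subseteq> {1..n}"
    using in_range_if_moved[OF h, of a] in_range_if_moved[OF h, of "?b"] in_range_if_moved[OF h, of "?c"] d
    by auto
  have "three_cycle ?b ?c ?d \<circ> three_cycle ?c ?b a \<in> H"
    using commutator_three_cycle[OF h, of a ?b ?c] d in_n by auto
  moreover have "three_cycle ?b ?c ?d \<circ> three_cycle ?c ?b a = three_cycle a ?d ?b"
    using d by (auto simp: fun_eq_iff three_cycle_apply)
  ultimately show ?thesis using all_if_three_cycle[of a ?d ?b] d in_n by auto
qed

text \<open>With b and c the images of a, the commutator of \<open>h\<close> with (a b e) takes e to
  c, c to \<open>h e\<close> and \<open>h e\<close> to b; these points are distinct, so the case of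
  four successive points applies to it.\<close>

lemma all_if_three_cycle_and_moves:
  assumes h: "h \<in> H" and d: "distinct [a, h a, h (h a)]" and c: "h (h (h a)) = a"
    and e: "e \<notin> {a, h a, h (h a)}" "h e \<noteq> e"
  shows "H = carrier (alt_group n)"
proof -
  let ?b = "h a" let ?c = "h ?b"
  have inj: "h x = h y \<longleftrightarrow> x = y" for x y using bij[OF h] by (simp add: bij_def inj_eq)
  have f: "h e \<notin> {a, ?b, ?c, e}" using e d inj[of e a] inj[of e ?b] inj[of e ?c] c by auto
  have in_n: "{a, ?b, ?c, e, h e} \<subseteq> {1..n}"
    using in_range_if_moved[OF h, of a] in_range_if_moved[OF h, of "?b"] in_range_if_moved[OF h, of e] d e
    by auto
  have k: "three_cycle ?b ?c (h e) \<circ> three_cycle e ?b a \<in> H" (is "?k \<in> H")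
    using commutator_three_cycle[OF h, of a ?b e] d e in_n by auto
  have "?k e = ?c" "?k ?c = h e" "?k (h e) = ?b"
    using d e f by (auto simp: three_cycle_apply)
  then show ?thesis using all_if_moves_four[OF k, of e] d e f by auto
qed

text \<open>The commutator \<open>k\<close> of \<open>h\<close> with (a ha b) swaps a and b and
  fixes a fifth point e. The commutator of \<open>k\<close> with (a b e) is then (b a e)(e b a) = (a
  b e).\<close>

lemma all_if_double_transposition:
  assumes h: "h \<in> H" and d: "distinct [a, h a, b, h b]" and i: "h (h a) = a" "h (h b) = b"
  shows "H = carrier (alt_group n)"
proof -
  let ?a = "h a" let ?b = "h b"
  have in_n: "{a, ?a, b, ?b} \<subseteq> {1..n}"
    using in_range_if_moved[OF h, of a] in_range_if_moved[OF h, of b] d by auto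
  obtain e where e: "e \<in> {1..n}" "e \<notin> {a, ?a, b, ?b}"
    using exists_not_in_list[of "[a, ?a, b, ?b]" n] n5 by auto
  have k: "three_cycle ?a a ?b \<circ> three_cycle b ?a a \<in> H" (is "?k \<in> H")
    using commutator_three_cycle[OF h, of a ?a b] i d in_n by auto
  have "?k a = b" "?k b = a" "?k e = e"
    using d e by (auto simp: three_cycle_apply)
  then have "three_cycle b a e \<circ> three_cycle e b a \<in> H"
    using commutator_three_cycle[OF k, of a b e] e in_n d by auto
  moreover have "three_cycle b a e \<circ> three_cycle e b a = three_cycle a b e"
    using d e by (auto simp: fun_eq_iff three_cycle_apply)
  ultimately show ?thesis using all_if_three_cycle[of a b e] e d in_n by auto
qed

text \<open>A case distinction on a nontrivial \<open>h\<close>. An involution that is even is no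
  single transposition, so it swaps two disjoint pairs. Otherwise some cycle has length at least 3:
  it is longer than 3, or is a three-cycle beside another moved point, or is all of
  \<open>h\<close>.\<close>

lemma trivial_or_all: "H = {id} \<or> H = carrier (alt_group n)"
proof (rule disjCI)
  assume ne: "H \<noteq> carrier (alt_group n)"
  have "h = id" if h: "h \<in> H" for h
  proof (rule ccontr)
    assume "h \<noteq> id"
    then obtain a where a: "h a \<noteq> a" by (auto simp: fun_eq_iff)
    have inj: "h x = h y \<longleftrightarrow> x = y" for x y using bij[OF h] by (simp add: bij_def inj_eq)
    show False
    proof (cases "\<forall>x. h (h x) = x")
      case True
      have "h \<noteq> transpose a (h a)"
        using in_alt[OF h] a by (metis evenperm_swap)
      then obtain b where b: "h b \<noteq> transpose a (h a) b" by (auto simp: fun_eq_iff)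
      then have "b \<notin> {a, h a}" "h b \<noteq> b"
        using True by (auto simp: transpose_def split: if_splits)
      then have "distinct [a, h a, b, h b]" using a True by (metis distinct_length_2_or_more distinct_singleton insertCI)
      then show False using all_if_double_transposition[OF h] True ne by blast
    next
      case False
      then obtain x where x: "h (h x) \<noteq> x" by blast
      then have d: "distinct [x, h x, h (h x)]" using inj[of x "h x"] by auto
      show False
      proof (cases "h (h (h x)) = x")
        case False
        then have "distinct [x, h x, h (h x), h (h (h x))]" using d False inj by (metis distinct_length_2_or_more distinct_singleton)
        then show False using all_if_moves_four[OF h] ne by blast
      next
        case True
        have in_n: "{x, h x, h (h x)} \<subseteq> {1..n}" 
          using in_range_if_moved[OF h, of x] in_range_if_moved[OF h, of "h x"] d by simp
        have rest: "h e = e" if "e \<notin> {x, h x, h (h x)}" for e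
          using all_if_three_cycle_and_moves[OF h d True that] ne by blast
        have "h e = three_cycle x (h x) (h (h x)) e" for e
          unfolding three_cycle_apply[OF d] using rest[of e] True by (simp split: if_split)
        then have "three_cycle x (h x) (h (h x)) \<in> H" using h by (metis ext)
        then show False using all_if_three_cycle d in_n ne by blast
      qed
    qed
  qed
  then show "H = {id}" using subgroup.one_closed[OF subgroup_axioms] by auto
qed

end

section \<open>The simplex\<close>

lemma simplex_iff: "(A, B) \<in> simplex n \<longleftrightarrow> A \<subseteq> B \<and> B \<subseteq> {0..n}"
  by (simp add: simplex_def)

lemma Field_simplex: "Field (simplex n) = Pow {0..n}"
proof -
  have "A \<in> Field (simplex n) \<longleftrightarrow> A \<subseteq> {0..n}" for A
    unfolding Field_def Un_iff Domain_iff Range_iff simplex_iff by blast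
  then show ?thesis by blast
qed

lemma finite_simplex_face: "A \<in> Field (simplex n) \<Longrightarrow> finite A"
  unfolding Field_simplex by (auto intro: finite_subset)

lemma Chains_simplex:
  "C \<in> Chains (simplex n) \<longleftrightarrow> C \<subseteq> Pow {0..n} \<and> (\<forall>A \<in> C. \<forall>B \<in> C. A \<subseteq> B \<or> B \<subseteq> A)"
  unfolding Chains_def mem_Collect_eq simplex_iff by blast

lemma in_flag_if_comparable:
  assumes C: "C \<in> flags (simplex n)" and D: "D \<subseteq> {0..n}" "\<And>A. A \<in> C \<Longrightarrow> A \<subseteq> D \<or> D \<subseteq> A"
  shows "D \<in> C"
proof -
  have "C \<in> Chains (simplex n)" using C by (simp add: flags_def)
  then have "insert D C \<in> Chains (simplex n)" using D unfolding Chains_simplex by blast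
  then have "insert D C = C" using C unfolding flags_def by blast
  then show ?thesis by blast
qed

lemma inj_on_card_simplex_chain: 
  assumes "C \<in> Chains (simplex n)"
  shows "inj_on card C"
proof (rule inj_onI)
  fix A B assume AB: "A \<in> C" "B \<in> C" "card A = card B"
  then have "finite A" "finite B" "A \<subseteq> B \<or> B \<subseteq> A"
    using assms unfolding Chains_simplex by (auto intro: finite_subset)
  then show "A = B" using AB(3) by (metis card_subset_eq)
qed

text \<open>Flags have no gaps: if B is a smallest member properly above A, then A with one point of
  B added is comparable to every member, so it belongs to the flag by maximality.\<close>

lemma simplex_flag_has_card:
  assumes C: "C \<in> flags (simplex n)" and "k \<le> n + 1"
  shows "\<exists>A \<in> C. card A = k"
  using assms(2)
proof (induction k)
  case 0
  have "{} \<in> C" by (rule in_flag_if_comparable[OF C]) auto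
  then show ?case by force
next
  case (Suc k)
  then obtain A where A: "A \<in> C" "card A = k" by auto
  have chain: "C \<subseteq> Pow {0..n}" "\<And>A B. A \<in> C \<Longrightarrow> B \<in> C \<Longrightarrow> A \<subseteq> B \<or> B \<subseteq> A"
    using C unfolding flags_def Chains_simplex by auto
  have "{0..n} \<in> C" by (rule in_flag_if_comparable[OF C]) (use chain(1) in auto)
  moreover have "A \<noteq> {0..n}" using A(2) Suc.prems by auto
  ultimately have "{0..n} \<in> C \<and> A \<subset> {0..n}" using A(1) chain(1) by auto
  then obtain B where B: "B \<in> C \<and> A \<subset> B" and least: "\<And>E. E \<in> C \<and> A \<subset> E \<Longrightarrow> card B \<le> card E"
    using ex_has_least_nat[of "\<lambda>B. B \<in> C \<and> A \<subset> B" "{0..n}" card] by blast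
  obtain x where x: "x \<in> B" "x \<notin> A" using B by blast
  have "insert x A \<in> C"
  proof (rule in_flag_if_comparable[OF C])
    show "insert x A \<subseteq> {0..n}" using x B chain(1) by blast
    fix E assume E: "E \<in> C"
    show "E \<subseteq> insert x A \<or> insert x A \<subseteq> E"
    proof (cases "E \<subseteq> A")
      case False
      then have AE: "A \<subset> E" using chain(2)[OF E A(1)] by blast
      have "finite B" using B chain(1) by (meson PowD finite_atLeastAtMost finite_subset subsetD)
      then have "B \<subseteq> E" using least[of E] E AE chain(2)[of B E] B card_seteq by blast
      then show ?thesis using x B by blast
    qed blast
  qed
  moreover have "finite A" using A(1) chain(1) by (meson PowD finite_atLeastAtMost finite_subset subsetD)
  ultimately show ?case using x(2) A(2) by (intro bexI[of _ "insert x A"]) auto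
qed

lemma card_image_simplex_flag:
  assumes C: "C \<in> flags (simplex n)"
  shows "card ` C = {0..n + 1}"
proof (rule subset_antisym)
  show "card ` C \<subseteq> {0..n + 1}"
  proof
    fix k assume "k \<in> card ` C"
    then obtain A where "A \<in> C" "k = card A" by blast
    moreover then have "card A \<le> card {0..n}"
      using C unfolding flags_def Chains_simplex by (intro card_mono) auto
    ultimately show "k \<in> {0..n + 1}" by simp
  qed
  show "{0..n + 1} \<subseteq> card ` C" using simplex_flag_has_card[OF C] by fastforce
qed

interpretation simplex: graded_poset n "simplex n" for n
proof
  have "refl_on (Field (simplex n)) (simplex n)" 
    unfolding refl_on_def Field_simplex by (auto simp: simplex_iff)
  moreover have "trans (simplex n)" by (rule transI) (auto simp: simplex_iff)
  moreover have "antisym (simplex n)" by (rule antisymI) (auto simp: simplex_iff)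
  moreover have "simplex n \<subseteq> Field (simplex n) \<times> Field (simplex n)" by (auto simp: Field_def)
  ultimately show "Partial_order (simplex n)" by (simp add: partial_order_on_def preorder_on_def)
  show "finite (Field (simplex n))" by (simp add: Field_simplex)
  fix C assume C: "C \<in> flags (simplex n)"
  then have "card C = card (card ` C)"
    using card_image[OF inj_on_card_simplex_chain, of C n] by (simp add: flags_def)
  then show "card C = n + 2" unfolding card_image_simplex_flag[OF C] by simp
qed

lemma rank_simplex:
  assumes A: "A \<in> Field (simplex n)"
  shows "rank (simplex n) A = int (card A) - 1"
proof -
  have "{A} \<in> Chains (simplex n)" using A by (auto simp: Chains_simplex Field_simplex)
  then obtain C where C: "C \<in> flags (simplex n)" "A \<in> C" using simplex.chain_extends_to_flag by blast
  have chain: "C \<subseteq> Pow {0..n}" "\<And>A B. A \<in> C \<Longrightarrow> B \<in> C \<Longrightarrow> A \<subseteq> B \<or> B \<subseteq> A"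
    using C(1) unfolding flags_def Chains_simplex by auto
  have fin: "finite B" if "B \<in> C" for B using that chain(1) by (meson PowD finite_atLeastAtMost finite_subset subsetD)
  have "strictly_below (simplex n) B A \<longleftrightarrow> card B < card A" if B: "B \<in> C" for B
  proof
    assume "strictly_below (simplex n) B A"
    then have "B \<subset> A" by (auto simp: strictly_below_def simplex_iff)
    then show "card B < card A" using fin C(2) by (simp add: psubset_card_mono)
  next
    assume less: "card B < card A"
    then have "\<not> A \<subseteq> B" using card_mono[OF fin[OF B], of A] by auto
    then show "strictly_below (simplex n) B A"
      using chain(2)[OF B C(2)] chain(1) C(2) less by (auto simp: strictly_below_def simplex_iff)
  qed
  then have "{B \<in> C. strictly_below (simplex n) B A} = {B \<in> C. card B < card A}" by blast
  moreover have "card {B \<in> C. card B < card A} = card (card ` {B \<in> C. card B < card A})"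
    using C(1) by (intro card_image[symmetric] inj_on_subset[OF inj_on_card_simplex_chain]) (auto simp: flags_def)
  moreover have "card ` {B \<in> C. card B < card A} = {0..<card A}"
  proof -
    have "card A \<in> {0..n + 1}" using card_image_simplex_flag[OF C(1)] C(2) by blast
    then have "{0..<card A} \<subseteq> card ` C" unfolding card_image_simplex_flag[OF C(1)] by auto
    then show ?thesis by auto
  qed
  ultimately show ?thesis using simplex.rank_in_flag[OF C] by simp
qed

interpretation simplex: diamond_poset n "simplex n" for n
proof
  show "\<exists>L \<in> Field (simplex n). \<forall>F \<in> Field (simplex n). (L, F) \<in> simplex n"
    by (rule bexI[of _ "{}"]) (auto simp: Field_simplex simplex_iff)
  show "\<exists>T \<in> Field (simplex n). \<forall>F \<in> Field (simplex n). (F, T) \<in> simplex n"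
    by (rule bexI[of _ "{0..n}"]) (auto simp: Field_simplex simplex_iff)
  fix F G assume FG: "(F, G) \<in> simplex n" and rank: "rank (simplex n) G = rank (simplex n) F + 2"
  have Field: "F \<in> Field (simplex n)" "G \<in> Field (simplex n)" using FG by (auto simp: Field_def)
  then have fin: "finite F" "finite G" by (auto dest: finite_simplex_face)
  have sub: "F \<subseteq> G" "G \<subseteq> {0..n}" using FG by (auto simp: simplex_iff)
  have "card G = card F + 2" using rank Field by (simp add: rank_simplex)
  then have "card (G - F) = 2" using sub(1) fin by (simp add: card_Diff_subset)
  then obtain x y where xy: "G - F = {x, y}" "x \<noteq> y" by (meson card_2_iff)
  have "{H. F \<subset> H \<and> H \<subset> G} = {insert x F, insert y F}"
  proof (intro subset_antisym subsetI)
    fix H assume "H \<in> {H. F \<subset> H \<and> H \<subset> G}"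
    then have H: "F \<subset> H" "H \<subset> G" by auto
    then have "H - F \<subseteq> {x, y}" "H - F \<noteq> {}" "H - F \<noteq> {x, y}" "H = F \<union> (H - F)" using xy sub by blast+
    then have "H - F = {x} \<or> H - F = {y}" by blast
    then show "H \<in> {insert x F, insert y F}" using \<open>H = F \<union> (H - F)\<close> by auto
  qed (use xy sub in auto)
  moreover have "{H. strictly_below (simplex n) F H \<and> strictly_below (simplex n) H G} = {H. F \<subset> H \<and> H \<subset> G}"
    using sub by (auto simp: strictly_below_def simplex_iff)
  moreover have "insert x F \<noteq> insert y F" using xy by blast
  ultimately show "card {H. strictly_below (simplex n) F H \<and> strictly_below (simplex n) H G} = 2" by simp
qed

text \<open>The reflection \<rho>_i on numbered vertices. Ranks start at 0 but
  \<open>alt_group (n + 1)\<close> permutes 1, ..., n + 1, hence the shift to i + 1 and i +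
  2.\<close>

definition adjacent_swap :: "nat \<Rightarrow> nat \<Rightarrow> nat" where
  "adjacent_swap i = transpose (Suc i) (Suc (Suc i))"

lemma adjacent_swap_permutes: "i < n \<Longrightarrow> adjacent_swap i permutes {1..n + 1}"
  unfolding adjacent_swap_def by (rule permutes_swap_id) auto

section \<open>Automorphisms of the simplex as permutations of its vertices\<close>

locale simplex_flag =
  fixes n :: nat and \<Psi> :: "nat set set"
  assumes flag: "\<Psi> \<in> flags (simplex n)"
begin

abbreviation "r \<equiv> simplex n"
abbreviation "Aut \<equiv> polytope_aut_group r"

lemma aut_card: "f \<in> carrier Aut \<Longrightarrow> A \<subseteq> {0..n} \<Longrightarrow> card (f A) = card A"
  using simplex.aut_rank[of f n A] rank_simplex[of A n] rank_simplex[of "f A" n] aut_apply_in_Field[of f r A]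
  by (simp add: Field_simplex)

lemma aut_subset: "f \<in> carrier Aut \<Longrightarrow> A \<subseteq> {0..n} \<Longrightarrow> f A \<subseteq> {0..n}"
  using aut_apply_in_Field[of f r A] by (simp add: Field_simplex)

lemma aut_subset_iff:
  "f \<in> carrier Aut \<Longrightarrow> A \<subseteq> {0..n} \<Longrightarrow> B \<subseteq> {0..n} \<Longrightarrow> f A \<subseteq> f B \<longleftrightarrow> A \<subseteq> B"
  using aut_subset[of f B] unfolding polytope_aut_group_simps Field_simplex simplex_iff by blast

text \<open>An automorphism is determined by its values on vertices: it is onto and preserves
  cardinality, so each point of \<open>f A\<close>, taken as a singleton, is the image of a single
  vertex, which lies in \<open>A\<close>.\<close>

lemma aut_eq_Union:
  assumes f: "f \<in> carrier Aut" and A: "A \<subseteq> {0..n}"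
  shows "f A = (\<Union>y \<in> A. f {y})"
proof (intro subset_antisym subsetI)
  fix x assume x: "x \<in> f A"
  have "f ` Pow {0..n} = Pow {0..n}"
    using f by (auto simp: polytope_aut_group_simps Bij_def bij_betw_def Field_simplex)
  moreover have "{x} \<in> Pow {0..n}" using x aut_subset[OF f A] by blast
  ultimately have "{x} \<in> f ` Pow {0..n}" by (simp only:)
  then obtain B where "{x} = f B" "B \<in> Pow {0..n}" by (rule imageE)
  then have B: "B \<subseteq> {0..n}" "f B = {x}" by simp_all
  then have "card B = 1" using aut_card[OF f B(1)] by simp
  then obtain y where y: "B = {y}" by (meson card_1_singletonE)
  have "f {y} \<subseteq> f A" using B y x by simp
  then have "y \<in> A" using aut_subset_iff[OF f _ A, of "{y}"] B y by simp
  then show "x \<in> (\<Union>y \<in> A. f {y})" using B y by blast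
next
  fix x assume "x \<in> (\<Union>y \<in> A. f {y})"
  then obtain y where y: "y \<in> A" "x \<in> f {y}" by blast
  have "{y} \<subseteq> {0..n}" using y(1) A by blast
  then have "f {y} \<subseteq> f A" using aut_subset_iff[OF f _ A] y(1) by simp
  then show "x \<in> f A" using y by blast
qed

text \<open>Indexed by the number of vertices, which exceeds the rank by one.\<close>

definition vertex_set :: "nat \<Rightarrow> nat set" where
  "vertex_set k = face r \<Psi> (int k - 1)"

lemma vertex_set:
  assumes "k \<le> n + 1"
  shows "vertex_set k \<in> \<Psi>" "vertex_set k \<subseteq> {0..n}" "card (vertex_set k) = k"
proof -
  show in_flag: "vertex_set k \<in> \<Psi>" unfolding vertex_set_def by (rule simplex.face_in_flag[OF flag]) (use assms in auto)
  then have "vertex_set k \<in> Field r" using simplex.flag_Field[OF flag] by blast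
  moreover have "rank r (vertex_set k) = int k - 1"
    unfolding vertex_set_def by (rule simplex.rank_face[OF flag]) (use assms in auto)
  ultimately show "vertex_set k \<subseteq> {0..n}" "card (vertex_set k) = k" by (auto simp: rank_simplex Field_simplex)
qed

lemma vertex_set_mono: "k \<le> l \<Longrightarrow> l \<le> n + 1 \<Longrightarrow> vertex_set k \<subseteq> vertex_set l"
  using simplex.face_le[OF flag, of "int k - 1" "int l - 1"] by (simp add: vertex_set_def simplex_iff)

lemma vertex_exists:
  assumes "1 \<le> k" "k \<le> n + 1"
  shows "\<exists>x. vertex_set k - vertex_set (k - 1) = {x}"
proof -
  have "vertex_set (k - 1) \<subseteq> {0..n}" using vertex_set(2) assms by simp
  then have "finite (vertex_set (k - 1))" using finite_subset by blast
  then have "card (vertex_set k - vertex_set (k - 1)) = 1"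
    using vertex_set(3) vertex_set_mono[of "k - 1" k] assms by (simp add: card_Diff_subset)
  then show ?thesis by (meson card_1_singletonE)
qed

text \<open>Numbers the vertices in the order in which the base flag acquires them, so that its
  faces become initial segments.\<close>

definition vertex :: "nat \<Rightarrow> nat" where
  "vertex k = (SOME x. vertex_set k - vertex_set (k - 1) = {x})"

lemma vertex: "1 \<le> k \<Longrightarrow> k \<le> n + 1 \<Longrightarrow> vertex_set k - vertex_set (k - 1) = {vertex k}"
  unfolding vertex_def using vertex_exists by (rule someI_ex)

lemma vertex_set_eq: "k \<le> n + 1 \<Longrightarrow> vertex_set k = vertex ` {1..k}"
proof (induction k)
  case 0
  then show ?case using vertex_set(2,3)[of 0] finite_subset by fastforce
next
  case (Suc k)
  have "vertex_set (Suc k) = insert (vertex (Suc k)) (vertex_set k)"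
    using vertex[of "Suc k"] vertex_set_mono[of k "Suc k"] Suc.prems by auto
  moreover have "{1..Suc k} = insert (Suc k) {1..k}" by auto
  ultimately show ?case using Suc by simp
qed

lemma vertex_bij: "bij_betw vertex {1..n + 1} {0..n}"
proof -
  have "card (vertex ` {1..n + 1}) = card {0..n}" "vertex ` {1..n + 1} \<subseteq> {0..n}"
    using vertex_set(2,3)[of "n + 1"] vertex_set_eq[of "n + 1"] by auto
  then have "vertex ` {1..n + 1} = {0..n}" using card_subset_eq[of "{0..n}"] by blast
  moreover then have "inj_on vertex {1..n + 1}" by (intro eq_card_imp_inj_on) auto
  ultimately show ?thesis by (simp add: bij_betw_def)
qed

text \<open>Rigidity without a connectedness argument: the image of the k-th vertex is the
  difference of the images of two consecutive faces of the base flag.\<close>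

lemma aut_unique:
  assumes f: "f \<in> carrier Aut" and g: "g \<in> carrier Aut" and eq: "f ` \<Psi> = g ` \<Psi>"
  shows "f = g"
proof -
  have vs: "f (vertex_set k) = g (vertex_set k)" if "k \<le> n + 1" for k
    using simplex.aut_face[OF f flag, of "int k - 1"] simplex.aut_face[OF g flag, of "int k - 1"] that eq
    by (simp add: vertex_set_def)
  have single: "f {vertex k} = f (vertex_set k) - f (vertex_set (k - 1))"
    if f: "f \<in> carrier Aut" and k: "1 \<le> k" "k \<le> n + 1" for f k
  proof -
    have c: "vertex_set k \<subseteq> {0..n}" "vertex_set (k - 1) \<subseteq> {0..n}" using vertex_set(2) k by auto
    have v: "vertex k \<in> vertex_set k" "vertex k \<notin> vertex_set (k - 1)" using vertex[OF k] by auto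
    then have vn: "{vertex k} \<subseteq> {0..n}" using c by blast
    have fv: "f {vertex k} \<subseteq> f (vertex_set k)" "\<not> f {vertex k} \<subseteq> f (vertex_set (k - 1))"
      using aut_subset_iff[OF f vn] c v by auto
    have "card (f {vertex k}) = 1" using aut_card[OF f vn] by simp
    then obtain a where a: "f {vertex k} = {a}" by (meson card_1_singletonE)
    have "f (vertex_set (k - 1)) \<subseteq> f (vertex_set k)"
      using aut_subset_iff[OF f c(2,1)] vertex_set_mono[of "k - 1" k] k by simp
    moreover have "finite (f (vertex_set (k - 1)))" using aut_subset[OF f c(2)] by (auto intro: finite_subset)
    ultimately have "card (f (vertex_set k) - f (vertex_set (k - 1))) = 1"
      using aut_card[OF f c(1)] aut_card[OF f c(2)] vertex_set(3) k by (simp add: card_Diff_subset)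
    then obtain z where "f (vertex_set k) - f (vertex_set (k - 1)) = {z}" by (meson card_1_singletonE)
    then show ?thesis using fv a by auto
  qed
  have "f {y} = g {y}" if "y \<in> {0..n}" for y
  proof -
    have "y \<in> vertex ` {1..n + 1}" using vertex_bij that by (simp add: bij_betw_def)
    then obtain k where k: "1 \<le> k" "k \<le> n + 1" "y = vertex k" by auto
    then show ?thesis using single[OF f k(1,2)] single[OF g k(1,2)] vs[of k] vs[of "k - 1"] by simp
  qed
  then have "f A = g A" if "A \<subseteq> {0..n}" for A
    using aut_eq_Union[OF f that] aut_eq_Union[OF g that] that by (metis (no_types, lifting) SUP_cong subsetD)
  then show ?thesis
    using f g by (intro extensionalityI[of _ "Field r"]) (auto simp: polytope_aut_group_simps Bij_def Field_simplex)
qed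

definition index :: "nat \<Rightarrow> nat" where "index = inv_into {1..n + 1} vertex"

text \<open>Permutations act on the numbers that the base flag assigns to the vertices;
  \<open>adjacent_swap i\<close> thereby becomes the i-th reflection of that flag.\<close>

definition perm_aut :: "(nat \<Rightarrow> nat) \<Rightarrow> nat set \<Rightarrow> nat set" where
  "perm_aut p = (\<lambda>A \<in> Pow {0..n}. (\<lambda>x. vertex (p (index x))) ` A)"

lemma index_vertex: "k \<in> {1..n + 1} \<Longrightarrow> index (vertex k) = k"
  unfolding index_def using vertex_bij by (simp add: bij_betw_inv_into_left)

lemma index_bij: "bij_betw index {0..n} {1..n + 1}"
  unfolding index_def by (rule bij_betw_inv_into[OF vertex_bij])

lemma perm_bij: 
  assumes "p permutes {1..n + 1}"
  shows "bij_betw (\<lambda>x. vertex (p (index x))) {0..n} {0..n}"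
  using bij_betw_trans[OF bij_betw_trans[OF index_bij permutes_imp_bij[OF assms]] vertex_bij] by (simp add: o_def)

lemma perm_aut_vertices:
  assumes "B \<subseteq> {1..n + 1}"
  shows "perm_aut p (vertex ` B) = vertex ` p ` B"
proof -
  have "vertex ` B \<in> Pow {0..n}" using assms vertex_bij unfolding bij_betw_def by blast
  then have "perm_aut p (vertex ` B) = (\<lambda>x. vertex (p (index x))) ` vertex ` B" unfolding perm_aut_def by (rule restrict_apply')
  also have "\<dots> = vertex ` p ` B"
    unfolding image_image by (rule image_cong[OF HOL.refl]) (use index_vertex assms in auto)
  finally show ?thesis .
qed

lemma perm_aut_in_carrier:
  assumes p: "p permutes {1..n + 1}"
  shows "perm_aut p \<in> carrier Aut"
proof -
  let ?q = "\<lambda>x. vertex (p (index x))"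
  have b: "bij_betw ?q {0..n} {0..n}" by (rule perm_bij[OF p])
  have "bij_betw ((`) ?q) (Pow {0..n}) (Pow {0..n})" by (rule bij_betw_Pow[OF b])
  then have "bij_betw (perm_aut p) (Pow {0..n}) (Pow {0..n})"
    by (rule bij_betw_cong[THEN iffD1, rotated]) (simp add: perm_aut_def)
  moreover have "?q ` A \<subseteq> ?q ` B \<and> ?q ` B \<subseteq> {0..n} \<longleftrightarrow> A \<subseteq> B \<and> B \<subseteq> {0..n}" 
    if "A \<subseteq> {0..n}" "B \<subseteq> {0..n}" for A B
  proof -
    have inj: "inj_on ?q {0..n}" and im: "?q ` {0..n} = {0..n}" using b by (auto simp: bij_betw_def)
    have "?q x \<in> ?q ` B \<longleftrightarrow> x \<in> B" if "x \<in> A" for x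
      using inj_on_image_mem_iff[OF inj _ \<open>B \<subseteq> {0..n}\<close>, of x] that \<open>A \<subseteq> {0..n}\<close> by blast
    then have "?q ` A \<subseteq> ?q ` B \<longleftrightarrow> A \<subseteq> B" by blast
    then show ?thesis using that image_mono[OF that(2), of ?q] im by simp
  qed
  ultimately show ?thesis
    unfolding polytope_aut_group_simps Field_simplex Bij_def by (simp add: perm_aut_def simplex_iff)
qed

lemma perm_aut_comp:
  assumes p: "p permutes {1..n + 1}" and q: "q permutes {1..n + 1}"
  shows "perm_aut (p \<circ> q) = perm_aut p \<otimes>\<^bsub>Aut\<^esub> perm_aut q"
proof (rule extensionalityI[of _ "Pow {0..n}"])
  have c: "perm_aut p \<in> carrier Aut" "perm_aut q \<in> carrier Aut" using p q perm_aut_in_carrier by auto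
  show "perm_aut (p \<circ> q) \<in> extensional (Pow {0..n})" by (simp add: perm_aut_def)
  show "perm_aut p \<otimes>\<^bsub>Aut\<^esub> perm_aut q \<in> extensional (Pow {0..n})"
    using monoid.m_closed[OF group.is_monoid[OF group_polytope_aut_group] c] unfolding polytope_aut_group_simps Bij_def Field_simplex by blast
  fix A assume "A \<in> Pow {0..n}"
  then have A: "A \<subseteq> {0..n}" and "A \<in> (`) vertex ` Pow {1..n + 1}"
    unfolding bij_betw_imp_surj_on[OF bij_betw_Pow[OF vertex_bij]] by simp_all
  from this(2) obtain B where "A = vertex ` B" "B \<in> Pow {1..n + 1}" by (rule imageE)
  then have B: "B \<subseteq> {1..n + 1}" "A = vertex ` B" by simp_all
  have "q ` B \<subseteq> {1..n + 1}" using B(1) permutes_image[OF q] by blast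
  then have "perm_aut p (perm_aut q A) = vertex ` p ` q ` B" using B perm_aut_vertices by simp
  then show "perm_aut (p \<circ> q) A = (perm_aut p \<otimes>\<^bsub>Aut\<^esub> perm_aut q) A"
    using aut_mult_apply[OF c, of A] B perm_aut_vertices[OF B(1), of "p \<circ> q"] A
    by (simp add: Field_simplex image_comp)
qed

lemma perm_aut_inj: 
  assumes p: "p permutes {1..n + 1}" and q: "q permutes {1..n + 1}" and eq: "perm_aut p = perm_aut q"
  shows "p = q"
proof
  fix k
  show "p k = q k"
  proof (cases "k \<in> {1..n + 1}")
    case True
    then have "perm_aut p (vertex ` {k}) = vertex ` p ` {k}" "perm_aut q (vertex ` {k}) = vertex ` q ` {k}"
      using perm_aut_vertices[of "{k}"] by auto
    then have "vertex (p k) = vertex (q k)" using eq by simp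
    then show ?thesis
      using vertex_bij True permutes_in_image[OF p] permutes_in_image[OF q] by (metis bij_betw_def inj_on_eq_iff)
  next
    case False
    then show ?thesis using p q by (metis permutes_not_in)
  qed
qed

text \<open>Swapping i + 1 and i + 2 preserves every initial segment except the one of length i + 1,
  which is the face of rank i.\<close>

lemma perm_aut_adjacent_swap:
  assumes i: "i < n"
  shows "perm_aut (adjacent_swap i) ` \<Psi> = adj r i \<Psi>"
proof (rule simplex.adj_eq[symmetric])
  have c: "perm_aut (adjacent_swap i) \<in> carrier Aut" by (rule perm_aut_in_carrier[OF adjacent_swap_permutes[OF i]])
  have fl: "perm_aut (adjacent_swap i) ` \<Psi> \<in> flags r" by (rule simplex.aut_flag[OF c flag])
  have face: "face r (perm_aut (adjacent_swap i) ` \<Psi>) (int k - 1) = vertex ` adjacent_swap i ` {1..k}" if "k \<le> n + 1" for k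
    using simplex.aut_face[OF c flag, of "int k - 1"] that vertex_set_eq[OF that] perm_aut_vertices[of "{1..k}" "adjacent_swap i"]
    by (simp add: vertex_set_def)
  have face': "face r \<Psi> (int k - 1) = vertex ` {1..k}" if "k \<le> n + 1" for k
    using vertex_set_eq[OF that] by (simp add: vertex_set_def)
  show "adjacent_at r i \<Psi> (perm_aut (adjacent_swap i) ` \<Psi>)"
    unfolding simplex.adjacent_at_iff[OF flag fl]
  proof (intro conjI allI impI notI)
    assume "\<Psi> = perm_aut (adjacent_swap i) ` \<Psi>"
    then have "vertex ` adjacent_swap i ` {1..i + 1} = vertex ` {1..i + 1}"
      using face[of "i + 1"] face'[of "i + 1"] i by simp
    moreover have "adjacent_swap i ` {1..i + 1} \<subseteq> {1..n + 1}" "{1..i + 1} \<subseteq> {1..n + 1}"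
      using i permutes_image[OF adjacent_swap_permutes[OF i]] by auto
    ultimately have "adjacent_swap i ` {1..i + 1} = {1..i + 1}"
      using vertex_bij by (metis bij_betw_def inj_on_image_eq_iff)
    moreover have "Suc (Suc i) \<in> adjacent_swap i ` {1..i + 1}" by (rule image_eqI[of _ _ "Suc i"]) (auto simp: adjacent_swap_def)
    ultimately show False by simp
  next
    fix k :: int assume k: "-1 \<le> k \<and> k \<le> int n \<and> k \<noteq> int i"
    define m where "m = nat (k + 1)"
    have m: "k = int m - 1" "m \<le> n + 1" "m \<noteq> i + 1" using k by (auto simp: m_def)
    have "adjacent_swap i ` {1..m} = {1..m}" unfolding adjacent_swap_def by (rule transpose_image_eq) (use m(3) in auto)
    then show "face r \<Psi> k = face r (perm_aut (adjacent_swap i) ` \<Psi>) k"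
      using face[OF m(2)] face'[OF m(2)] m(1) by simp
  qed
qed

lemma standard_reflection:
  assumes "i < n"
  shows "standard_reflection r \<Psi> i = perm_aut (adjacent_swap i)"
  unfolding standard_reflection_def
  using perm_aut_in_carrier[OF adjacent_swap_permutes[OF assms]] perm_aut_adjacent_swap[OF assms] aut_unique
  by (intro the_equality) auto

lemma regular_rotation:
  assumes "1 \<le> i" "i \<le> n - 1"
  shows "regular_rotation r \<Psi> i = perm_aut (adjacent_swap (i - 1) \<circ> adjacent_swap i)"
proof -
  have "i - 1 < n" "i < n" using assms by arith+
  then show ?thesis unfolding regular_rotation_def using standard_reflection perm_aut_comp adjacent_swap_permutes by simp
qed

lemma perm_aut_hom: "perm_aut \<in> hom (alt_group (n + 1)) Aut" 
  by (rule homI) (use perm_aut_in_carrier perm_aut_comp in auto)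

lemma inj_on_perm_aut: "inj_on perm_aut (carrier (alt_group (n + 1)))"
  by (rule inj_onI) (use perm_aut_inj in auto)

end

section \<open>Mixing with a simple quotient\<close>

lemma (in group) r_coset_eq_iff:
  assumes "subgroup H G" "x \<in> carrier G" "y \<in> carrier G"
  shows "H #> x = H #> y \<longleftrightarrow> x \<otimes> inv y \<in> H"
  using subgroup.rcos_module[OF assms(1) group_axioms assms(3,2)]
    repr_independence[OF _ assms(3,1), of x] repr_independenceD[OF assms(1,2), of y] by auto

lemma set_mult_memI: "h \<in> H \<Longrightarrow> k \<in> K \<Longrightarrow> h \<otimes>\<^bsub>G\<^esub> k \<in> H <#>\<^bsub>G\<^esub> K"
  by (auto simp: set_mult_def)

lemma set_mult_memE:
  assumes "x \<in> H <#>\<^bsub>G\<^esub> K"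
  obtains h k where "h \<in> H" "k \<in> K" "x = h \<otimes>\<^bsub>G\<^esub> k"
  using assms by (auto simp: set_mult_def)

text \<open>The group theory in isolation: \<open>b\<close> plays the role of \<open>bar\<close>,
  the kernel of \<open>g\<close> that of \<open>K\<close>, and \<open>A\<close> that of the
  alternating group.\<close>

locale mix_with_simple_quotient = W: group W + A: group A
  for W (structure) and A +
  fixes b g M
  assumes b_hom: "b \<in> hom W W" and b_b: "w \<in> carrier W \<Longrightarrow> b (b w) = w"
    and g_hom: "g \<in> hom W A" and g_surj: "g ` carrier W = carrier A"
    and simple: "H \<lhd> A \<Longrightarrow> H = {\<one>\<^bsub>A\<^esub>} \<or> H = carrier A"
    and not_comm: "\<exists>x \<in> carrier A. \<exists>y \<in> carrier A. x \<otimes>\<^bsub>A\<^esub> y \<noteq> y \<otimes>\<^bsub>A\<^esub> x"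
    and b_kernel: "w \<in> kernel W A g \<Longrightarrow> b w \<in> kernel W A g"
    and M: "M \<lhd> W"
begin

sublocale b: group_hom W W b by unfold_locales (rule b_hom)
sublocale g: group_hom W A g by unfold_locales (rule g_hom)
sublocale M: normal M W by (rule M)

abbreviation N where "N \<equiv> M \<inter> kernel W A g"

lemma normal_kernel_g: "kernel W A g \<lhd> W" by (rule g.normal_kernel)

lemma normal_N: "N \<lhd> W" by (rule W.normal_subgroup_intersect[OF M normal_kernel_g])

lemma normal_b_image: "H \<lhd> W \<Longrightarrow> b ` H \<lhd> W"
proof (rule normal.surj_hom_normal_subgroup)
  show "group_hom W W b" by unfold_locales
  show "b ` carrier W = carrier W" using b_b b.hom_closed by (metis (no_types, lifting) image_eqI image_subsetI subsetI subset_antisym)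
qed

text \<open>If x = b m with m in \<open>M\<close>, then m = b x because \<open>b\<close> is an
  involution, and b x stays in the kernel.\<close>

lemma in_bN: 
  assumes "x \<in> b ` M" "x \<in> kernel W A g"
  shows "x \<in> b ` N"
proof -
  obtain m where m: "m \<in> M" "x = b m" using assms(1) by blast
  then have "m = b x" using b_b M.mem_carrier by simp
  then show ?thesis using m b_kernel[OF assms(2)] by blast
qed

lemma bM_subset: "b ` M \<subseteq> M <#> b ` N"
proof
  fix x assume x: "x \<in> b ` M"
  have bM: "b ` M \<lhd> W" by (rule normal_b_image[OF M])
  interpret bM: normal "b ` M" W by (rule bM)
  have D: "M \<inter> b ` M \<lhd> W" by (rule W.normal_subgroup_intersect[OF M bM])
  have g_image: "g ` H = {\<one>\<^bsub>A\<^esub>} \<or> g ` H = carrier A" if "H \<lhd> W" for H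
    by (rule simple[OF normal.surj_hom_normal_subgroup[OF that g.group_hom_axioms g_surj]])
  \<comment> \<open>If x is in the kernel, d = 1 works. Otherwise d is an element of M \<inter> b(M)
    with the same image as x: then inv d x lies both in b(M) and in the kernel.\<close>
  have "\<exists>d \<in> M. inv d \<otimes> x \<in> b ` N"
  proof (cases "x \<in> kernel W A g")
    case True
    then show ?thesis using in_bN[OF x] bM.mem_carrier[OF x] M.one_closed by (intro bexI[of _ \<one>]) auto
  next
    case False
    then have gbM: "g ` b ` M = carrier A"
      using g_image[OF bM] x bM.mem_carrier unfolding kernel_def by blast
    have "g ` M \<noteq> {\<one>\<^bsub>A\<^esub>}"
    proof
      assume "g ` M = {\<one>\<^bsub>A\<^esub>}"
      then have "M \<subseteq> kernel W A g" using M.subset unfolding kernel_def by blast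
      then have "b ` M \<subseteq> kernel W A g" using b_kernel by blast
      then show False using x False by blast
    qed
    then have gM: "g ` M = carrier A" using g_image[OF M] by blast
    have "g ` (M \<inter> b ` M) \<noteq> {\<one>\<^bsub>A\<^esub>}"
    proof
      assume triv: "g ` (M \<inter> b ` M) = {\<one>\<^bsub>A\<^esub>}"
      obtain p q where pq: "p \<in> carrier A" "q \<in> carrier A" "p \<otimes>\<^bsub>A\<^esub> q \<noteq> q \<otimes>\<^bsub>A\<^esub> p" using not_comm by (elim bexE)
      obtain m where m: "m \<in> M" "g m = p" using pq(1) unfolding gM[symmetric] by (elim imageE) simp
      obtain m' where m': "m' \<in> b ` M" "g m' = q" using pq(2) unfolding gbM[symmetric] by auto
      note c = M.mem_carrier[OF m(1)] bM.mem_carrier[OF m'(1)]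
      \<comment> \<open>The commutator bracketed in two ways: as m times a conjugate of its inverse
        it is in \<open>M\<close>, as a conjugate of m' times its inverse it is in b(M).\<close>
      have "m \<otimes> (m' \<otimes> inv m \<otimes> inv m') \<in> M"
        using m(1) M.inv_op_closed2[OF c(2), of "inv m"] by simp
      moreover have "m \<otimes> m' \<otimes> inv m \<otimes> inv m' \<in> b ` M"
        using m'(1) bM.inv_op_closed2[OF c(1), of m'] by simp
      ultimately have "m \<otimes> m' \<otimes> inv m \<otimes> inv m' \<in> M \<inter> b ` M" using c by (simp add: W.m_assoc)
      then have "g (m \<otimes> m' \<otimes> inv m \<otimes> inv m') = \<one>\<^bsub>A\<^esub>" using triv by blast
      then have "p \<otimes>\<^bsub>A\<^esub> q \<otimes>\<^bsub>A\<^esub> inv\<^bsub>A\<^esub> p \<otimes>\<^bsub>A\<^esub> inv\<^bsub>A\<^esub> q = \<one>\<^bsub>A\<^esub>" using c m m' by simp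
      then show False using pq
        by (metis A.inv_closed A.inv_inv A.inv_solve_right' A.l_one A.m_closed)
    qed
    then have "g ` (M \<inter> b ` M) = carrier A" using g_image[OF D] by blast
    then obtain d where d: "d \<in> M" "d \<in> b ` M" "g d = g x"
      using bM.mem_carrier[OF x] g.hom_closed by (metis (no_types, lifting) IntE imageE)
    have "inv d \<otimes> x \<in> b ` M" using d x by (meson bM.m_closed bM.m_inv_closed)
    moreover have "inv d \<otimes> x \<in> kernel W A g"
      using d(3) M.mem_carrier[OF d(1)] bM.mem_carrier[OF x] by (simp add: kernel_def A.l_inv)
    ultimately show ?thesis using in_bN d(1) by blast
  qed
  then obtain d where d: "d \<in> M" "inv d \<otimes> x \<in> b ` N" by blast
  moreover have "x = d \<otimes> (inv d \<otimes> x)"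
    using M.mem_carrier[OF d(1)] bM.mem_carrier[OF x] by (simp flip: W.m_assoc)
  ultimately show "x \<in> M <#> b ` N" using set_mult_memI by metis
qed

lemma mix_chiral:
  assumes "\<not> b ` M \<subseteq> M"
  shows "\<not> b ` N \<subseteq> N"
proof
  assume "b ` N \<subseteq> N"
  then have "M <#> b ` N \<subseteq> M" unfolding set_mult_def using M.m_closed by blast
  then show False using assms bM_subset by blast
qed

text \<open>On sets of cosets the natural map Nx \<mapsto> Mx is multiplication by \<open>M\<close>,
  since M N = M. The equality of the two chirality groups is expressed by this map being an
  isomorphism.\<close>

lemma coset_map_iso:
  "(\<lambda>C. M <#> C) \<in> iso ((W\<lparr>carrier := N <#> b ` N\<rparr>) Mod N) ((W\<lparr>carrier := M <#> b ` M\<rparr>) Mod M)"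
proof -
  interpret N: normal N W by (rule normal_N)
  interpret K: normal "kernel W A g" W by (rule normal_kernel_g)
  have bM: "b ` M \<lhd> W" and bN: "b ` N \<lhd> W" using normal_b_image M normal_N by blast+
  interpret bM: normal "b ` M" W by (rule bM)
  interpret bN: normal "b ` N" W by (rule bN)
  let ?G = "(W\<lparr>carrier := N <#> b ` N\<rparr>) Mod N" and ?H = "(W\<lparr>carrier := M <#> b ` M\<rparr>) Mod M"
  have carG: "carrier ?G = (\<lambda>x. N #> x) ` (N <#> b ` N)" and carH: "carrier ?H = (\<lambda>x. M #> x) ` (M <#> b ` M)"
    by (auto simp: FactGroup_def RCOSETS_def)
  have mult: "monoid.mult ?G = set_mult W" "monoid.mult ?H = set_mult W"
    by (auto simp: FactGroup_def fun_eq_iff set_mult_def)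
  have NNW: "N <#> b ` N \<subseteq> carrier W" by (rule W.setmult_subset_G[OF N.subset bN.subset])
  have MN: "M <#> N = M"
  proof
    show "M <#> N \<subseteq> M" unfolding set_mult_def using M.m_closed by blast
    show "M \<subseteq> M <#> N"
    proof
      fix x assume "x \<in> M"
      then show "x \<in> M <#> N"
        using set_mult_memI[OF _ N.one_closed, of x M W] M.mem_carrier[of x] by simp
    qed
  qed
  have map: "M <#> (N #> x) = M #> x" if "x \<in> carrier W" for x
    using W.setmult_rcos_assoc[OF M.subset N.subset that] MN by simp
  have sub: "N <#> b ` N \<subseteq> M <#> b ` M" by (rule mono_set_mult) auto
  \<comment> \<open>The source of injectivity: if x and y in N b(N) have the same coset of
    \<open>M\<close>, then x inv y lies in \<open>M\<close> and in the kernel, hence in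
    \<open>N\<close>.\<close>
  have inK: "N <#> b ` N \<subseteq> kernel W A g"
    unfolding set_mult_def using b_kernel K.m_closed by blast
  show ?thesis
  proof (rule isoI)
    show "(\<lambda>C. M <#> C) \<in> hom ?G ?H"
    proof (rule homI)
      fix C assume "C \<in> carrier ?G"
      then obtain x where "x \<in> N <#> b ` N" "C = N #> x" unfolding carG by blast
      then show "M <#> C \<in> carrier ?H" using map sub NNW unfolding carH by blast
    next
      fix C D assume "C \<in> carrier ?G" "D \<in> carrier ?G"
      then obtain x y where xy: "x \<in> carrier W" "C = N #> x" "y \<in> carrier W" "D = N #> y"
        using NNW unfolding carG by blast
      then show "M <#> (C \<otimes>\<^bsub>?G\<^esub> D) = (M <#> C) \<otimes>\<^bsub>?H\<^esub> (M <#> D)"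
        unfolding mult xy N.rcos_sum[OF xy(1,3)] map[OF xy(1)] map[OF xy(3)] M.rcos_sum[OF xy(1,3)]
        by (intro map W.m_closed)
    qed
    show "bij_betw (\<lambda>C. M <#> C) (carrier ?G) (carrier ?H)"
    proof (rule bij_betw_imageI)
      show "inj_on (\<lambda>C. M <#> C) (carrier ?G)"
      proof (rule inj_onI)
        fix C D assume "C \<in> carrier ?G" "D \<in> carrier ?G" and eq: "M <#> C = M <#> D"
        then obtain x y where xy: "x \<in> N <#> b ` N" "C = N #> x" "y \<in> N <#> b ` N" "D = N #> y"
          unfolding carG by blast
        then have c: "x \<in> carrier W" "y \<in> carrier W" using NNW by auto
        have "x \<otimes> inv y \<in> M"
          using eq xy map[OF c(1)] map[OF c(2)] W.r_coset_eq_iff[OF M.subgroup_axioms c] by simp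
        moreover have "x \<otimes> inv y \<in> kernel W A g"
          using xy inK by (meson K.m_closed K.m_inv_closed subsetD)
        ultimately show "C = D" using xy W.r_coset_eq_iff[OF N.subgroup_axioms c] by simp
      qed
      show "(\<lambda>C. M <#> C) ` carrier ?G = carrier ?H"
      proof (rule subset_antisym)
        show "(\<lambda>C. M <#> C) ` carrier ?G \<subseteq> carrier ?H"
          using map sub NNW unfolding carG carH by blast
        show "carrier ?H \<subseteq> (\<lambda>C. M <#> C) ` carrier ?G"
        proof
          fix D assume "D \<in> carrier ?H"
          then obtain z where z: "z \<in> M <#> b ` M" "D = M #> z" unfolding carH by blast
          \<comment> \<open>For surjectivity, z = m x and x = d y with m and d in \<open>M\<close>,
            so z and y have the same coset of \<open>M\<close>, and y lies in b(N).\<close>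
          from z(1) obtain m x where m: "m \<in> M" "x \<in> b ` M" "z = m \<otimes> x" by (rule set_mult_memE)
          have "x \<in> M <#> b ` N" using bM_subset m(2) by (rule subsetD)
          then obtain d y where d: "d \<in> M" "y \<in> b ` N" "x = d \<otimes> y" by (rule set_mult_memE)
          have c: "m \<in> carrier W" "d \<in> carrier W" "y \<in> carrier W"
            using M.mem_carrier[OF m(1)] M.mem_carrier[OF d(1)] bN.mem_carrier[OF d(2)] .
          have "m \<otimes> x \<otimes> inv y = m \<otimes> d" using c d(3) by (simp add: W.m_assoc)
          then have "D = M #> y"
            using W.r_coset_eq_iff[OF M.subgroup_axioms, of "m \<otimes> x" y] c d m(3) z(2) M.m_closed[OF m(1) d(1)]
            by simp
          moreover have "y \<in> N <#> b ` N"
            using set_mult_memI[OF N.one_closed d(2), of W] c(3) by simp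
          ultimately show "D \<in> (\<lambda>C. M <#> C) ` carrier ?G"
            unfolding carG using map[OF c(3)] by blast
        qed
      qed
    qed
  qed
qed

end

section \<open>The mix of a chiral polytope with a simplex\<close>

lemma adjacent_swap_comp_self: "adjacent_swap i \<circ> adjacent_swap i = id"
  by (simp add: adjacent_swap_def)

lemma adjacent_swap_commute: "Suc i < j \<Longrightarrow> adjacent_swap i \<circ> adjacent_swap j = adjacent_swap j \<circ> adjacent_swap i"
  unfolding adjacent_swap_def by (rule ext) (auto simp: transpose_def)

definition alt_gen :: "nat \<Rightarrow> nat \<Rightarrow> nat" where
  "alt_gen i = adjacent_swap (i - 1) \<circ> adjacent_swap i"

lemma alt_gen_eq_three_cycle: "1 \<le> i \<Longrightarrow> alt_gen i = three_cycle i (i + 1) (i + 2)"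
  by (simp add: alt_gen_def adjacent_swap_def three_cycle_def)

lemma alt_gen_in_alt_group:
  assumes "1 \<le> i" "i \<le> n - 1"
  shows "alt_gen i \<in> carrier (alt_group (n + 1))"
  unfolding alt_gen_eq_three_cycle[OF assms(1)] by (rule three_cycle_in_alt_group) (use assms in auto)

lemma rot_prod_alt_group: "rot_prod (alt_group m) s i j = rot_prod (sym_group m) s i j"
proof -
  have "word_eval (alt_group m) s (map (\<lambda>k. (k, True)) xs) = word_eval (sym_group m) s (map (\<lambda>k. (k, True)) xs)" for xs
    by (induction xs) auto
  then show ?thesis unfolding rot_prod_def .
qed

text \<open>The reflections are odd, so the relations are checked in the symmetric group and then
  read in the alternating group, which has the same multiplication.\<close>

lemma Wplus_relations_alt_gen: "Wplus_relations n (alt_group (n + 1)) alt_gen"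
proof -
  have "Wplus_relations n (sym_group (n + 1)) alt_gen"
  proof (rule group.Wplus_relations_reflections[OF sym_group_is_group, where r = adjacent_swap])
    show "adjacent_swap k \<otimes>\<^bsub>sym_group (n + 1)\<^esub> adjacent_swap l = adjacent_swap l \<otimes>\<^bsub>sym_group (n + 1)\<^esub> adjacent_swap k"
      if "Suc k < l" for k l using adjacent_swap_commute[OF that] unfolding sym_group_simps .
    show "adjacent_swap k \<otimes>\<^bsub>sym_group (n + 1)\<^esub> adjacent_swap k = \<one>\<^bsub>sym_group (n + 1)\<^esub>" for k
      unfolding sym_group_simps by (rule adjacent_swap_comp_self)
    show "adjacent_swap k \<in> carrier (sym_group (n + 1))" if "k < n" for k
      using adjacent_swap_permutes[OF that] unfolding sym_group_simps by blast
    show "alt_gen i = adjacent_swap (i - 1) \<otimes>\<^bsub>sym_group (n + 1)\<^esub> adjacent_swap i" for i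
      unfolding sym_group_simps by (rule alt_gen_def)
  qed
  moreover have "alt_gen \<in> {1..n - 1} \<rightarrow> carrier (alt_group (n + 1))"
    by (intro Pi_I alt_gen_in_alt_group) simp_all
  ultimately show ?thesis
    unfolding Wplus_relations_def rot_prod_alt_group alt_group_simps(2,3) sym_group_simps(2,3) by blast
qed

abbreviation alt_hom :: "nat \<Rightarrow> nat word set \<Rightarrow> nat \<Rightarrow> nat" where
  "alt_hom n \<equiv> natural_hom n (alt_group (n + 1)) alt_gen"

lemmas alt_hom = natural_hom[OF alt_group_is_group Wplus_relations_alt_gen]

lemma alt_hom_surj: "alt_hom n ` carrier (Wplus n) = carrier (alt_group (n + 1))"
proof
  interpret S: group "sym_group (n + 1)" by (rule sym_group_is_group)
  interpret group_hom "Wplus n" "alt_group (n + 1)" "alt_hom n"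
    using alt_hom(1) by (simp add: group_hom_def group_hom_axioms_def group_Wplus alt_group_is_group)
  show "alt_hom n ` carrier (Wplus n) \<subseteq> carrier (alt_group (n + 1))" using hom_closed by blast
  have alt: "(sym_group (n + 1))\<lparr>carrier := carrier (alt_group (n + 1))\<rparr> = alt_group (n + 1)"
    by (simp add: alt_group_def)
  have "subgroup (alt_hom n ` carrier (Wplus n)) (sym_group (n + 1))"
    by (rule S.incl_subgroup[OF alt_group_is_subgroup, unfolded alt, OF img_is_subgroup])
  then show "carrier (alt_group (n + 1)) \<subseteq> alt_hom n ` carrier (Wplus n)"
  proof (rule alt_group_subset_of_adjacent_products)
    fix i assume i: "1 \<le> i" "i + 2 \<le> n + 1"
    then have "alt_hom n (Wplus_gen n i) = alt_gen i" "Wplus_gen n i \<in> carrier (Wplus n)"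
      using alt_hom(3)[of i n] by auto
    then show "transpose i (i + 1) \<circ> transpose (i + 1) (i + 2) \<in> alt_hom n ` carrier (Wplus n)"
      using alt_gen_eq_three_cycle[OF i(1)] unfolding three_cycle_def by (metis imageI)
  qed
qed

text \<open>The simplex is directly regular: \<open>bar\<close> acts on its rotation group as conjugation by the
  reflection \<open>\<rho>\<^sub>0\<close>.\<close>

lemma alt_hom_bar:
  assumes n: "n \<ge> 3" and w: "w \<in> carrier (Wplus n)"
  shows "alt_hom n (bar n w) = adjacent_swap 0 \<circ> alt_hom n w \<circ> adjacent_swap 0"
proof -
  let ?S = "sym_group (n + 1)" and ?r = adjacent_swap
  interpret W: group "Wplus n" by (rule group_Wplus)
  interpret g: group_hom "Wplus n" "alt_group (n + 1)" "alt_hom n"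
    using alt_hom(1) by (simp add: group_hom_def group_hom_axioms_def group_Wplus alt_group_is_group)
  have rr: "?r k \<circ> (?r k \<circ> p) = p" for k p using adjacent_swap_comp_self[of k] by (metis comp_assoc id_comp)
  have perm: "alt_hom n v permutes {1..n + 1}" if "v \<in> carrier (Wplus n)" for v
    using g.hom_closed[OF that] unfolding alt_group_simps by blast
  have mult: "alt_hom n (u \<otimes>\<^bsub>Wplus n\<^esub> v) = alt_hom n u \<circ> alt_hom n v"
    if "u \<in> carrier (Wplus n)" "v \<in> carrier (Wplus n)" for u v
    using g.hom_mult[OF that] unfolding alt_group_simps .
  have bar_hom: "bar n \<in> hom (Wplus n) (Wplus n)" using bar_auto[OF n] by (simp add: auto_def)
  have r0: "?r 0 permutes {1..n + 1}" by (rule adjacent_swap_permutes) (use n in simp)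
  have "(alt_hom n \<circ> bar n) w = (\<lambda>w. ?r 0 \<circ> alt_hom n w \<circ> ?r 0) w"
  \<comment> \<open>Both sides are homomorphisms into the symmetric group, where \<rho>_0 lives; it
    remains to compare them on generators.\<close>
  proof (rule Wplus_hom_unique[OF sym_group_is_group _ _ _ w])
    have "alt_hom n \<in> hom (Wplus n) ?S"
      unfolding hom_def sym_group_simps using perm mult by blast
    then show "alt_hom n \<circ> bar n \<in> hom (Wplus n) ?S" using hom_compose[OF bar_hom] by blast
    show "(\<lambda>w. ?r 0 \<circ> alt_hom n w \<circ> ?r 0) \<in> hom (Wplus n) ?S"
    proof (rule homI)
      show "?r 0 \<circ> alt_hom n v \<circ> ?r 0 \<in> carrier ?S" if "v \<in> carrier (Wplus n)" for v
        unfolding sym_group_simps using permutes_compose[OF r0 permutes_compose[OF perm[OF that] r0]]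
        by (simp only: comp_assoc mem_Collect_eq)
      show "?r 0 \<circ> alt_hom n (u \<otimes>\<^bsub>Wplus n\<^esub> v) \<circ> ?r 0 =
          (?r 0 \<circ> alt_hom n u \<circ> ?r 0) \<otimes>\<^bsub>?S\<^esub> (?r 0 \<circ> alt_hom n v \<circ> ?r 0)"
        if "u \<in> carrier (Wplus n)" "v \<in> carrier (Wplus n)" for u v
        unfolding sym_group_simps mult[OF that] by (simp only: comp_assoc rr)
    qed
    fix i assume i: "1 \<le> i" "i \<le> n - 1"
    have gen: "Wplus_gen n 1 \<in> carrier (Wplus n)" "Wplus_gen n 2 \<in> carrier (Wplus n)"
      "alt_hom n (Wplus_gen n 1) = ?r 0 \<circ> ?r 1" "alt_hom n (Wplus_gen n 2) = ?r 1 \<circ> ?r 2"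
      using n alt_hom(3)[of 1 n] alt_hom(3)[of 2 n] by (auto simp: alt_gen_def)
    have "alt_hom n (bar n (Wplus_gen n i)) = ?r 0 \<circ> alt_hom n (Wplus_gen n i) \<circ> ?r 0"
      unfolding bar_gen[OF n i]
    proof -
      consider "i = 1" | "i = 2" | "i \<ge> 3" using i by linarith
      then show "alt_hom n (bar_gens (Wplus n) (Wplus_gen n) i) = ?r 0 \<circ> alt_hom n (Wplus_gen n i) \<circ> ?r 0"
      proof cases
        case 1
        have "alt_hom n (inv\<^bsub>Wplus n\<^esub> Wplus_gen n 1) = inv' (?r 0 \<circ> ?r 1)"
          using g.hom_inv[OF gen(1)] alt_group_inv_equality[OF g.hom_closed[OF gen(1)]] unfolding gen(3) by (rule HOL.trans)
        also have "\<dots> = ?r 1 \<circ> ?r 0" by (simp add: adjacent_swap_def o_inv_distrib)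
        finally show ?thesis using 1 gen(3) by (simp only: bar_gens_def comp_assoc rr if_True simp_thms)
      next
        case 2
        have "alt_hom n (Wplus_gen n 1 \<otimes>\<^bsub>Wplus n\<^esub> Wplus_gen n 1 \<otimes>\<^bsub>Wplus n\<^esub> Wplus_gen n 2) =
            ?r 0 \<circ> ?r 1 \<circ> (?r 0 \<circ> ?r 1) \<circ> (?r 1 \<circ> ?r 2)"
          unfolding mult[OF W.m_closed[OF gen(1,1)] gen(2)] mult[OF gen(1,1)] gen(3,4) by (rule HOL.refl)
        \<comment> \<open>The inner pair of \<rho>_1 cancels; what is left is the conjugate of
          \<rho>_1 \<rho>_2, since \<rho>_0 and \<rho>_2 commute.\<close>
        also have "\<dots> = ?r 0 \<circ> (?r 1 \<circ> (?r 0 \<circ> ?r 2))" by (simp only: comp_assoc rr)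
        also have "\<dots> = ?r 0 \<circ> (?r 1 \<circ> ?r 2) \<circ> ?r 0"
          using adjacent_swap_commute[of 0 2] by (simp only: comp_assoc)
        finally show ?thesis unfolding 2 gen(4) by (simp only: bar_gens_def if_True if_False one_eq_numeral_iff numeral_eq_one_iff semiring_norm)
      next
        case 3
        have c: "?r 0 \<circ> ?r (i - 1) = ?r (i - 1) \<circ> ?r 0" "?r 0 \<circ> ?r i = ?r i \<circ> ?r 0"
          using 3 by (auto intro!: adjacent_swap_commute simp del: comp_apply)
        have "?r 0 \<circ> (?r (i - 1) \<circ> ?r i) \<circ> ?r 0 = ?r 0 \<circ> ?r (i - 1) \<circ> (?r i \<circ> ?r 0)"
          by (simp only: comp_assoc)
        also have "\<dots> = ?r (i - 1) \<circ> (?r 0 \<circ> (?r 0 \<circ> ?r i))" unfolding c(1) c(2)[symmetric] by (simp only: comp_assoc)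
        finally have "?r 0 \<circ> (?r (i - 1) \<circ> ?r i) \<circ> ?r 0 = ?r (i - 1) \<circ> ?r i" unfolding rr .
        moreover have "bar_gens (Wplus n) (Wplus_gen n) i = Wplus_gen n i" using 3 by (simp add: bar_gens_def)
        moreover have "alt_hom n (Wplus_gen n i) = ?r (i - 1) \<circ> ?r i"
          using alt_hom(3)[OF i] unfolding alt_gen_def[of i] .
        ultimately show ?thesis by (simp only:)
      qed
    qed
    then show "(alt_hom n \<circ> bar n) (Wplus_gen n i) = ?r 0 \<circ> alt_hom n (Wplus_gen n i) \<circ> ?r 0" by simp
  qed
  then show ?thesis by simp
qed

lemma mix_with_simplex:
  assumes n: "n \<ge> 4" and M: "M \<lhd> Wplus n"
  shows "mix_with_simple_quotient (Wplus n) (alt_group (n + 1)) (bar n) (alt_hom n) M"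
proof -
  interpret W: group "Wplus n" by (rule group_Wplus)
  interpret A: group "alt_group (n + 1)" by (rule alt_group_is_group)
  have n3: "n \<ge> 3" using n by simp
  show ?thesis
  proof (intro mix_with_simple_quotient.intro mix_with_simple_quotient_axioms.intro)
    show "group (Wplus n)" "group (alt_group (n + 1))" by unfold_locales
    show "bar n \<in> hom (Wplus n) (Wplus n)" using bar_auto[OF n3] by (simp add: auto_def)
    show "bar n (bar n w) = w" if "w \<in> carrier (Wplus n)" for w by (rule bar_bar[OF n3 that])
    show "alt_hom n \<in> hom (Wplus n) (alt_group (n + 1))" by (rule alt_hom(1))
    show "alt_hom n ` carrier (Wplus n) = carrier (alt_group (n + 1))" by (rule alt_hom_surj)
    show "H = {\<one>\<^bsub>alt_group (n + 1)\<^esub>} \<or> H = carrier (alt_group (n + 1))" if "H \<lhd> alt_group (n + 1)" for H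
    proof -
      have "alt_normal (n + 1) H" by (rule alt_normal.intro) (use n that in auto)
      from alt_normal.trivial_or_all[OF this] show ?thesis unfolding alt_group_simps(3) .
    qed
    \<comment> \<open>The generators are (1 2 3) and (2 3 4); the two products send 2 to 1 and to
      4.\<close>
    have "(alt_gen 1 \<circ> alt_gen 2) 2 \<noteq> (alt_gen 2 \<circ> alt_gen 1) 2"
      by (simp add: alt_gen_def adjacent_swap_def transpose_def)
    then have "alt_gen 1 \<circ> alt_gen 2 \<noteq> alt_gen 2 \<circ> alt_gen 1" by metis
    moreover have "alt_gen 1 \<in> carrier (alt_group (n + 1))" "alt_gen 2 \<in> carrier (alt_group (n + 1))"
      using alt_gen_in_alt_group[of _ n] n by auto
    ultimately show "\<exists>x\<in>carrier (alt_group (n + 1)). \<exists>y\<in>carrier (alt_group (n + 1)).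
        x \<otimes>\<^bsub>alt_group (n + 1)\<^esub> y \<noteq> y \<otimes>\<^bsub>alt_group (n + 1)\<^esub> x"
      unfolding alt_group_simps(2) by blast
    show "bar n w \<in> kernel (Wplus n) (alt_group (n + 1)) (alt_hom n)"
      if "w \<in> kernel (Wplus n) (alt_group (n + 1)) (alt_hom n)" for w
    proof -
      have w: "w \<in> carrier (Wplus n)" "alt_hom n w = id" using that by (auto simp: kernel_def)
      have "alt_hom n (bar n w) = id"
        unfolding alt_hom_bar[OF n3 w(1)] w(2) using adjacent_swap_comp_self[of 0] by simp
      moreover have "bar n w \<in> carrier (Wplus n)"
        using bar_auto[OF n3] w(1) by (auto simp: auto_def hom_def)
      ultimately show ?thesis by (simp add: kernel_def)
    qed
    show "M \<lhd> Wplus n" by (rule M)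
  qed
qed

theorem theorem5p2:
  fixes n :: nat
    and P :: "'a rel" and \<Phi> :: "'a set" and \<Psi> :: "nat set set"
    and \<sigma> :: "nat \<Rightarrow> 'a \<Rightarrow> 'a" and \<tau> :: "nat \<Rightarrow> nat set \<Rightarrow> nat set"
    and \<Gamma>P :: "('a \<Rightarrow> 'a) monoid" and \<Gamma>Q :: "(nat set \<Rightarrow> nat set) monoid"
    and M N :: "nat word set set"
  assumes "n \<ge> 4"
    and "chiral_polytope n P" and "finite (Field P)"
    and "\<Phi> \<in> flags P" and "\<Psi> \<in> flags (simplex n)"
    and "\<sigma> = chiral_rotation P \<Phi>" and "\<Gamma>P = rotation_group n P \<sigma>"
    and "\<tau> = regular_rotation (simplex n) \<Psi>" and "\<Gamma>Q = rotation_group n (simplex n) \<tau>"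
    and "M = defining_subgroup n \<Gamma>P \<sigma>"
    and "N = defining_subgroup n (mix_group n \<Gamma>P \<sigma> \<Gamma>Q \<tau>) (mix_gen \<sigma> \<tau>)"
    and "\<not> chirality_group n M \<cong> alt_group (n + 1)"
  shows "chiral_subgroup n N \<and>
    (\<lambda>C. M <#>\<^bsub>Wplus n\<^esub> C) \<in> iso (chirality_group n N) (chirality_group n M) \<and>
    chirality_group n N \<cong> chirality_group n M"
proof -
  have n3: "n \<ge> 3" using assms(1) by simp
  interpret P: chiral_poset n P \<Phi> by (rule chiral_poset_if_chiral_polytope[OF assms(2-4)])
  interpret Q: simplex_flag n \<Psi> by (rule simplex_flag.intro[OF assms(5)])
  let ?AP = "polytope_aut_group P" and ?AQ = "polytope_aut_group (simplex n)" and ?A = "alt_group (n + 1)"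
  have gP: "group ?AP" and gQ: "group ?AQ" by (rule group_polytope_aut_group)+
  have \<Gamma>P: "\<Gamma>P = subgroup_generated ?AP (\<sigma> ` {1..n - 1})"
    and \<Gamma>Q: "\<Gamma>Q = subgroup_generated ?AQ (\<tau> ` {1..n - 1})"
    unfolding assms(7,9) by (simp_all only: rotation_group_def)
  have relP: "Wplus_relations n ?AP \<sigma>" unfolding assms(6) by (rule P.Wplus_relations_rotations)
  have \<tau>: "\<tau> i = Q.perm_aut (alt_gen i)" if "1 \<le> i" "i \<le> n - 1" for i
    using Q.regular_rotation[OF that] unfolding assms(8) alt_gen_def .
  \<comment> \<open>The relations are carried over from the alternating group along
    \<open>perm_aut\<close>, which maps \<open>alt_gen\<close> to the rotations of the
    simplex.\<close>
  have relQ: "Wplus_relations n ?AQ \<tau>"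
    by (rule Wplus_relations_hom[OF alt_group_is_group[of "n + 1"] gQ Q.perm_aut_hom Wplus_relations_alt_gen[of n]])
      (rule \<tau>)
  have g\<Gamma>: "group \<Gamma>P" "group \<Gamma>Q"
    unfolding \<Gamma>P \<Gamma>Q using group.group_subgroup_generated gP gQ by blast+
  have rel\<Gamma>: "Wplus_relations n \<Gamma>P \<sigma>" "Wplus_relations n \<Gamma>Q \<tau>"
    unfolding \<Gamma>P \<Gamma>Q by (rule Wplus_relations_subgroup_generated[OF gP relP], rule Wplus_relations_subgroup_generated[OF gQ relQ])
  have M_eq: "M = defining_subgroup n ?AP \<sigma>"
    unfolding assms(10) \<Gamma>P by (rule defining_subgroup_subgroup_generated[OF gP relP])
  have "defining_subgroup n \<Gamma>Q \<tau> = defining_subgroup n ?AQ \<tau>"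
    unfolding \<Gamma>Q by (rule defining_subgroup_subgroup_generated[OF gQ relQ])
  \<comment> \<open>The embedding \<open>perm_aut\<close> identifies the simplex rotations with
    \<open>alt_gen\<close>, so the base flag \<open>\<Psi>\<close> disappears from the description
    of \<open>K\<close>.\<close>
  also have "\<dots> = kernel (Wplus n) ?A (alt_hom n)"
    by (rule defining_subgroup_eq_kernel[OF gQ relQ alt_group_is_group alt_hom(1) Q.perm_aut_hom Q.inj_on_perm_aut])
      (simp only: alt_hom(3) \<tau>)
  finally have K: "defining_subgroup n \<Gamma>Q \<tau> = kernel (Wplus n) ?A (alt_hom n)" .
  have N_eq: "N = M \<inter> kernel (Wplus n) ?A (alt_hom n)"
    unfolding assms(11) mix_group_def
      defining_subgroup_subgroup_generated[OF DirProd_group[OF g\<Gamma>] Wplus_relations_DirProd[OF rel\<Gamma>]]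
      defining_subgroup_DirProd[OF g\<Gamma>(1) rel\<Gamma>(1) g\<Gamma>(2) rel\<Gamma>(2)] K assms(10)[symmetric] by (rule HOL.refl)
  have "M \<lhd> Wplus n" unfolding M_eq by (rule normal_defining_subgroup[OF gP relP])
  then interpret mix: mix_with_simple_quotient "Wplus n" ?A "bar n" "alt_hom n" M by (rule mix_with_simplex[OF assms(1)])
  have "\<not> bar n ` M \<subseteq> M" unfolding M_eq assms(6) by (rule P.bar_image_not_subset[OF n3])
  then have "\<not> bar n ` N \<subseteq> N" unfolding N_eq by (rule mix.mix_chiral)
  then have "chiral_subgroup n N" unfolding chiral_subgroup_def by blast
  moreover have "(\<lambda>C. M <#>\<^bsub>Wplus n\<^esub> C) \<in> iso (chirality_group n N) (chirality_group n M)"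
    unfolding N_eq chirality_group_def by (rule mix.coset_map_iso)
  moreover then have "chirality_group n N \<cong> chirality_group n M" by (rule is_isoI)
  ultimately show ?thesis by blast
qed

end
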